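(* Let $M$ be a compact manifold, possibly with boundary, and let $\mathcal U$ be a finite family of closed balls or closed half-balls of $M$ whose interiors cover $M$. Let $f$ be a homeomorphism in $\mathrm{Homeo}_0(M)$. If $$\lim_{n\to+\infty}\frac{\mathrm{Frag}_{\mathcal U}(f^n)\,\log(\mathrm{Frag}_{\mathcal U}(f^n))}{n}=0,$$ then $f$ is a distortion element in $\mathrm{Homeo}_0(M)$.
   Context: $\mathrm{Homeo}_0(M)$ is the identity component of the group of (compactly supported) homeomorphisms of $M$. Let $d=\dim M$. Closed balls and half-balls. A closed ball of $M$ is the image of the closed unit ball under an embedding $\mathbb R^d\to M$. With $H^d=\{(x_1,\dots,x_d)\in\mathbb R^d: x_1\ge0\}$, a closed half-ball is the image of $B(0,1)\cap H^d$ ($B(0,1)$ the closed unit ball) under an embedding $p:H^d\to M$ with $p(\partial H^d)=p(H^d)\cap\partial M$. Fragmentation length. $\mathrm{Frag}_{\mathcal U}(g)$ is the minimal integer $n$ such that $g=f_1\circ\dots\circ f_n$ with each $f_i\in\mathrm{Homeo}_0(M)$ supported in one of the sets of $\mathcal U$ (such a decomposition always exists by the fragmentation lemma). If this integer is $0$, the product $0\log 0$ is read as $0$. Distortion. If $G$ is generated by a finite set $\mathcal G$, $l_{\mathcal G}(g)$ is the minimal length of a word in elements of $\mathcal G$ and their inverses representing $g$; $g$ is distorted in $G$ if $\lim_{n\to\infty} l_{\mathcal G}(g^n)/n=0$. In a general group $G$, $g$ is a distortion element if it belongs to a finitely generated subgroup of $G$ in which it is distorted. *)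

theory Defs
  imports "HOL-Analysis.Analysis" "HOL-Algebra.Algebra"
begin

section \<open>Topological manifolds with boundary, balls and half-balls\<close>

text \<open>Coordinates are numbered from 0, so the first coordinate of a point \<open>x\<close> of
  \<open>Euclidean_space d\<close> is \<open>x 0\<close>. For \<open>d = 0\<close> the half-space is the one-point space.\<close>

definition half_space :: "nat \<Rightarrow> (nat \<Rightarrow> real) topology" where
  "half_space d = subtopology (Euclidean_space d) {x. x 0 \<ge> 0}"

definition half_space_boundary :: "nat \<Rightarrow> (nat \<Rightarrow> real) set" where
  "half_space_boundary d = {x \<in> topspace (half_space d). x 0 = 0}"

definition unit_ball :: "nat \<Rightarrow> (nat \<Rightarrow> real) set" where
  "unit_ball d = {x \<in> topspace (Euclidean_space d). (\<Sum>i<d. (x i)\<^sup>2) \<le> 1}"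

definition manifold_with_boundary :: "nat \<Rightarrow> 'a topology \<Rightarrow> bool" where
  "manifold_with_boundary d M \<longleftrightarrow>
     Hausdorff_space M \<and> second_countable M \<and>
     (\<forall>x\<in>topspace M. \<exists>U V. openin M U \<and> x \<in> U \<and> openin (half_space d) V \<and>
        subtopology M U homeomorphic_space subtopology (half_space d) V)"

definition manifold_interior :: "nat \<Rightarrow> 'a topology \<Rightarrow> 'a set" where
  "manifold_interior d M =
     {x \<in> topspace M. \<exists>U V. openin M U \<and> x \<in> U \<and> openin (Euclidean_space d) V \<and>
        subtopology M U homeomorphic_space subtopology (Euclidean_space d) V}"

definition manifold_boundary :: "nat \<Rightarrow> 'a topology \<Rightarrow> 'a set" where
  "manifold_boundary d M = topspace M - manifold_interior d M"

definition closed_ball_of :: "nat \<Rightarrow> 'a topology \<Rightarrow> 'a set \<Rightarrow> bool" where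
  "closed_ball_of d M B \<longleftrightarrow>
     (\<exists>p. embedding_map (Euclidean_space d) M p \<and> B = p ` unit_ball d)"

definition closed_half_ball_of :: "nat \<Rightarrow> 'a topology \<Rightarrow> 'a set \<Rightarrow> bool" where
  "closed_half_ball_of d M B \<longleftrightarrow>
     (\<exists>p. embedding_map (half_space d) M p \<and>
          p ` half_space_boundary d = p ` topspace (half_space d) \<inter> manifold_boundary d M \<and>
          B = p ` (unit_ball d \<inter> topspace (half_space d)))"


section \<open>The group of homeomorphisms and its identity component\<close>

text \<open>As in \<open>BijGroup\<close>, maps are extensional, so that a homeomorphism is determined by its values
  on \<open>topspace M\<close>. Only compact \<open>M\<close> are considered below, so every homeomorphism has compact
  support and none is excluded on that account. The set of homeomorphisms carries the
  compact-open topology, which for compact \<open>M\<close> is the topology of uniform convergence.\<close>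

definition homeos :: "'a topology \<Rightarrow> ('a \<Rightarrow> 'a) set" where
  "homeos M = {f \<in> extensional (topspace M). homeomorphic_map M M f}"

definition homeo_topology :: "'a topology \<Rightarrow> ('a \<Rightarrow> 'a) topology" where
  "homeo_topology M =
     topology_generated_by {{f \<in> homeos M. f ` K \<subseteq> U} | K U. compactin M K \<and> openin M U}"

definition Homeo0 :: "'a topology \<Rightarrow> ('a \<Rightarrow> 'a) monoid" where
  "Homeo0 M = (BijGroup (topspace M))
     \<lparr>carrier := connected_component_of_set (homeo_topology M) \<one>\<^bsub>BijGroup (topspace M)\<^esub>\<rparr>"

definition homeo_support :: "'a topology \<Rightarrow> ('a \<Rightarrow> 'a) \<Rightarrow> 'a set" where
  "homeo_support M f = M closure_of {x \<in> topspace M. f x \<noteq> x}"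


section \<open>Fragmentation length\<close>

text \<open>The length is taken in \<^typ>\<open>enat\<close>, with value \<open>\<infinity>\<close> for a map that has no decomposition.
  For compact \<open>M\<close> covered by the interiors of the sets in \<open>\<U>\<close>, the fragmentation lemma says
  that this value does not occur on the identity component.\<close>

definition Frag :: "'a topology \<Rightarrow> 'a set set \<Rightarrow> ('a \<Rightarrow> 'a) \<Rightarrow> enat" where
  "Frag M \<U> g = (INF fs \<in> {fs. set fs \<subseteq> carrier (Homeo0 M) \<and>
                              (\<forall>h\<in>set fs. \<exists>U\<in>\<U>. homeo_support M h \<subseteq> U) \<and>
                              g = foldr (\<otimes>\<^bsub>Homeo0 M\<^esub>) fs \<one>\<^bsub>Homeo0 M\<^esub>}. enat (length fs))"

text \<open>Since \<open>ln 0 = 0\<close> in HOL, the value at 0 is 0.\<close>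

definition xlogx :: "enat \<Rightarrow> ereal" where
  "xlogx k = (case k of enat m \<Rightarrow> ereal (real m * ln (real m)) | \<infinity> \<Rightarrow> \<infinity>)"


section \<open>Distortion\<close>

text \<open>\<open>word_length G S g\<close> is meaningful only for \<open>g\<close> in the subgroup generated by \<open>S\<close>.\<close>

definition word_length :: "('g, 'b) monoid_scheme \<Rightarrow> 'g set \<Rightarrow> 'g \<Rightarrow> nat" where
  "word_length G S g =
     (LEAST n. \<exists>ws. length ws = n \<and> set ws \<subseteq> S \<union> m_inv G ` S \<and>
                    g = foldr (\<otimes>\<^bsub>G\<^esub>) ws \<one>\<^bsub>G\<^esub>)"

text \<open>Word lengths for two finite generating sets are bounded by constant multiples of each other,
  so it does not matter which finite generating set is taken.\<close>

definition distorted_in :: "('g, 'b) monoid_scheme \<Rightarrow> 'g \<Rightarrow> bool" where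
  "distorted_in G g \<longleftrightarrow>
     g \<in> carrier G \<and>
     (\<exists>S. finite S \<and> S \<subseteq> carrier G \<and> generate G S = carrier G \<and>
          (\<lambda>n. real (word_length G S (g [^]\<^bsub>G\<^esub> n)) / real n) \<longlonglongrightarrow> 0)"

definition distortion_element :: "('g, 'b) monoid_scheme \<Rightarrow> 'g \<Rightarrow> bool" where
  "distortion_element G g \<longleftrightarrow>
     (\<exists>H. subgroup H G \<and> distorted_in (G\<lparr>carrier := H\<rparr>) g)"

end

(*
  Every sequence of homeomorphisms h_n supported in a ball B lies in a finitely generated group in which
  h_n has word length O(log n).  Take a contraction t with B, t B, t^2 B, ... pairwise disjoint and two
  maps s_0, s_1 sending a larger ball B' into disjoint parts of itself, let v_n be the word in s_0, s_1
  given by a binary prefix code of n, and let A act on v_n t^i B as the conjugate of h_n by v_n t^i.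
  Then a = v_n^-1 A v_n acts on B' as the product of all t^i h_n t^-i, so h_n is the commutator [a, t].

  Half-balls are treated in the same way by translating along the boundary, except in dimension 1, where
  the end point cannot be moved.  There a homeomorphism is an order automorphism of the line.  A fast
  change of coordinates makes the whole (batched) family of bounded displacement, and a map of small
  displacement is a product of four maps which, after a translation, are supported in the intervals
  [2j, 2j+1); to these the commutator argument applies in all intervals at once.

  Finally f^n is a product of Frag(f^n) factors supported in the sets of the cover.  Realizing the
  factors of f^(n_k) for a sparse sequence n_k makes the length of f^(n_k) at most
  C Frag(f^(n_k)) (k + log Frag(f^(n_k))), which is o(n_k), and subadditivity gives distortion.
*)

theory Submission
  imports Defs "HOL-Homology.Invariance_of_Domain"
begin

section \<open>Word length in groups\<close>

text \<open>The form of the hypothesis comes from counting: each of the Frag(f^n) factors is one of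
  Frag(f^n) members of its batch, and a binary name for it costs about log Frag(f^n) letters.

  All conjugates of all factors are stored in the one map A, and the obstacle is that this infinite
  product must again be a homeomorphism. In the cones the pieces shrink, both under the words and
  under t, and the product is a uniform limit. On the line no convergence is involved: an increasing
  surjection is continuous. This is why the half-ball of dimension 1 is opened up to a line by a
  logistic coordinate, in which germs at the fixed end point become germs at infinity. Such germs
  cannot be moved into disjoint copies, hence the reduction to unit intervals.

  Continuing a map from a ball to the manifold by the identity is continuous because the image of
  the embedding is open. This rests on invariance of domain and, for half-balls, on the condition on
  the boundary. The Alexander isotopy, available because the models are cones, puts the continued
  maps into the identity component.\<close>

definition word_ball :: "('g, 'b) monoid_scheme \<Rightarrow> 'g set \<Rightarrow> nat \<Rightarrow> 'g set" where
  "word_ball G S n =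
     {foldr (\<otimes>\<^bsub>G\<^esub>) ws \<one>\<^bsub>G\<^esub> | ws. length ws \<le> n \<and> set ws \<subseteq> S \<union> m_inv G ` S}"

lemma word_ball_mono: "m \<le> n \<Longrightarrow> S \<subseteq> S' \<Longrightarrow> word_ball G S m \<subseteq> word_ball G S' n"
  unfolding word_ball_def by fastforce

lemma word_ballI: "length ws \<le> n \<Longrightarrow> set ws \<subseteq> S \<union> m_inv G ` S \<Longrightarrow>
    foldr (\<otimes>\<^bsub>G\<^esub>) ws \<one>\<^bsub>G\<^esub> \<in> word_ball G S n"
  unfolding word_ball_def by blast

lemma one_in_word_ball: "\<one>\<^bsub>G\<^esub> \<in> word_ball G S n"
  using word_ballI[of "[]"] by fastforce

lemma word_length_le:
  assumes "g \<in> word_ball G S n" shows "word_length G S g \<le> n"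
proof -
  obtain ws where ws: "g = foldr (\<otimes>\<^bsub>G\<^esub>) ws \<one>\<^bsub>G\<^esub>" "length ws \<le> n" "set ws \<subseteq> S \<union> m_inv G ` S"
    using assms unfolding word_ball_def by blast
  have "word_length G S g \<le> length ws"
    unfolding word_length_def by (rule Least_le) (use ws in blast)
  then show ?thesis using ws by simp
qed

context group
begin

lemma foldr_closed: "set ws \<subseteq> carrier G \<Longrightarrow> foldr (\<otimes>) ws \<one> \<in> carrier G"
  by (induction ws) auto

lemma foldr_append: "set us \<subseteq> carrier G \<Longrightarrow> set ws \<subseteq> carrier G \<Longrightarrow>
   foldr (\<otimes>) (us @ ws) \<one> = foldr (\<otimes>) us \<one> \<otimes> foldr (\<otimes>) ws \<one>"
  by (induction us) (auto simp: foldr_closed m_assoc simp del: foldr_append)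

lemma foldr_inv: "set ws \<subseteq> carrier G \<Longrightarrow>
   inv (foldr (\<otimes>) ws \<one>) = foldr (\<otimes>) (rev (map (m_inv G) ws)) \<one>"
proof (induction ws)
  case (Cons a ws)
  then have "inv (foldr (\<otimes>) (a # ws) \<one>) = inv (foldr (\<otimes>) ws \<one>) \<otimes> inv a"
    by (simp add: foldr_closed inv_mult_group)
  also have "\<dots> = foldr (\<otimes>) (rev (map (m_inv G) ws) @ [inv a]) \<one>"
    using Cons by (subst foldr_append) auto
  finally show ?case by simp
qed simp

lemma gens_closed: "S \<subseteq> carrier G \<Longrightarrow> S \<union> m_inv G ` S \<subseteq> carrier G"
  by auto

lemma word_ball_closed: "S \<subseteq> carrier G \<Longrightarrow> word_ball G S n \<subseteq> carrier G"
  unfolding word_ball_def by (auto intro!: foldr_closed)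

lemma word_ball_mult:
  assumes "S \<subseteq> carrier G" "a \<in> word_ball G S m" "b \<in> word_ball G S n"
  shows "a \<otimes> b \<in> word_ball G S (m + n)"
proof -
  obtain us ws where us: "a = foldr (\<otimes>) us \<one>" "length us \<le> m" "set us \<subseteq> S \<union> m_inv G ` S"
    and ws: "b = foldr (\<otimes>) ws \<one>" "length ws \<le> n" "set ws \<subseteq> S \<union> m_inv G ` S"
    using assms unfolding word_ball_def by blast
  have "foldr (\<otimes>) (us @ ws) \<one> = a \<otimes> b"
    unfolding us ws using us(3) ws(3) gens_closed[OF assms(1)] by (intro foldr_append) auto
  then show ?thesis using word_ballI[of "us @ ws" "m + n" S G] us ws by auto
qed

lemma word_ball_inv:
  assumes S: "S \<subseteq> carrier G" and "a \<in> word_ball G S n"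
  shows "inv a \<in> word_ball G S n"
proof -
  obtain us where us: "a = foldr (\<otimes>) us \<one>" "length us \<le> n" "set us \<subseteq> S \<union> m_inv G ` S"
    using assms unfolding word_ball_def by blast
  have "inv a = foldr (\<otimes>) (rev (map (m_inv G) us)) \<one>"
    unfolding us using us(3) gens_closed[OF S] by (intro foldr_inv) auto
  moreover have "m_inv G ` set us \<subseteq> S \<union> m_inv G ` S"
    using us(3) S by (force simp: subset_iff)
  ultimately show ?thesis using word_ballI[of "rev (map (m_inv G) us)" n S G] us by auto
qed

lemma word_ball_gen: "S \<subseteq> carrier G \<Longrightarrow> s \<in> S \<Longrightarrow> 1 \<le> n \<Longrightarrow> s \<in> word_ball G S n"
  using word_ballI[of "[s]" n S G] by (auto simp: subset_iff)

lemma word_ball_pow: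
  assumes "S \<subseteq> carrier G" "a \<in> word_ball G S m"
  shows "a [^] (k::nat) \<in> word_ball G S (k * m)"
proof (induction k)
  case (Suc k)
  show ?case using word_ball_mult[OF assms(1) Suc assms(2)] by (simp add: add.commute)
qed (simp add: one_in_word_ball)

lemma word_ball_foldr:
  assumes "S \<subseteq> carrier G" "\<forall>a\<in>set ws. a \<in> word_ball G S m"
  shows "foldr (\<otimes>) ws \<one> \<in> word_ball G S (length ws * m)"
  using assms(2)
proof (induction ws)
  case (Cons a ws)
  then show ?case using word_ball_mult[OF assms(1), of a m _ "length ws * m"] by simp
qed (simp add: one_in_word_ball)

end

lemma word_ball_hom:
  assumes "group_hom G H \<phi>" "S \<subseteq> carrier G" "a \<in> word_ball G S n"
  shows "\<phi> a \<in> word_ball H (\<phi> ` S) n"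
proof -
  interpret group_hom G H \<phi> by fact
  obtain us where us: "a = foldr (\<otimes>\<^bsub>G\<^esub>) us \<one>\<^bsub>G\<^esub>" "length us \<le> n" "set us \<subseteq> S \<union> m_inv G ` S"
    using assms unfolding word_ball_def by blast
  have "set us \<subseteq> carrier G" using us(3) assms(2) by auto
  then have "\<phi> (foldr (\<otimes>\<^bsub>G\<^esub>) us \<one>\<^bsub>G\<^esub>) = foldr (\<otimes>\<^bsub>H\<^esub>) (map \<phi> us) \<one>\<^bsub>H\<^esub>"
    by (induction us) (auto simp: G.foldr_closed)
  moreover have "\<phi> ` set us \<subseteq> \<phi> ` S \<union> m_inv H ` \<phi> ` S"
  proof
    fix y assume "y \<in> \<phi> ` set us"
    then obtain x where x: "x \<in> set us" "y = \<phi> x" by blast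
    then consider "x \<in> S" | z where "z \<in> S" "x = inv\<^bsub>G\<^esub> z" using us(3) by blast
    then show "y \<in> \<phi> ` S \<union> m_inv H ` \<phi> ` S"
    proof cases
      case 2
      then have "y = inv\<^bsub>H\<^esub> (\<phi> z)" using x assms(2) by auto
      then show ?thesis using 2 by blast
    qed (use x in blast)
  qed
  ultimately show ?thesis using word_ballI[of "map \<phi> us" n "\<phi> ` S" H] us by auto
qed

subsection \<open>A prefix code for the natural numbers\<close>

text \<open>Binary digits, lowest first, each announced by \<open>True\<close>, and a final
  \<open>False\<close>. The markers make the code prefix-free at the price of doubling the number of
  digits.\<close>

fun code :: "nat \<Rightarrow> bool list" where
  "code n = (if n = 0 then [False] else True # odd n # code (n div 2))"

declare code.simps [simp del]

lemma code_0: "code 0 = [False]" and code_pos: "n \<noteq> 0 \<Longrightarrow> code n = True # odd n # code (n div 2)"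
  by (subst code.simps; simp)+

lemma length_code_le: "n < 2 ^ b \<Longrightarrow> length (code n) \<le> 2 * b + 1"
proof (induction b arbitrary: n)
  case (Suc b)
  then have "n div 2 < 2 ^ b" by auto
  from Suc.IH[OF this] show ?case by (subst code.simps) auto
qed (simp add: code.simps)

text \<open>A crude converse bound: only finitely many numbers have codes of bounded length. This
  makes the index sets of the partial products finite later on.\<close>

lemma less_two_power_length_code: "n < 2 ^ length (code n)"
proof (induction n rule: less_induct)
  case (less n)
  show ?case
  proof (cases "n = 0")
    case False
    then have "n div 2 < 2 ^ length (code (n div 2))" by (intro less) auto
    moreover have "length (code n) = Suc (Suc (length (code (n div 2))))"
      using False by (subst code.simps) simp
    ultimately show ?thesis by simp
  qed simp
qed

text \<open>The pairing function grows quadratically, so its value has about twice as many digits as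
  the larger argument. For \<open>k\<close> the wasteful \<open>k + 1 \<le> 2 ^ k\<close> is
  affordable, because the cost may be linear in \<open>k\<close>.\<close>

lemma length_code_prod_encode: "length (code (prod_encode (k, i))) \<le> 5 * (1 + k + length (code i))"
proof -
  let ?L = "length (code i)"
  have i: "i < 2 ^ ?L" by (rule less_two_power_length_code)
  have k: "k + 1 \<le> 2 ^ k" by (simp add: Suc_leI)
  have L: "1 \<le> ?L" by (subst code.simps) simp
  have "k + i + 1 < 2 ^ k + 2 ^ ?L" using i k by linarith
  also have "\<dots> \<le> 2 ^ (k + ?L) + 2 ^ (k + ?L)" by (intro add_mono power_increasing) auto
  also have "\<dots> = 2 ^ (k + ?L + 1)" by simp
  finally have a: "k + i + 1 < 2 ^ (k + ?L + 1)" .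
  have "prod_encode (k, i) \<le> (k + i) * (k + i + 1) div 2 + k"
    by (simp add: prod_encode_def triangle_def)
  also have "\<dots> < (k + i + 1) * (k + i + 1)"
  proof -
    have "(k + i) * (k + i + 1) div 2 \<le> (k + i) * (k + i + 1)" by (rule div_le_dividend)
    then show ?thesis by (simp add: algebra_simps)
  qed
  also have "\<dots> \<le> 2 ^ (k + ?L + 1) * 2 ^ (k + ?L + 1)" using a by (intro mult_mono) auto
  also have "\<dots> = 2 ^ (2 * (k + ?L + 1))" by (simp only: mult_2 power_add)
  finally have "length (code (prod_encode (k, i))) \<le> 2 * (2 * (k + ?L + 1)) + 1"
    by (rule length_code_le)
  then show ?thesis by (simp add: algebra_simps)
qed

lemma length_code_le_log:
  assumes "i < l" shows "real (length (code i)) \<le> 3 + 2 * log 2 (real l)"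
proof -
  define b where "b = nat \<lceil>log 2 (real l)\<rceil>"
  have l: "l \<ge> 1" using assms by simp
  have "real l = 2 powr (log 2 (real l))" using l by simp
  also have "\<dots> \<le> 2 powr (real b)" unfolding b_def by (intro powr_mono) linarith+
  also have "\<dots> = real (2 ^ b)" by (simp add: powr_realpow)
  finally have "l \<le> 2 ^ b" by linarith
  then have "length (code i) \<le> 2 * b + 1" using assms by (intro length_code_le) simp
  moreover have "real b \<le> log 2 (real l) + 1"
    unfolding b_def using l by simp
  ultimately show ?thesis by linarith
qed

subsection \<open>Realization of countable families in finitely generated subgroups\<close>

text \<open>The \<open>k\<close>-th batch of the family may be penalized by \<open>k\<close>, because the powers of \<open>f\<close> to which
  this is applied can be chosen as sparse as needed; within a batch the length must be logarithmic.
  The batches are finite because the half-ball of dimension 1 requires this.\<close>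

abbreviation realized ::
  "('g, 'b) monoid_scheme \<Rightarrow> (nat \<Rightarrow> nat) \<Rightarrow> (nat \<Rightarrow> nat \<Rightarrow> 'g) \<Rightarrow> bool" where
  "realized G N h \<equiv> \<exists>S C. finite S \<and> S \<subseteq> carrier G \<and>
     (\<forall>k i. i < N k \<longrightarrow> h k i \<in> word_ball G S (C * (1 + k + length (code i))))"

text \<open>The finite set and the constant may depend on the family. This is essential: one of the
  generators will encode all members of the family at once.\<close>

definition log_realizable :: "('g, 'b) monoid_scheme \<Rightarrow> 'g set \<Rightarrow> bool" where
  "log_realizable G P \<longleftrightarrow> (\<forall>h N. (\<forall>k. \<forall>i<N k. h k i \<in> P) \<longrightarrow> realized G N h)"

lemma log_realizableD:
  fixes N :: "nat \<Rightarrow> nat"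
  assumes "log_realizable G P" "\<And>k i. i < N k \<Longrightarrow> h k i \<in> P"
  shows "realized G N h"
  using assms unfolding log_realizable_def by blast

lemma log_realizableI:
  assumes "\<And>h N. (\<And>k i. i < N k \<Longrightarrow> h k i \<in> P) \<Longrightarrow> realized G N h"
  shows "log_realizable G P"
  using assms unfolding log_realizable_def by simp

lemma log_realizable_subset:
  assumes "log_realizable G P" "Q \<subseteq> P" shows "log_realizable G Q"
proof (rule log_realizableI)
  fix h and N :: "nat \<Rightarrow> nat" assume "\<And>k i. i < N k \<Longrightarrow> h k i \<in> Q"
  then have "\<And>k i. i < N k \<Longrightarrow> h k i \<in> P" using assms(2) by auto
  then show "realized G N h"
    by (rule log_realizableD[OF assms(1)])
qed

text \<open>Carries the result from the model groups to \<open>Homeo0 M\<close>: choose preimages in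
  \<open>P\<close>, realize those, and map the generators.\<close>

lemma log_realizable_hom:
  assumes "group_hom G H \<phi>" "log_realizable G P" "Q \<subseteq> \<phi> ` P"
  shows "log_realizable H Q"
proof (rule log_realizableI)
  interpret group_hom G H \<phi> by fact
  fix h and N :: "nat \<Rightarrow> nat" assume "\<And>k i. i < N k \<Longrightarrow> h k i \<in> Q"
  then have "\<forall>k i. \<exists>g. i < N k \<longrightarrow> g \<in> P \<and> h k i = \<phi> g" using assms(3) by blast
  then obtain g where "\<forall>k i. i < N k \<longrightarrow> g k i \<in> P \<and> h k i = \<phi> (g k i)"
    by metis
  then have g: "\<And>k i. i < N k \<Longrightarrow> g k i \<in> P" "\<And>k i. i < N k \<Longrightarrow> h k i = \<phi> (g k i)"
    by auto
  obtain S C where S: "finite S" "S \<subseteq> carrier G"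
    "\<forall>k i. i < N k \<longrightarrow> g k i \<in> word_ball G S (C * (1 + k + length (code i)))"
    using log_realizableD[OF assms(2), of N g, OF g(1)] by blast
  have "\<phi> ` S \<subseteq> carrier H" using S(2) by auto
  then show "realized H N h"
    using S g(2) word_ball_hom[OF assms(1) S(2)]
    by (intro exI[of _ "\<phi> ` S"] exI[of _ C]) simp
qed

context group
begin

text \<open>Factor each member of the family, realize the left and the right factors as two separate
  families, and unite the generators.\<close>

lemma log_realizable_mult:
  assumes "log_realizable G P" "log_realizable G Q"
    and R: "\<And>r. r \<in> R \<Longrightarrow> \<exists>p\<in>P. \<exists>q\<in>Q. r = p \<otimes> q"
  shows "log_realizable G R"
proof (rule log_realizableI)
  fix h and N :: "nat \<Rightarrow> nat" assume "\<And>k i. i < N k \<Longrightarrow> h k i \<in> R"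
  then have "\<forall>k i. \<exists>p q. i < N k \<longrightarrow> p \<in> P \<and> q \<in> Q \<and> h k i = p \<otimes> q" using R by meson
  then obtain p q where "\<forall>k i. i < N k \<longrightarrow> p k i \<in> P \<and> q k i \<in> Q \<and> h k i = p k i \<otimes> q k i"
    by metis
  then have pq: "\<And>k i. i < N k \<Longrightarrow> p k i \<in> P" "\<And>k i. i < N k \<Longrightarrow> q k i \<in> Q"
      "\<And>k i. i < N k \<Longrightarrow> h k i = p k i \<otimes> q k i"
    by auto
  obtain S C where S: "finite S" "S \<subseteq> carrier G"
    "\<forall>k i. i < N k \<longrightarrow> p k i \<in> word_ball G S (C * (1 + k + length (code i)))"
    using log_realizableD[OF assms(1), of N p, OF pq(1)] by blast
  obtain S' C' where S': "finite S'" "S' \<subseteq> carrier G"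
    "\<forall>k i. i < N k \<longrightarrow> q k i \<in> word_ball G S' (C' * (1 + k + length (code i)))"
    using log_realizableD[OF assms(2), of N q, OF pq(2)] by blast
  have "h k i \<in> word_ball G (S \<union> S') ((C + C') * (1 + k + length (code i)))" if "i < N k" for k i
  proof -
    have "p k i \<otimes> q k i \<in> word_ball G (S \<union> S')
        (C * (1 + k + length (code i)) + C' * (1 + k + length (code i)))"
    proof (rule word_ball_mult)
      show "p k i \<in> word_ball G (S \<union> S') (C * (1 + k + length (code i)))"
        using S(3) that word_ball_mono[of _ _ S "S \<union> S'"] by blast
      show "q k i \<in> word_ball G (S \<union> S') (C' * (1 + k + length (code i)))"
        using S'(3) that word_ball_mono[of _ _ S' "S \<union> S'"] by blast
    qed (use S S' in auto)
    then show ?thesis using pq(3)[OF that] by (simp add: algebra_simps)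
  qed
  then show "realized G N h"
    using S S' by (intro exI[of _ "S \<union> S'"] exI[of _ "C + C'"]) auto
qed

lemma log_realizable_singleton: "c \<in> carrier G \<Longrightarrow> log_realizable G {c}"
proof (rule log_realizableI)
  fix h and N :: "nat \<Rightarrow> nat"
  assume "c \<in> carrier G" "\<And>k i. i < N k \<Longrightarrow> h k i \<in> {c}"
  then show "realized G N h"
    by (intro exI[of _ "{c}"] exI[of _ 1]) (auto intro!: word_ball_gen)
qed

lemma log_realizable_conj:
  assumes "log_realizable G P" "c \<in> carrier G"
    and R: "\<And>r. r \<in> R \<Longrightarrow> \<exists>p\<in>P. r = c \<otimes> p \<otimes> inv c"
  shows "log_realizable G R"
proof (rule log_realizable_mult)
  show "log_realizable G {c \<otimes> p | p. p \<in> P}"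
    by (rule log_realizable_mult[OF log_realizable_singleton[OF assms(2)] assms(1)]) auto
  show "log_realizable G {inv c}" by (rule log_realizable_singleton) (use assms in auto)
qed (use R in blast)

text \<open>With the identity adjoined to both sets, every element of the union is a product of an
  element of \<open>P\<close> and one of \<open>Q\<close>, so the statement on products
  applies.\<close>

lemma log_realizable_Un:
  assumes "log_realizable G P" "log_realizable G Q"
  shows "log_realizable G (P \<union> Q)"
proof -
  have "log_realizable G (insert \<one> P')" if P': "log_realizable G P'" for P'
  proof (rule log_realizableI)
    fix h and N :: "nat \<Rightarrow> nat" assume h: "\<And>k i. i < N k \<Longrightarrow> h k i \<in> insert \<one> P'"
    show "realized G N h"
    proof (cases "P' = {}")
      case True
      then show ?thesis using h by (intro exI[of _ "{}"]) (auto simp: one_in_word_ball)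
    next
      case False
      then obtain q where q: "q \<in> P'" by blast
      \<comment> \<open>Entries outside \<open>P'\<close> are equal to the identity, which has
        length 0; they are replaced by a fixed \<open>q\<close> only to obtain a family in
        \<open>P'\<close>.\<close>
      define h' where "h' = (\<lambda>k i. if h k i \<in> P' then h k i else q)"
      have h': "h' k i \<in> P'" if "i < N k" for k i using q by (simp add: h'_def)
      obtain S C where S: "finite S" "S \<subseteq> carrier G"
        "\<forall>k i. i < N k \<longrightarrow> h' k i \<in> word_ball G S (C * (1 + k + length (code i)))"
        using log_realizableD[OF P', of N h', OF h'] by blast
      have "h k i \<in> word_ball G S (C * (1 + k + length (code i)))" if i: "i < N k" for k i
      proof (cases "h k i \<in> P'")
        case True
        then show ?thesis using S(3)[rule_format, OF i] by (simp add: h'_def)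
      next
        case False
        then show ?thesis using h[OF i] one_in_word_ball[of G] by simp
      qed
      then show ?thesis using S by blast
    qed
  qed
  note ins = this
  \<comment> \<open>Realizing the family constant at \<open>x\<close> puts \<open>x\<close> into a
    word ball and hence into the group.\<close>
  have car: "P \<subseteq> carrier G" if P: "log_realizable G P" for P
  proof
    fix x assume "x \<in> P"
    then obtain S C where S: "S \<subseteq> carrier G"
        "\<forall>k i::nat. i < 1 \<longrightarrow> x \<in> word_ball G S (C * (1 + k + length (code i)))"
      using log_realizableD[OF P, of "\<lambda>_. 1" "\<lambda>_ _. x", OF \<open>x \<in> P\<close>] by blast
    then show "x \<in> carrier G" using word_ball_closed[OF S(1)] S(2) by blast
  qed
  have "\<exists>p\<in>insert \<one> P. \<exists>q\<in>insert \<one> Q. r = p \<otimes> q" if r: "r \<in> P \<union> Q" for r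
  proof (cases "r \<in> P")
    case True
    then show ?thesis using car[OF assms(1)] by (intro bexI[of _ r] bexI[of _ \<one>]) auto
  next
    case False
    then show ?thesis using r car[OF assms(2)] by (intro bexI[of _ \<one>] bexI[of _ r]) auto
  qed
  then show ?thesis by (rule log_realizable_mult[OF ins[OF assms(1)] ins[OF assms(2)]])
qed

lemma log_realizable_UN:
  assumes "finite I" "\<And>i. i \<in> I \<Longrightarrow> log_realizable G (P i)"
  shows "log_realizable G (\<Union>i\<in>I. P i)"
  using assms
proof (induction I)
  case empty
  show ?case unfolding log_realizable_def by auto
next
  case (insert i I)
  then show ?case using log_realizable_Un by simp
qed

end

section \<open>Distortion from short powers along a sparse sequence\<close>

lemma nat_le_xlnx: "real l \<le> 3 + real l * ln (real l)"
proof (cases "l \<ge> 3")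
  case True
  have "exp (1::real) \<le> real l" using exp_le True by linarith
  then have "1 \<le> ln (real l)" using True by (subst ln_ge_iff) auto
  then have "real l * 1 \<le> real l * ln (real l)" by (intro mult_left_mono) auto
  then show ?thesis by simp
next
  case False
  then have "0 \<le> real l * ln (real l)" by (cases "l = 0") auto
  then show ?thesis using False by linarith
qed

lemma (in group) word_length_subgroup:
  assumes "subgroup H G" "S \<subseteq> H"
  shows "word_length (G\<lparr>carrier := H\<rparr>) S g = word_length G S g"
proof -
  have "m_inv (G\<lparr>carrier := H\<rparr>) ` S = m_inv G ` S"
    using assms by (intro image_cong) (auto simp: m_inv_consistent)
  then show ?thesis unfolding word_length_def by simp
qed

lemma (in group) distortion_elementI:
  fixes fs :: "nat \<Rightarrow> 'a list"
  assumes P: "log_realizable G P" and f: "f \<in> carrier G"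
    and ev: "\<forall>\<^sub>F n in sequentially. set (fs n) \<subseteq> P \<and> f [^] n = foldr (\<otimes>) (fs n) \<one>"
    and lim: "(\<lambda>n. real (length (fs n)) * ln (real (length (fs n))) / real n) \<longlonglongrightarrow> 0"
  shows "distortion_element G f"
proof -
  define l where "l = (\<lambda>n. length (fs n))"
  have lim': "(\<lambda>n. real (l n) * ln (real (l n)) / real n) \<longlonglongrightarrow> 0"
    using lim by (simp add: l_def)
  \<comment> \<open>From 3 on the logarithm is at least 1, so \<open>l\<close> is dominated by
    \<open>l * ln l\<close> up to a constant and the hypothesis also controls
    \<open>l / n\<close>.\<close>
  have l0: "(\<lambda>n. real (l n) / real n) \<longlonglongrightarrow> 0"
  proof (rule tendsto_sandwich[where f = "\<lambda>_. 0"])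
    show "(\<lambda>n. 3 / real n + real (l n) * ln (real (l n)) / real n) \<longlonglongrightarrow> 0"
      using tendsto_add[OF lim_const_over_n[of 3] lim'] by simp
    show "\<forall>\<^sub>F n in sequentially. real (l n) / real n \<le> 3 / real n + real (l n) * ln (real (l n)) / real n"
      using nat_le_xlnx by (intro always_eventually allI)
        (simp add: add_divide_distrib[symmetric] divide_right_mono)
  qed auto
  \<comment> \<open>Up to the factor \<open>C\<close>, the length per power of \<open>f\<close> if
    the factors of \<open>f [^] n\<close> form the \<open>k\<close>-th batch. The 4 is the 1 of
    \<open>1 + k + length (code i)\<close> plus the 3 of \<open>length_code_le_log\<close>.\<close>
  define c where "c = (\<lambda>k n. real (l n) * (4 + real k + 2 * log 2 (real (l n))) / real n)"
  have c0: "c k \<longlonglongrightarrow> 0" for k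
  proof -
    have "(\<lambda>n. (4 + real k) * (real (l n) / real n) + 2 / ln 2 * (real (l n) * ln (real (l n)) / real n))
        \<longlonglongrightarrow> (4 + real k) * 0 + 2 / ln 2 * 0"
      by (intro tendsto_intros l0 lim')
    moreover have "c k = (\<lambda>n. (4 + real k) * (real (l n) / real n) + 2 / ln 2 * (real (l n) * ln (real (l n)) / real n))"
      by (rule ext) (simp add: c_def log_def ring_distribs add_divide_distrib mult_ac)
    ultimately show ?thesis by simp
  qed
  \<comment> \<open>For fixed \<open>k\<close> the penalty is a constant, which a sufficiently large
    \<open>n\<close> absorbs; \<open>\<nu> k\<close> is such an \<open>n\<close>.\<close>
  have "\<exists>n>0. (set (fs n) \<subseteq> P \<and> f [^] n = foldr (\<otimes>) (fs n) \<one>) \<and> c k n < 1 / (real k + 1)" for k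
  proof -
    have "\<forall>\<^sub>F n in sequentially. c k n < 1 / (real k + 1)"
      by (rule order_tendstoD[OF c0]) auto
    then have "\<forall>\<^sub>F n in sequentially. n > 0 \<and> (set (fs n) \<subseteq> P \<and> f [^] n = foldr (\<otimes>) (fs n) \<one>)
        \<and> c k n < 1 / (real k + 1)"
      using ev eventually_gt_at_top[of 0] by eventually_elim auto
    then show ?thesis by (rule eventually_happens'[rotated]) simp
  qed
  then obtain \<nu> where "\<forall>k. \<nu> k > 0 \<and> (set (fs (\<nu> k)) \<subseteq> P \<and> f [^] \<nu> k = foldr (\<otimes>) (fs (\<nu> k)) \<one>)
       \<and> c k (\<nu> k) < 1 / (real k + 1)"
    by metis
  then have \<nu>: "\<nu> k > 0" "set (fs (\<nu> k)) \<subseteq> P" "f [^] \<nu> k = foldr (\<otimes>) (fs (\<nu> k)) \<one>"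
     "c k (\<nu> k) < 1 / (real k + 1)" for k by auto
  have hP: "fs (\<nu> k) ! i \<in> P" if "i < l (\<nu> k)" for k i
    using \<nu>(2)[of k] that by (auto simp: l_def)
  obtain S C where S: "finite S" "S \<subseteq> carrier G"
     and h: "\<forall>k i. i < l (\<nu> k) \<longrightarrow> fs (\<nu> k) ! i \<in> word_ball G S (C * (1 + k + length (code i)))"
    using log_realizableD[OF P, of "\<lambda>k. l (\<nu> k)" "\<lambda>k i. fs (\<nu> k) ! i", OF hP] by blast
  \<comment> \<open>With \<open>f\<close> among the generators, the remainder of \<open>n\<close>
    modulo \<open>\<nu> k\<close>, bounded for fixed \<open>k\<close>, can be spelled out letter by
    letter.\<close>
  define S' where "S' = insert f S"
  define H where "H = generate G S'"
  have S': "finite S'" "S' \<subseteq> carrier G" "S \<subseteq> S'" "f \<in> S'"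
    using S f by (auto simp: S'_def)
  have H: "subgroup H G" "S' \<subseteq> H"
    using generate_is_subgroup[OF S'(2)] generate.incl[of _ S' G] by (auto simp: H_def)
  have pow: "\<exists>A::nat. f [^] \<nu> k \<in> word_ball G S' A \<and> real A \<le> real C / (real k + 1) * real (\<nu> k)" for k
  proof -
    define b where "b = nat \<lfloor>real C * (4 + real k + 2 * log 2 (real (l (\<nu> k))))\<rfloor>"
    have "\<forall>a\<in>set (fs (\<nu> k)). a \<in> word_ball G S' b"
    proof
      fix a assume "a \<in> set (fs (\<nu> k))"
      then obtain i where i: "i < l (\<nu> k)" "a = fs (\<nu> k) ! i"
        unfolding l_def by (metis in_set_conv_nth)
      have "real (C * (1 + k + length (code i))) \<le> real C * (4 + real k + 2 * log 2 (real (l (\<nu> k))))"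
        unfolding of_nat_mult using length_code_le_log[OF i(1)] by (intro mult_left_mono) auto
      then have "C * (1 + k + length (code i)) \<le> b" unfolding b_def by (intro le_nat_floor) simp
      then show "a \<in> word_ball G S' b"
        using h i word_ball_mono[OF _ S'(3)] by blast
    qed
    then have "f [^] \<nu> k \<in> word_ball G S' (l (\<nu> k) * b)"
      using word_ball_foldr[OF S'(2)] \<nu>(3) unfolding l_def by metis
    moreover have "real (l (\<nu> k) * b) \<le> real C / (real k + 1) * real (\<nu> k)"
    proof (cases "l (\<nu> k) = 0")
      case False
      then have "0 \<le> real C * (4 + real k + 2 * log 2 (real (l (\<nu> k))))"
        by (intro mult_nonneg_nonneg add_nonneg_nonneg) auto
      then have "real b \<le> real C * (4 + real k + 2 * log 2 (real (l (\<nu> k))))"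
        unfolding b_def by linarith
      then have "real (l (\<nu> k) * b) \<le> real (l (\<nu> k)) * (real C * (4 + real k + 2 * log 2 (real (l (\<nu> k)))))"
        by (simp add: mult_left_mono)
      also have "\<dots> = real C * (c k (\<nu> k) * real (\<nu> k))"
        using \<nu>(1)[of k] by (simp add: c_def)
      also have "\<dots> \<le> real C * (1 / (real k + 1) * real (\<nu> k))"
        using \<nu>(4)[of k] by (intro mult_left_mono mult_right_mono) auto
      finally show ?thesis by simp
    qed simp
    ultimately show ?thesis by blast
  qed
  have "(\<lambda>n. real (word_length G S' (f [^] n)) / real n) \<longlonglongrightarrow> 0"
  proof (rule LIMSEQ_I)
    fix e :: real assume e: "e > 0"
    obtain k :: nat where k: "real C / (real k + 1) < e / 2"
    proof -
      obtain k :: nat where "real C / (e / 2) < real k" using reals_Archimedean2 by blast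
      then have "real C < (e / 2) * (real k + 1)" using e by (simp add: field_simps)
      then show ?thesis using that[of k] by (simp add: field_simps)
    qed
    obtain A where A: "f [^] \<nu> k \<in> word_ball G S' A" "real A \<le> real C / (real k + 1) * real (\<nu> k)"
      using pow by blast
    obtain n0 :: nat where n0: "real (\<nu> k) / (e / 2) < real n0" using reals_Archimedean2 by blast
    show "\<exists>no. \<forall>n\<ge>no. norm (real (word_length G S' (f [^] n)) / real n - 0) < e"
    proof (intro exI allI impI)
      fix n assume n: "n \<ge> max 1 n0"
      define q r where "q = n div \<nu> k" and "r = n mod \<nu> k"
      have nqr: "n = \<nu> k * q + r" by (simp add: q_def r_def)
      have "f [^] n = (f [^] \<nu> k) [^] q \<otimes> f [^] r"
        unfolding nqr using f by (simp add: nat_pow_mult nat_pow_pow)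
      moreover have "(f [^] \<nu> k) [^] q \<otimes> f [^] r \<in> word_ball G S' (q * A + r * 1)"
        by (intro word_ball_mult word_ball_pow A word_ball_gen S') auto
      ultimately have "word_length G S' (f [^] n) \<le> q * A + r" using word_length_le by fastforce
      then have "real (word_length G S' (f [^] n)) \<le> real q * real A + real r"
        by (metis of_nat_add of_nat_le_iff of_nat_mult)
      also have "\<dots> \<le> real q * (real C / (real k + 1) * real (\<nu> k)) + real (\<nu> k)"
        using A(2) \<nu>(1)[of k] by (intro add_mono mult_left_mono) (auto simp: r_def less_imp_le)
      also have "\<dots> \<le> real C / (real k + 1) * real n + real (\<nu> k)"
      proof -
        have "real q * real (\<nu> k) \<le> real n" unfolding nqr by simp
        then have "real C / (real k + 1) * (real q * real (\<nu> k)) \<le> real C / (real k + 1) * real n"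
          by (intro mult_left_mono) auto
        then show ?thesis by (simp add: mult_ac)
      qed
      finally have "real (word_length G S' (f [^] n)) / real n \<le> (real C / (real k + 1) * real n + real (\<nu> k)) / real n"
        by (rule divide_right_mono) simp
      also have "\<dots> = real C / (real k + 1) + real (\<nu> k) / real n"
        using n by (simp add: add_divide_distrib)
      also have "\<dots> < e / 2 + e / 2"
      proof (rule add_strict_mono[OF k])
        have "real (\<nu> k) / (e / 2) < real n" using n n0 by linarith
        then show "real (\<nu> k) / real n < e / 2" using e n by (simp add: field_simps)
      qed
      finally show "norm (real (word_length G S' (f [^] n)) / real n - 0) < e" by simp
    qed
  qed
  then have "distorted_in (G\<lparr>carrier := H\<rparr>) f"
    unfolding distorted_in_def word_length_subgroup[OF H] using H S' generate_consistent[OF H(2,1)]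
    by (intro conjI exI[of _ S']) (auto simp: H_def word_length_subgroup[OF H, unfolded H_def] nat_pow_def)
  then show ?thesis unfolding distortion_element_def using H by blast
qed

section \<open>Realization by commutators\<close>

definition word_act :: "(bool \<Rightarrow> 'x \<Rightarrow> 'x) \<Rightarrow> bool list \<Rightarrow> 'x \<Rightarrow> 'x" where
  "word_act s bs = foldr (\<lambda>b. (\<circ>) (s b)) bs id"

lemma word_act_simps [simp]:
  "word_act s [] = id" "word_act s (b # bs) = s b \<circ> word_act s bs"
  by (auto simp: word_act_def)

lemma word_act_into: "(\<And>b. s b ` B \<subseteq> B) \<Longrightarrow> x \<in> B \<Longrightarrow> word_act s bs x \<in> B"
  by (induction bs) (auto simp: image_subset_iff)

lemma bij_word_act: "(\<And>b. bij (s b)) \<Longrightarrow> bij (word_act s bs)"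
  by (induction bs) (auto simp: bij_comp)

text \<open>Ping-pong: the two letters have disjoint images of \<open>B\<close>, so the first letter
  of a word can be read off from any point of its image of \<open>B\<close>. Comparing two codes in
  steps of two letters, either both end together, or one shows the final \<open>False\<close> where
  the other shows the marker \<open>True\<close>, which is impossible.\<close>

lemma word_act_code_disjoint:
  assumes inj: "\<And>b. inj (s b)" and sub: "\<And>b. s b ` B \<subseteq> B"
    and disj: "s True ` B \<inter> s False ` B = {}"
    and "x \<in> B" "y \<in> B" "word_act s (code n) x = word_act s (code m) y"
  shows "n = m"
  using assms(6)
proof (induction n arbitrary: m rule: less_induct)
  case (less n)
  have into: "word_act s bs z \<in> B" if "z \<in> B" for bs z
    by (rule word_act_into[where s = s and B = B, OF sub that])
  have key: False if "s True z = s False w" "z \<in> B" "w \<in> B" for z w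
    using disj imageI[OF that(2), of "s True"] imageI[OF that(3), of "s False"] that(1) by auto
  have neq: "b = c" if "s b z = s c w" "z \<in> B" "w \<in> B" for b c z w
    using that key[of z w] key[of w z] by (cases b; cases c) auto
  have mem: "s b z \<in> B" if "z \<in> B" for b z using sub[of b] that by auto
  show ?case
  proof (cases "n = 0 \<or> m = 0")
    case True
    show ?thesis
    proof (rule ccontr)
      assume "n \<noteq> m"
      then have "(n = 0 \<and> m \<noteq> 0) \<or> (n \<noteq> 0 \<and> m = 0)" using True by auto
      then show False
      proof
        assume nm: "n = 0 \<and> m \<noteq> 0"
        then have "s False x = s True (s (odd m) (word_act s (code (m div 2)) y))"
          using less.prems by (simp add: code_0 code_pos)
        from neq[OF this assms(4) mem[OF into[OF assms(5)]]] show False by simp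
      next
        assume nm: "n \<noteq> 0 \<and> m = 0"
        then have "s True (s (odd n) (word_act s (code (n div 2)) x)) = s False y"
          using less.prems by (simp add: code_0 code_pos)
        from neq[OF this mem[OF into[OF assms(4)]] assms(5)] show False by simp
      qed
    qed
  next
    case False
    then have "s True (s (odd n) (word_act s (code (n div 2)) x)) =
        s True (s (odd m) (word_act s (code (m div 2)) y))"
      using less.prems by (simp add: code_0 code_pos)
    then have e: "s (odd n) (word_act s (code (n div 2)) x) = s (odd m) (word_act s (code (m div 2)) y)"
      by (rule injD[OF inj])
    then have o: "odd n = odd m" by (rule neq[OF _ into[OF assms(4)] into[OF assms(5)]])
    then have "word_act s (code (n div 2)) x = word_act s (code (m div 2)) y"
      using e injD[OF inj] by simp
    then have "n div 2 = m div 2" using less.IH False by auto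
    moreover have "n mod 2 = m mod 2" using o by presburger
    ultimately show ?thesis by (metis div_mult_mod_eq)
  qed
qed

subsection \<open>Gluing conjugates with disjoint supports\<close>

text \<open>The product of the conjugates of \<open>h j\<close> by \<open>u j\<close> over all
  \<open>j\<close> in \<open>J\<close>, defined pointwise because \<open>J\<close> may be infinite.
  Disjointness of the pieces will make the choice of \<open>j\<close> unique; the index set is kept
  as a parameter so that finite partial products are available.\<close>

definition patch :: "('j \<Rightarrow> 'x \<Rightarrow> 'x) \<Rightarrow> ('j \<Rightarrow> 'x \<Rightarrow> 'x) \<Rightarrow> 'x set \<Rightarrow> 'j set \<Rightarrow> 'x \<Rightarrow> 'x" where
  "patch u h B J z =
     (if \<exists>j\<in>J. z \<in> u j ` B then let j = (SOME j. j \<in> J \<and> z \<in> u j ` B) in u j (h j (inv_into UNIV (u j) z)) else z)"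

locale disjoint_pieces =
  fixes u :: "'j \<Rightarrow> 'x \<Rightarrow> 'x" and B :: "'x set"
  assumes bij_u: "bij (u j)"
    and disj_u: "x \<in> B \<Longrightarrow> y \<in> B \<Longrightarrow> u j x = u k y \<Longrightarrow> j = k"
begin

lemma patch_in: "j \<in> J \<Longrightarrow> x \<in> B \<Longrightarrow> patch u h B J (u j x) = u j (h j x)"
proof -
  assume j: "j \<in> J" "x \<in> B"
  have "(SOME k. k \<in> J \<and> u j x \<in> u k ` B) = j"
    by (rule some_equality) (use j disj_u in auto)
  then show ?thesis using j bij_u[of j] by (auto simp: patch_def Let_def bij_is_inj)
qed

lemma patch_out: "(\<And>j. j \<in> J \<Longrightarrow> z \<notin> u j ` B) \<Longrightarrow> patch u h B J z = z"
  by (auto simp: patch_def)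

lemma patch_cases:
  obtains j x where "j \<in> J" "x \<in> B" "z = u j x" | "\<And>j. j \<in> J \<Longrightarrow> z \<notin> u j ` B"
  by blast

lemma patch_patch:
  assumes "\<And>j. j \<in> J \<Longrightarrow> h j ` B \<subseteq> B"
  shows "patch u g B J (patch u h B J z) = patch u (\<lambda>j. g j \<circ> h j) B J z"
proof (cases z rule: patch_cases[of J])
  case (1 j x)
  then have "h j x \<in> B" using assms by blast
  then show ?thesis using 1 by (simp add: patch_in)
qed (simp add: patch_out)

lemma patch_id: "patch u (\<lambda>j. id) B J = id"
proof
  fix z show "patch u (\<lambda>j. id) B J z = id z"
    by (cases z rule: patch_cases[of J]) (auto simp: patch_in patch_out)
qed

text \<open>Every \<open>h j\<close> preserves \<open>B\<close>, so the patch of the inverses is a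
  two-sided inverse.\<close>

lemma bij_patch:
  assumes "\<And>j. bij (h j)" "\<And>j x. x \<notin> B \<Longrightarrow> h j x = x"
  shows "bij (patch u h B J)"
proof -
  have B: "h j x \<in> B \<longleftrightarrow> x \<in> B" for j x
    using assms(2)[of "h j x" j] assms(2)[of x j] bij_is_inj[OF assms(1)[of j]] by (metis injD)
  have B': "inv_into UNIV (h j) x \<in> B" if "x \<in> B" for j x
    using B[of j "inv_into UNIV (h j) x"] that bij_is_surj[OF assms(1)[of j]] by (simp add: surj_f_inv_f)
  have 1: "patch u (\<lambda>j. inv_into UNIV (h j)) B J (patch u h B J z) = z" for z
  proof (subst patch_patch)
    show "patch u (\<lambda>j. inv_into UNIV (h j) \<circ> h j) B J z = z"
      using patch_id[of J] assms(1) by (simp add: bij_is_inj id_def)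
  qed (use B in auto)
  have 2: "patch u h B J (patch u (\<lambda>j. inv_into UNIV (h j)) B J z) = z" for z
  proof (subst patch_patch)
    have "h j \<circ> inv_into UNIV (h j) = id" for j using assms(1) by (simp add: bij_is_surj surj_iff[symmetric])
    then show "patch u (\<lambda>j. h j \<circ> inv_into UNIV (h j)) B J z = z"
      using patch_id[of J] by (simp add: id_def)
  qed (use B' in auto)
  show "bij (patch u h B J)" by (rule bijI') (metis 1, metis 2)
qed

end

text \<open>The conjugate of \<open>A\<close> by \<open>v\<close> agrees on \<open>B'\<close> with the product of all \<open>t\<^sup>i h t\<^sup>-\<^sup>i\<close>, whose commutator with \<open>t\<close>
  telescopes to \<open>h\<close>; outside \<open>B'\<close>, where \<open>t\<close> is the identity, the commutator is trivial.\<close>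

lemma commutator_trick:
  fixes t h a :: "'x \<Rightarrow> 'x"
  assumes t: "bij t" "\<And>x. x \<notin> B' \<Longrightarrow> t x = x" and B: "B \<subseteq> B'"
    and away: "\<And>x n. x \<in> B \<Longrightarrow> (t ^^ Suc n) x \<notin> B"
    and h: "bij h" "\<And>x. x \<notin> B \<Longrightarrow> h x = x"
    and a: "bij a" "\<And>x i. x \<in> B \<Longrightarrow> a ((t ^^ i) x) = (t ^^ i) (h x)"
      "\<And>y. y \<in> B' \<Longrightarrow> (\<And>i x. x \<in> B \<Longrightarrow> y \<noteq> (t ^^ i) x) \<Longrightarrow> a y = y"
  shows "h = a \<circ> t \<circ> inv_into UNIV a \<circ> inv_into UNIV t"
proof -
  have injs: "inj t" "inj h" "inj a" using t h a by (auto simp: bij_is_inj)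
  have tB: "t x \<in> B' \<longleftrightarrow> x \<in> B'" for x
    using t(2)[of "t x"] t(2)[of x] injs(1) by (metis injD)
  have tiB: "(t ^^ i) x \<in> B'" if "x \<in> B" for i x
    using that B tB by (induction i) auto
  have hB: "h x \<in> B \<longleftrightarrow> x \<in> B" for x
    using h(2)[of "h x"] h(2)[of x] injs(2) by (metis injD)
  have surjh: "\<exists>y. x = h y" for x using h(1) by (metis bij_pointE)
  \<comment> \<open>Nothing is assumed about \<open>a\<close> outside \<open>B'\<close> except
    bijectivity. That no outside point is sent into \<open>B'\<close> follows since the values in
    \<open>B'\<close> are already taken by points of \<open>B'\<close>.\<close>
  have aB: "y \<in> B'" if "a y \<in> B'" for y
  proof (cases "\<exists>i x. x \<in> B \<and> a y = (t ^^ i) x")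
    case True
    then obtain i x where x: "x \<in> B" "a y = (t ^^ i) x" by blast
    obtain z where z: "x = h z" using surjh by blast
    then have "z \<in> B" using hB x by auto
    then have "a ((t ^^ i) z) = a y" using a(2) x z by simp
    then show ?thesis using injs(3) tiB \<open>z \<in> B\<close> by (metis injD)
  next
    case False
    then have "a (a y) = a y" using a(3) that by blast
    then show ?thesis using injs(3) that by (metis injD)
  qed
  have "h (t (a y)) = a (t y)" for y
  proof (cases "\<exists>i x. x \<in> B \<and> y = (t ^^ i) x")
    case True
    then obtain i x where x: "x \<in> B" "y = (t ^^ i) x" by blast
    have "t (a y) = (t ^^ Suc i) (h x)" using x a(2) by simp
    moreover have "a (t y) = (t ^^ Suc i) (h x)" using x a(2)[of x "Suc i"] by simp
    moreover have "(t ^^ Suc i) (h x) \<notin> B" using away[of "h x"] x hB by blast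
    ultimately show ?thesis using h(2) by simp
  next
    case F: False
    show ?thesis
    proof (cases "y \<in> B'")
      case True
      then have ay: "a y = y" using a(3) F by blast
      show ?thesis
      proof (cases "t y \<in> B")
        case True
        then show ?thesis using a(2)[of "t y" 0] ay by simp
      next
        case tyB: False
        have "t y \<noteq> (t ^^ i) x" if "x \<in> B" for i x
        proof (cases i)
          case (Suc j)
          then show ?thesis using F that injs(1) by (auto dest: injD)
        qed (use that tyB in auto)
        then have "a (t y) = t y" using a(3) True tB by blast
        then show ?thesis using ay h(2) tyB by simp
      qed
    next
      case False
      then have "a y \<notin> B'" using aB by blast
      then show ?thesis using t(2) False h(2) B by auto
    qed
  qed
  then have "h \<circ> t \<circ> a = a \<circ> t" by auto
  then have "h \<circ> (t \<circ> (a \<circ> inv_into UNIV a) \<circ> inv_into UNIV t) = a \<circ> t \<circ> inv_into UNIV a \<circ> inv_into UNIV t" by (simp add: fun_eq_iff)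
  moreover have "a \<circ> inv_into UNIV a = id" "t \<circ> inv_into UNIV t = id"
    using a(1) t(1) by (auto simp: bij_is_surj surj_iff[symmetric])
  ultimately show ?thesis by simp
qed

text \<open>Purely set-theoretic data, so that one argument serves both the line and the cones. As
  \<open>t\<close> is injective, \<open>t_away\<close> makes all iterates of \<open>B\<close> under
  \<open>t\<close> pairwise disjoint.\<close>

locale tower =
  fixes B B' :: "'x set" and t :: "'x \<Rightarrow> 'x" and s :: "bool \<Rightarrow> 'x \<Rightarrow> 'x"
  assumes bij_t: "bij t" and t_off: "x \<notin> B' \<Longrightarrow> t x = x" and sub: "B \<subseteq> B'"
    and t_away: "x \<in> B \<Longrightarrow> (t ^^ Suc n) x \<notin> B"
    and bij_s: "bij (s b)" and s_into: "s b ` B' \<subseteq> B'"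
    and s_disj: "s True ` B' \<inter> s False ` B' = {}"
begin

definition piece :: "nat \<times> nat \<Rightarrow> 'x \<Rightarrow> 'x" where
  "piece j = word_act s (code (fst j)) \<circ> t ^^ snd j"

lemma t_into: "t x \<in> B' \<longleftrightarrow> x \<in> B'"
  using t_off[of "t x"] t_off[of x] bij_is_inj[OF bij_t] by (metis injD)

lemma funpow_t_into: "x \<in> B' \<Longrightarrow> (t ^^ i) x \<in> B'"
  by (induction i) (auto simp: t_into)

lemma funpow_t_disjoint:
  assumes "x \<in> B" "y \<in> B" "(t ^^ i) x = (t ^^ k) y" shows "i = k"
proof -
  have *: False if ik: "i < k" and "x \<in> B" "y \<in> B" "(t ^^ i) x = (t ^^ k) y" for i k x y
  proof -
    obtain n where k: "k = i + Suc n" using less_imp_Suc_add[OF ik] by auto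
    have "(t ^^ i) x = (t ^^ i) ((t ^^ Suc n) y)" using that(4) k by (simp only: funpow_add o_apply)
    then have "x = (t ^^ Suc n) y" using bij_is_inj[OF bij_fn[OF bij_t]] by (metis injD)
    then show False using t_away that by blast
  qed
  show ?thesis using *[of i k x y] *[of k i y x] assms by (metis linorder_neqE_nat)
qed

lemma inj_word: "inj (word_act s bs)"
  by (rule bij_is_inj[OF bij_word_act[where s = s, OF bij_s]])

lemma word_disjoint:
  "x \<in> B' \<Longrightarrow> y \<in> B' \<Longrightarrow> word_act s (code n) x = word_act s (code m) y \<Longrightarrow> n = m"
  by (rule word_act_code_disjoint[where s = s and B = B', OF bij_is_inj[OF bij_s] s_into s_disj])

sublocale disjoint_pieces piece B
proof
  show "bij (piece j)" for j
    unfolding piece_def by (intro bij_comp bij_fn bij_t bij_word_act bij_s)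
next
  fix x y j k assume xy: "x \<in> B" "y \<in> B" "piece j x = piece k y"
  have in': "(t ^^ snd j) x \<in> B'" "(t ^^ snd k) y \<in> B'" using funpow_t_into xy sub by blast+
  have eq: "word_act s (code (fst j)) ((t ^^ snd j) x) = word_act s (code (fst k)) ((t ^^ snd k) y)"
    using xy by (simp add: piece_def)
  have f: "fst j = fst k"
    by (rule word_disjoint[OF in' eq])
  then have "(t ^^ snd j) x = (t ^^ snd k) y"
    using eq by (simp add: inj_eq[OF inj_word])
  then show "j = k" using f funpow_t_disjoint xy by (auto intro: prod_eqI)
qed

lemma commutator_patch:
  fixes h :: "nat \<Rightarrow> 'x \<Rightarrow> 'x" and n :: nat
  assumes h: "\<And>n. bij (h n)" "\<And>n x. x \<notin> B \<Longrightarrow> h n x = x"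
  defines "A \<equiv> patch piece (h \<circ> fst) B UNIV"
  defines "v \<equiv> word_act s (code n)"
  defines "a \<equiv> inv_into UNIV v \<circ> A \<circ> v"
  shows "h n = a \<circ> t \<circ> inv_into UNIV a \<circ> inv_into UNIV t"
proof (rule commutator_trick[OF bij_t t_off sub t_away])
  have bA: "bij A" unfolding A_def using h by (intro bij_patch) auto
  have bv: "bij v" unfolding v_def by (intro bij_word_act bij_s)
  show "bij a" unfolding a_def by (intro bij_comp bA bv bij_imp_bij_inv)
  show "a ((t ^^ i) x) = (t ^^ i) (h n x)" if "x \<in> B" for x i
    using patch_in[of "(n, i)" UNIV x "h \<circ> fst"] that bij_is_inj[OF bv]
    by (simp add: a_def A_def piece_def v_def)
  show "a y = y" if y: "y \<in> B'" "\<And>i x. x \<in> B \<Longrightarrow> y \<noteq> (t ^^ i) x" for y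
  proof -
    have "v y \<notin> piece j ` B" for j
    proof
      assume "v y \<in> piece j ` B"
      then obtain x where x: "x \<in> B" "v y = word_act s (code (fst j)) ((t ^^ snd j) x)"
        by (auto simp: piece_def)
      have "(t ^^ snd j) x \<in> B'" using funpow_t_into x sub by blast
      then have "n = fst j"
        using word_disjoint[OF y(1)] x(2) unfolding v_def by blast
      then have "y = (t ^^ snd j) x" using x(2) inj_word by (simp add: v_def inj_eq)
      then show False using y(2) x by blast
    qed
    then have "A (v y) = v y" unfolding A_def by (intro patch_out) auto
    then show ?thesis using bij_is_inj[OF bv] by (simp add: a_def)
  qed
qed (use h in auto)

text \<open>The hypothesis \<open>patch\<close> is the analytic input: the infinite product of
  conjugates must belong to the group. It serves as one generator for the whole family, next to
  \<open>t\<close> and the two letters.\<close>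

lemma log_realizable_tower:
  assumes G: "group G" "mult G = (\<circ>)" "one G = id" and bij: "\<And>g. g \<in> carrier G \<Longrightarrow> bij g"
    and ts: "t \<in> carrier G" "\<And>b. s b \<in> carrier G"
    and P: "P \<subseteq> carrier G" "\<And>h x. h \<in> P \<Longrightarrow> x \<notin> B \<Longrightarrow> h x = x" "id \<in> P"
    and patch: "\<And>h. (\<And>n::nat. h n \<in> P) \<Longrightarrow> patch piece (h \<circ> fst) B UNIV \<in> carrier G"
  shows "log_realizable G P"
proof (rule log_realizableI)
  interpret group G by fact
  have inv: "m_inv G g = inv_into UNIV g" if "g \<in> carrier G" for g
  proof -
    have "m_inv G g \<circ> g = id" "g \<circ> m_inv G g = id"
      using l_inv[OF that] r_inv[OF that] by (auto simp: G)
    then show ?thesis by (metis inv_unique_comp)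
  qed
  fix h :: "nat \<Rightarrow> nat \<Rightarrow> 'x \<Rightarrow> 'x" and N :: "nat \<Rightarrow> nat" assume h: "\<And>k i. i < N k \<Longrightarrow> h k i \<in> P"
  define h' where "h' = (\<lambda>n. case prod_decode n of (k, i) \<Rightarrow> if i < N k then h k i else id)"
  have h': "h' n \<in> P" for n using h P(3) by (auto simp: h'_def split: prod.splits)
  define A where "A = patch piece (h' \<circ> fst) B UNIV"
  define S where "S = {A, t, s True, s False}"
  have S: "S \<subseteq> carrier G" using ts patch[of h'] h' by (auto simp: S_def A_def)
  have sS: "s b \<in> S" for b by (cases b) (auto simp: S_def)
  have "h' n \<in> word_ball G S (8 * length (code n))" for n
  proof -
    define v where "v = word_act s (code n)"
    have "word_act s bs \<in> word_ball G S (length bs)" for bs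
    proof (induction bs)
      case Nil
      show ?case using one_in_word_ball[of G S 0] by (simp only: G word_act_simps list.size)
    next
      case (Cons b bs)
      have "word_act s (b # bs) = s b \<otimes>\<^bsub>G\<^esub> word_act s bs" by (simp add: G(2))
      then show ?case
        using word_ball_mult[OF S word_ball_gen[OF S sS[of b], of 1] Cons.IH]
        by (simp only: list.size order_refl add.commute add_0_right Suc_eq_plus1)
    qed
    then have v: "v \<in> word_ball G S (length (code n))" by (simp add: v_def)
    then have vc: "v \<in> carrier G" using word_ball_closed[OF S] by blast
    define a where "a = inv_into UNIV v \<circ> A \<circ> v"
    have "m_inv G v \<otimes>\<^bsub>G\<^esub> A \<otimes>\<^bsub>G\<^esub> v \<in> word_ball G S (length (code n) + 1 + length (code n))"
      by (intro word_ball_mult word_ball_inv word_ball_gen S v) (auto simp: S_def)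
    then have a: "a \<in> word_ball G S (2 * length (code n) + 1)"
      by (simp add: a_def inv[OF vc] G(2) mult_2)
    then have ac: "a \<in> carrier G" using word_ball_closed[OF S] by blast
    have "a \<otimes>\<^bsub>G\<^esub> t \<otimes>\<^bsub>G\<^esub> m_inv G a \<otimes>\<^bsub>G\<^esub> m_inv G t
        \<in> word_ball G S (2 * length (code n) + 1 + 1 + (2 * length (code n) + 1) + 1)"
      by (intro word_ball_mult word_ball_inv word_ball_gen S a) (auto simp: S_def)
    moreover have len: "2 * length (code n) + 1 + 1 + (2 * length (code n) + 1) + 1 = 4 * length (code n) + 4"
      by simp
    ultimately have "a \<circ> t \<circ> inv_into UNIV a \<circ> inv_into UNIV t \<in> word_ball G S (4 * length (code n) + 4)"
      by (simp only: inv[OF ac] inv[OF ts(1)] G(2) len)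
    moreover have "h' n = a \<circ> t \<circ> inv_into UNIV a \<circ> inv_into UNIV t"
      unfolding a_def v_def A_def
      by (rule commutator_patch) (use h' P(1,2) bij in blast)+
    \<comment> \<open>With \<open>L = length (code n)\<close>, conjugation by \<open>v\<close> gives
      \<open>a\<close> the length \<open>2 L + 1\<close>, and the commutator contains
      \<open>a\<close> twice and \<open>t\<close> twice: \<open>4 L + 4\<close> in all, which is at
      most \<open>8 L\<close> because \<open>L \<ge> 1\<close>.\<close>
    moreover have "length (code n) \<ge> 1" by (subst code.simps) simp
    ultimately show ?thesis
      using word_ball_mono[of "4 * length (code n) + 4" "8 * length (code n)" S S G] by auto
  qed
  moreover have "8 * length (code (prod_encode (k, i))) \<le> 40 * (1 + k + length (code i))" for k i
    using length_code_prod_encode[of k i] by linarith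
  ultimately have *: "h' (prod_encode (k, i)) \<in> word_ball G S (40 * (1 + k + length (code i)))" for k i
    using subsetD[OF word_ball_mono[OF _ order_refl]] by metis
  have "h k i \<in> word_ball G S (40 * (1 + k + length (code i)))" if "i < N k" for k i
    using *[of k i] that by (simp add: h'_def)
  then show "realized G N h"
    using S by (intro exI[of _ S] exI[of _ 40]) (auto simp: S_def)
qed

end

section \<open>Order automorphisms of the line\<close>

text \<open>The orientation preserving homeomorphisms of the line: a strictly increasing surjection
  is continuous, and so is its inverse. Thus infinite gluing requires order and surjectivity
  only.\<close>

definition order_auts :: "(real \<Rightarrow> real) monoid" where
  "order_auts = \<lparr>carrier = {f. strict_mono f \<and> surj f}, mult = (\<circ>), one = id\<rparr>"

lemma order_auts_simps [simp]:
  "mult order_auts = (\<circ>)" "one order_auts = id"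
  "f \<in> carrier order_auts \<longleftrightarrow> strict_mono f \<and> surj f"
  by (auto simp: order_auts_def)

lemma inv_into_order_auts:
  fixes f :: "real \<Rightarrow> real"
  assumes "strict_mono f" "surj f"
  shows "strict_mono (inv_into UNIV f)" "surj (inv_into UNIV f)"
    "f (inv_into UNIV f x) = x" "inv_into UNIV f (f x) = x"
proof -
  have i: "inj f" using assms by (simp add: strict_mono_imp_inj_on)
  then show "inv_into UNIV f (f x) = x" "f (inv_into UNIV f x) = x"
    using assms by (auto simp: surj_f_inv_f)
  show "strict_mono (inv_into UNIV f)" by (rule strict_mono_inv[OF assms]) (simp add: i)
  show "surj (inv_into UNIV f)" using i by (simp add: inj_imp_surj_inv)
qed

lemma group_order_auts: "group order_auts"
proof (rule groupI)
  fix f assume "f \<in> carrier order_auts"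
  then show "\<exists>g\<in>carrier order_auts. g \<otimes>\<^bsub>order_auts\<^esub> f = \<one>\<^bsub>order_auts\<^esub>"
    using inv_into_order_auts[of f] by (intro bexI[of _ "inv_into UNIV f"]) auto
next
  fix f g assume "f \<in> carrier order_auts" "g \<in> carrier order_auts"
  then show "f \<otimes>\<^bsub>order_auts\<^esub> g \<in> carrier order_auts"
    using comp_surj[of g f] by (simp add: strict_mono_o)
qed (simp_all add: o_assoc strict_mono_def)

interpretation order_auts: group order_auts
  by (rule group_order_auts)

lemma bij_order_auts: "f \<in> carrier order_auts \<Longrightarrow> bij f"
  by (auto simp: bij_def strict_mono_imp_inj_on)

lemma inv_order_auts:
  assumes "f \<in> carrier order_auts" shows "m_inv order_auts f = inv_into UNIV f"
  using assms inv_into_order_auts[of f] by (intro order_auts.inv_equality) auto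

text \<open>Points in two different pieces keep their order because the conjugate acting on either piece is
  monotone and fixes the other piece; the relative position of the pieces does not matter.\<close>

lemma strict_mono_patch:
  fixes u h :: "'j \<Rightarrow> real \<Rightarrow> real"
  assumes "disjoint_pieces u B"
    and u: "\<And>j. strict_mono (u j)" and h: "\<And>j. strict_mono (h j)" "\<And>j x. x \<notin> B \<Longrightarrow> h j x = x"
  shows "strict_mono (patch u h B J)"
proof (rule strict_monoI)
  interpret disjoint_pieces u B by fact
  define g where "g = (\<lambda>j. u j \<circ> h j \<circ> inv_into UNIV (u j))"
  have uinv: "inv_into UNIV (u j) (u j x) = x" "u j (inv_into UNIV (u j) x) = x" for j x
    using bij_u[of j] by (auto simp: bij_def surj_f_inv_f)
  have gm: "g j x < g j y" if "x < y" for j x y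
    using that strict_mono_inv[OF u[of j], of "inv_into UNIV (u j)"] u[of j] h(1)[of j] bij_u[of j]
    by (simp add: g_def strict_mono_def bij_def)
  have hB: "h j x \<in> B \<longleftrightarrow> x \<in> B" for j x
    using h(2)[of "h j x" j] h(2)[of x j] strict_mono_eq[OF h(1)[of j]] by metis
  have in1: "patch u h B J z = g j z" "g j z \<in> u j ` B" if "j \<in> J" "z \<in> u j ` B" for j z
    using that hB uinv by (auto simp: g_def patch_in)
  have gfix: "g j z = z" if "z \<notin> u j ` B" for j z
  proof -
    have "inv_into UNIV (u j) z \<notin> B" using that uinv(2)[of j z] by (metis imageI)
    then show ?thesis using h(2) uinv by (simp add: g_def)
  qed
  have disj: "z \<notin> u k ` B" if "z \<in> u j ` B" "j \<noteq> k" for z j k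
    using that disj_u by auto
  fix z z' :: real assume z: "z < z'"
  show "patch u h B J z < patch u h B J z'"
  proof (cases "\<exists>j\<in>J. z \<in> u j ` B")
    case False
    then have e: "patch u h B J z = z" by (intro patch_out) auto
    show ?thesis
    proof (cases "\<exists>k\<in>J. z' \<in> u k ` B")
      case True
      then obtain k where k: "k \<in> J" "z' \<in> u k ` B" by blast
      have "g k z = z" using False k gfix by blast
      then show ?thesis using gm[OF z, of k] in1(1)[OF k] e by simp
    next
      case False
      then have "patch u h B J z' = z'" by (intro patch_out) auto
      then show ?thesis using e z by simp
    qed
  next
    case True
    then obtain j where j: "j \<in> J" "z \<in> u j ` B" by blast
    show ?thesis
    proof (cases "\<exists>k\<in>J. z' \<in> u k ` B")
      case True
      then obtain k where k: "k \<in> J" "z' \<in> u k ` B" by blast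
      show ?thesis
      proof (cases "j = k")
        case True
        then show ?thesis using gm[OF z, of k] in1(1)[OF k] in1(1)[OF j] by simp
      next
        case False
        have "g j z < z'" using gm[OF z, of j] gfix disj k False by metis
        from gm[OF this, of k] have "g j z < g k z'" using gfix disj in1(2)[OF j] False by metis
        then show ?thesis using in1(1)[OF k] in1(1)[OF j] by simp
      qed
    next
      case False
      then have "patch u h B J z' = z'" by (intro patch_out) auto
      moreover have "g j z' = z'" using False j gfix by blast
      ultimately show ?thesis using gm[OF z, of j] in1(1)[OF j] by simp
    qed
  qed
qed

subsection \<open>Piecewise affine interpolation\<close>

definition interp :: "(int \<Rightarrow> real) \<Rightarrow> real \<Rightarrow> real" where
  "interp r x = r \<lfloor>x\<rfloor> + frac x * (r (\<lfloor>x\<rfloor> + 1) - r \<lfloor>x\<rfloor>)"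

lemma interp_of_int [simp]: "interp r (of_int m) = r m"
  by (simp add: interp_def)

lemma interp_periodic:
  assumes "\<And>m. r (m + p) = r m + q" shows "interp r (x + of_int p) = interp r x + q"
proof -
  have "\<lfloor>x + of_int p\<rfloor> = \<lfloor>x\<rfloor> + p" "frac (x + of_int p) = frac x" by (auto simp: frac_def)
  moreover have "r (\<lfloor>x\<rfloor> + p + 1) = r (\<lfloor>x\<rfloor> + 1) + q" using assms[of "\<lfloor>x\<rfloor> + 1"] by (simp add: algebra_simps)
  ultimately show ?thesis using assms[of "\<lfloor>x\<rfloor>"] by (simp add: interp_def)
qed

lemma interp_order_auts:
  assumes step: "\<And>m. r m < r (m + 1)" and unb: "\<And>y. \<exists>m. r m \<le> y" "\<And>y. \<exists>m. y < r m"
  shows "interp r \<in> carrier order_auts"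
proof -
  have mono: "r i < r j" if "i < j" for i j
    using that by (induction rule: int_gr_induct) (use step less_trans in blast)+
  then have mono': "r i \<le> r j" if "i \<le> j" for i j using that by (cases "i = j") (auto simp: less_imp_le)
  have bd: "r \<lfloor>x\<rfloor> \<le> interp r x" "interp r x < r (\<lfloor>x\<rfloor> + 1)" for x
  proof -
    have "0 < r (\<lfloor>x\<rfloor> + 1) - r \<lfloor>x\<rfloor>" using step[of "\<lfloor>x\<rfloor>"] by simp
    then have "0 \<le> frac x * (r (\<lfloor>x\<rfloor> + 1) - r \<lfloor>x\<rfloor>)"
      and "frac x * (r (\<lfloor>x\<rfloor> + 1) - r \<lfloor>x\<rfloor>) < 1 * (r (\<lfloor>x\<rfloor> + 1) - r \<lfloor>x\<rfloor>)"
      using frac_lt_1[of x] by (auto intro!: mult_strict_right_mono simp del: mult_1)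
    then show "r \<lfloor>x\<rfloor> \<le> interp r x" "interp r x < r (\<lfloor>x\<rfloor> + 1)" by (simp_all add: interp_def)
  qed
  have "interp r x < interp r y" if "x < y" for x y
  proof (cases "\<lfloor>x\<rfloor> = \<lfloor>y\<rfloor>")
    case True
    then have "frac x < frac y" using that by (simp add: frac_def)
    then show ?thesis using True step[of "\<lfloor>y\<rfloor>"] by (simp add: interp_def)
  next
    case False
    then have "\<lfloor>x\<rfloor> + 1 \<le> \<lfloor>y\<rfloor>" using floor_mono[of x y] that by linarith
    then show ?thesis using bd(2)[of x] bd(1)[of y] mono'[of "\<lfloor>x\<rfloor> + 1" "\<lfloor>y\<rfloor>"] by linarith
  qed
  moreover have "\<exists>x. y = interp r x" for y
  proof -
    obtain a b where a: "r a \<le> y" and b: "y < r b" using unb by blast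
    have "a < b" using a b mono'[of b a] by linarith
    \<comment> \<open>The first node above \<open>y\<close>, searched from a node below
      \<open>y\<close>; its predecessor begins the affine piece that reaches
      \<open>y\<close>.\<close>
    define n where "n = (LEAST n::nat. y < r (a + int n))"
    have ex: "y < r (a + int (nat (b - a)))" using b \<open>a < b\<close> by simp
    have n: "y < r (a + int n)" unfolding n_def by (rule LeastI[of _ "nat (b - a)"]) (rule ex)
    then have "n \<noteq> 0" using a by (cases n) auto
    then obtain m where m: "n = Suc m" by (cases n) auto
    have "\<not> y < r (a + int m)" using not_less_Least[of m "\<lambda>n. y < r (a + int n)"] m n_def by simp
    then have c: "r (a + int m) \<le> y" "y < r (a + int m + 1)" using n m by (auto simp: algebra_simps)
    define c d where "c = a + int m" and "d = r (c + 1) - r c"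
    have d: "d > 0" using step[of c] by (simp add: d_def)
    define x where "x = of_int c + (y - r c) / d"
    have "0 \<le> (y - r c) / d" "(y - r c) / d < 1" using c d by (auto simp: c_def d_def)
    then have "\<lfloor>x\<rfloor> = c" "frac x = (y - r c) / d" unfolding x_def
      by (auto simp: frac_def floor_eq_iff)
    then have "interp r x = y" using d by (simp add: interp_def d_def)
    then show ?thesis by blast
  qed
  ultimately show ?thesis by (auto simp: strict_mono_def surj_def)
qed

subsection \<open>A tower of period 2\<close>

text \<open>The piecewise affine map commuting with \<open>x \<mapsto> x + 2\<close> whose values at \<open>-1/2, -1/4, \<dots>, 5/4\<close> are
  the eight entries of \<open>a\<close>.\<close>

definition zigzag :: "real list \<Rightarrow> real \<Rightarrow> real" where
  "zigzag a x = interp (\<lambda>m. 2 * of_int ((m + 2) div 8) + a ! nat ((m + 2) mod 8)) (4 * x)"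

text \<open>The appended \<open>hd a + 2\<close> is the value at the first node of the next period,
  so the sorting condition includes the step across the period.\<close>

lemma zigzag_order_auts:
  assumes len: "length a = 8" and inc: "sorted_wrt (<) (a @ [hd a + 2])"
  shows "zigzag a \<in> carrier order_auts"
proof -
  define r where "r = (\<lambda>m::int. 2 * real_of_int ((m + 2) div 8) + a ! nat ((m + 2) mod 8))"
  have hd: "hd a = a ! 0" using len by (intro hd_conv_nth) auto
  have step1: "(a @ [hd a + 2]) ! i < (a @ [hd a + 2]) ! (i + 1)" if "i < 8" for i
    using sorted_wrt_nth_less[OF inc, of i "i + 1"] that len by simp
  have a: "a ! i < a ! (i + 1)" if "i < 7" for i
    using step1[of i] that len by (simp add: nth_append)
  have a7: "a ! 7 < a ! 0 + 2"
    using step1[of 7] len hd by (simp add: nth_append)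
  have "interp r \<in> carrier order_auts"
  proof (rule interp_order_auts)
    fix m :: int
    define q i where "q = (m + 2) div 8" and "i = (m + 2) mod 8"
    have qi: "m + 1 + 2 = 8 * q + (i + 1)" "0 \<le> i" "i < 8" by (auto simp: q_def i_def)
    show "r m < r (m + 1)"
    proof (cases "i = 7")
      case True
      then have "(m + 1 + 2) div 8 = q + 1" "(m + 1 + 2) mod 8 = 0"
        using qi by (auto intro!: int_div_pos_eq[where r = 0] int_mod_pos_eq[where q = "q + 1"])
      then show ?thesis using True a7 by (simp add: r_def q_def[symmetric] i_def[symmetric])
    next
      case False
      then have "(m + 1 + 2) div 8 = q" "(m + 1 + 2) mod 8 = i + 1"
        using qi by (auto intro: int_div_pos_eq int_mod_pos_eq)
      then show ?thesis using a[of "nat i"] False qi(2,3)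
        by (simp add: r_def nat_add_distrib q_def[symmetric] i_def[symmetric])
    qed
  next
    have v: "r (8 * n - 2) = 2 * real_of_int n + a ! 0" for n by (simp add: r_def)
    fix y :: real
    define z where "z = (y - a ! 0) / 2"
    have y: "y = 2 * z + a ! 0" by (simp add: z_def field_simps)
    obtain k where k: "real_of_int k \<le> z" "z < real_of_int k + 1"
      by (rule that[of "\<lfloor>z\<rfloor>"]) linarith+
    have "r (8 * k - 2) \<le> y" unfolding v y using k by linarith
    then show "\<exists>m. r m \<le> y" by blast
    have "y < r (8 * (k + 1) - 2)" unfolding v y of_int_add of_int_1 using mult_strict_left_mono[OF k(2), of 2] by simp
    then show "\<exists>m. y < r m" by blast
  qed
  moreover have "(\<lambda>x::real. 4 * x) \<in> carrier order_auts"
    by (auto simp: strict_mono_def intro: surjI[of _ "\<lambda>x. x / 4"])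
  ultimately have "interp r \<otimes>\<^bsub>order_auts\<^esub> (\<lambda>x. 4 * x) \<in> carrier order_auts"
    by (rule order_auts.m_closed)
  moreover have "interp r \<otimes>\<^bsub>order_auts\<^esub> (\<lambda>x. 4 * x) = zigzag a"
    by (auto simp: zigzag_def r_def)
  ultimately show ?thesis by metis
qed

lemma zigzag_periodic: "zigzag a (x + 2 * of_int j) = zigzag a x + 2 * of_int j"
proof -
  have *: "(m + 8 * j + 2) div 8 = (m + 2) div 8 + j" "(m + 8 * j + 2) mod 8 = (m + 2) mod 8" for m
  proof -
    have "m + 8 * j + 2 = 8 * j + (m + 2)" by simp
    then show "(m + 8 * j + 2) div 8 = (m + 2) div 8 + j" "(m + 8 * j + 2) mod 8 = (m + 2) mod 8"
      by (simp_all only: div_mult_self4 mod_mult_self4 zero_neq_numeral not_False_eq_True add.commute[of j])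
  qed
  have "zigzag a (x + 2 * of_int j) =
      interp (\<lambda>m. 2 * of_int ((m + 2) div 8) + a ! nat ((m + 2) mod 8)) (4 * x + of_int (8 * j))"
    by (simp add: zigzag_def algebra_simps)
  also have "\<dots> = zigzag a x + 2 * of_int j"
    unfolding zigzag_def by (rule interp_periodic, simp only: *) simp
  finally show ?thesis .
qed

lemma zigzag_node: "- 2 \<le> m \<Longrightarrow> m < 6 \<Longrightarrow> zigzag a (of_int m / 4) = a ! nat (m + 2)"
  using interp_of_int[of _ m] by (simp add: zigzag_def)

text \<open>The two affine pieces over \<open>[-1/2, -1/4)\<close> and \<open>[5/4, 3/2)\<close>,
  which lie outside the room within one period, are the identity as soon as the values at their end
  nodes are right.\<close>

lemma zigzag_fixed:
  assumes "m \<in> {-2, 5}" "of_int m / 4 \<le> x" "x < of_int (m + 1) / 4"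
    and "a ! nat (m + 2) = of_int m / 4" "m = - 2 \<Longrightarrow> a ! 1 = - 1 / 4" "a ! 0 = - 1 / 2"
  shows "zigzag a x = x"
proof -
  have fl: "\<lfloor>4 * x\<rfloor> = m" using assms(2,3) by (simp add: floor_eq_iff)
  consider "m = - 2" | "m = 5" "a ! 7 = 5 / 4" using assms(1,4) by auto
  then show ?thesis
  proof cases
    case 1
    then have "zigzag a x = a ! 0 + (4 * x + 2) * (a ! 1 - a ! 0)"
      using fl by (simp add: zigzag_def interp_def frac_def)
    then show ?thesis unfolding assms(5)[OF 1] assms(6) by (simp add: field_simps)
  next
    case 2
    then have "zigzag a x = a ! 7 + (4 * x - 5) * (2 + a ! 0 - a ! 7)"
      using fl by (simp add: zigzag_def interp_def frac_def)
    then show ?thesis unfolding 2(2) assms(6) by (simp add: field_simps)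
  qed
qed

text \<open>The essential values are: \<open>-1/4\<close> and \<open>5/4\<close> are fixed, and 0
  and 1 go to \<open>-1/8\<close> and 0. So \<open>[0, 1)\<close> is pushed into
  \<open>[-1/8, 0)\<close> and never leaves \<open>[-1/4, 0)\<close> again. The remaining entries
  only fill in increasing values.\<close>

definition zig_t :: "real \<Rightarrow> real" where
  "zig_t = zigzag [- 1/2, - 1/4, - 1/8, - 3/32, - 1/16, - 1/32, 0, 5/4]"

text \<open>The interval from \<open>-1/4\<close> to \<open>5/4\<close> is mapped to its part below
  \<open>1/2\<close> for \<open>True\<close> and to its part above \<open>1/2\<close> for
  \<open>False\<close>.\<close>

definition zig_s :: "bool \<Rightarrow> real \<Rightarrow> real" where
  "zig_s b = (if b then zigzag [- 1/2, - 1/4, - 1/8, 0, 1/8, 1/4, 3/8, 1/2]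
              else zigzag [- 1/2, 1/2, 5/8, 3/4, 7/8, 1, 9/8, 5/4])"

abbreviation zig_room :: "real set" where
  "zig_room \<equiv> {x. \<exists>j::int. 2 * of_int j - 1/4 < x \<and> x < 2 * of_int j + 5/4}"

lemma zig_order_auts: "zig_t \<in> carrier order_auts" "zig_s b \<in> carrier order_auts"
  unfolding zig_t_def zig_s_def by (auto intro!: zigzag_order_auts simp del: order_auts_simps)

lemma zig_periodic: "zig_t (x + 2 * of_int j) = zig_t x + 2 * of_int j"
    "zig_s b (x + 2 * of_int j) = zig_s b x + 2 * of_int j"
  by (auto simp: zig_t_def zig_s_def zigzag_periodic)

lemma zig_nodes: "zig_t (- 1/4) = - 1/4" "zig_t 0 = - 1/8" "zig_t 1 = 0"
    "zig_s True (- 1/4) = - 1/4" "zig_s True (5/4) = 1/2"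
    "zig_s False (- 1/4) = 1/2" "zig_s False (5/4) = 5/4"
  using zigzag_node[of "-1"] zigzag_node[of 0] zigzag_node[of 4] zigzag_node[of 5]
  by (simp_all add: zig_t_def zig_s_def)

lemma zig_less: "x < y \<Longrightarrow> zig_t x < zig_t y" "x < y \<Longrightarrow> zig_s b x < zig_s b y"
  using zig_order_auts by (auto simp: strict_mono_def)

interpretation zig: tower "{x::real. even \<lfloor>x\<rfloor>}"
  zig_room zig_t zig_s
proof
  show "bij zig_t" "bij (zig_s b)" for b using zig_order_auts bij_order_auts by blast+
  show "{x::real. even \<lfloor>x\<rfloor>} \<subseteq> zig_room"
  proof
    fix x :: real assume "x \<in> {x. even \<lfloor>x\<rfloor>}"
    then obtain j where "\<lfloor>x\<rfloor> = 2 * j" by (auto elim: evenE)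
    then have "2 * of_int j \<le> x" "x < 2 * of_int j + 1" by linarith+
    then show "x \<in> zig_room"
      by (auto intro!: exI[of _ j])
  qed
  show "zig_t x = x" if x: "x \<notin> zig_room" for x
  proof -
    \<comment> \<open>Subtracting \<open>2 * of_int j\<close> moves \<open>x\<close> into the period
      \<open>[-1/2, 3/2)\<close>.\<close>
    define j where "j = \<lfloor>(x + 1/2) / 2\<rfloor>"
    define y where "y = x - 2 * of_int j"
    have "of_int j \<le> (x + 1/2) / 2" "(x + 1/2) / 2 < of_int j + 1" unfolding j_def by linarith+
    then have y: "- 1/2 \<le> y" "y < 3/2" by (auto simp: y_def field_simps)
    have "\<not> (2 * of_int j - 1/4 < x \<and> x < 2 * of_int j + 5/4)" using x by blast
    then have "\<not> (- 1/4 < y \<and> y < 5/4)" unfolding y_def by linarith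
    then consider "y < - 1/4" | "y = - 1/4" | "5/4 \<le> y" by linarith
    then have "zig_t y = y"
    proof cases
      case 1
      then show ?thesis unfolding zig_t_def using y by (intro zigzag_fixed[of "-2"]) auto
    next
      case 2
      then show ?thesis using zig_nodes(1) by simp
    next
      case 3
      then show ?thesis unfolding zig_t_def using y by (intro zigzag_fixed[of 5]) auto
    qed
    then show ?thesis using zig_periodic(1)[of y j] by (simp add: y_def)
  qed
  show "(zig_t ^^ Suc n) x \<notin> {x. even \<lfloor>x\<rfloor>}" if ex: "x \<in> {x. even \<lfloor>x\<rfloor>}" for x n
  proof -
    obtain j where "\<lfloor>x\<rfloor> = 2 * j" using ex by (auto elim: evenE)
    then have x: "2 * of_int j \<le> x" "x < 2 * of_int j + 1" by linarith+
    have v: "zig_t (2 * of_int j) = 2 * of_int j - 1/8" "zig_t (2 * of_int j + 1) = 2 * of_int j"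
      "zig_t (2 * of_int j - 1/4) = 2 * of_int j - 1/4"
      using zig_periodic(1)[of 0 j] zig_periodic(1)[of 1 j] zig_periodic(1)[of "- 1/4" j] zig_nodes
      by (simp_all add: algebra_simps)
    have le: "zig_t a \<le> zig_t b" if "a \<le> b" for a b using zig_less(1)[of a b] that by (cases "a = b") auto
    \<comment> \<open>From the first step on the orbit stays in \<open>[2 j - 1/4, 2 j)\<close>,
      which \<open>zig_t\<close> maps into itself and whose points have odd floor.\<close>
    have "2 * of_int j - 1/4 \<le> (zig_t ^^ Suc n) x \<and> (zig_t ^^ Suc n) x < 2 * of_int j"
    proof (induction n)
      case 0
      then show ?case using le[OF x(1)] zig_less(1)[OF x(2)] v by simp
    next
      case (Suc n)
      define z where "z = (zig_t ^^ Suc n) x"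
      have z: "2 * of_int j - 1/4 \<le> z" "z < 2 * of_int j" using Suc by (auto simp: z_def)
      have "2 * of_int j - 1/4 \<le> zig_t z \<and> zig_t z < 2 * of_int j"
        using le[OF z(1)] zig_less(1)[OF z(2)] v by simp
      then show ?case by (simp add: z_def)
    qed
    then have "\<lfloor>(zig_t ^^ Suc n) x\<rfloor> = 2 * j - 1" by (simp only: floor_eq_iff) simp
    then show ?thesis by simp
  qed
  have img: "zig_s True ` zig_room \<subseteq> {x. \<exists>j::int. 2 * of_int j - 1/4 < x \<and> x < 2 * of_int j + 1/2}"
    "zig_s False ` zig_room \<subseteq> {x. \<exists>j::int. 2 * of_int j + 1/2 < x \<and> x < 2 * of_int j + 5/4}"
  proof safe
    fix x :: real and j :: int assume x: "2 * of_int j - 1/4 < x" "x < 2 * of_int j + 5/4"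
    have v: "zig_s b (2 * of_int j - 1/4) = zig_s b (- 1/4) + 2 * of_int j"
      "zig_s b (2 * of_int j + 5/4) = zig_s b (5/4) + 2 * of_int j" for b
      using zig_periodic(2)[of b "- 1/4" j] zig_periodic(2)[of b "5/4" j] by (simp_all add: algebra_simps)
    show "\<exists>j::int. 2 * of_int j - 1/4 < zig_s True x \<and> zig_s True x < 2 * of_int j + 1/2"
      using zig_less(2)[OF x(1), of True] zig_less(2)[OF x(2), of True] v[of True] zig_nodes
      by (intro exI[of _ j]) simp
    show "\<exists>j::int. 2 * of_int j + 1/2 < zig_s False x \<and> zig_s False x < 2 * of_int j + 5/4"
      using zig_less(2)[OF x(1), of False] zig_less(2)[OF x(2), of False] v[of False] zig_nodes
      by (intro exI[of _ j]) simp
  qed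
  show "zig_s b ` zig_room \<subseteq> zig_room" for b
  proof -
    have "{x. \<exists>j::int. 2 * of_int j - 1/4 < x \<and> x < 2 * of_int j + 1/2} \<subseteq> zig_room"
      "{x. \<exists>j::int. 2 * of_int j + 1/2 < x \<and> x < 2 * of_int j + 5/4} \<subseteq> zig_room"
      by (force intro: exI)+
    from subset_trans[OF img(1) this(1)] subset_trans[OF img(2) this(2)] show ?thesis
      by (cases b) simp_all
  qed
  have "False" if "2 * real_of_int j - 1/4 < x" "x < 2 * real_of_int j + 1/2"
      "2 * real_of_int i + 1/2 < x" "x < 2 * real_of_int i + 5/4" for i j x
  proof -
    have "real_of_int i < real_of_int j" "real_of_int j < real_of_int i + 1" using that by linarith+
    then have "i < j" "j < i + 1" by linarith+
    then show False by simp
  qed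
  then show "zig_s True ` zig_room \<inter> zig_s False ` zig_room = {}"
    using img by blast
qed

lemma strict_mono_funpow: "strict_mono (t :: real \<Rightarrow> real) \<Longrightarrow> strict_mono (t ^^ n)"
  by (induction n) (auto simp: strict_mono_def)

lemma strict_mono_word_act: "(\<And>b. strict_mono (s b :: real \<Rightarrow> real)) \<Longrightarrow> strict_mono (word_act s bs)"
  by (induction bs) (auto simp: strict_mono_def)

text \<open>The commutator argument takes place in all intervals \<open>[2 j, 2 j + 1)\<close>
  simultaneously, since the tower is periodic. The pieces do not shrink; the patch is a group member
  by monotonicity and bijectivity alone.\<close>

lemma realizable_even_floor:
  "log_realizable order_auts {g \<in> carrier order_auts. \<forall>x. odd \<lfloor>x\<rfloor> \<longrightarrow> g x = x}" (is "log_realizable _ ?Q")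
proof (rule zig.log_realizable_tower)
  fix h assume h: "\<And>n::nat. h n \<in> ?Q"
  have "strict_mono (zig.piece j)" for j
    unfolding zig.piece_def using zig_order_auts
    by (intro strict_mono_o strict_mono_word_act strict_mono_funpow) auto
  then have "strict_mono (patch zig.piece (h \<circ> fst) {x. even \<lfloor>x\<rfloor>} UNIV)"
    using h by (intro strict_mono_patch zig.disjoint_pieces_axioms) auto
  moreover have "bij (patch zig.piece (h \<circ> fst) {x. even \<lfloor>x\<rfloor>} UNIV)"
    using h bij_order_auts by (intro zig.bij_patch) auto
  ultimately show "patch zig.piece (h \<circ> fst) {x. even \<lfloor>x\<rfloor>} UNIV \<in> carrier order_auts"
    by (simp add: bij_is_surj)
qed (use zig_order_auts bij_order_auts group_order_auts in \<open>auto simp: strict_mono_def\<close>)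


subsection \<open>Reduction to homeomorphisms supported in alternate unit intervals\<close>

lemma comp_order_auts:
  "f \<in> carrier order_auts \<Longrightarrow> g \<in> carrier order_auts \<Longrightarrow> f \<circ> g \<in> carrier order_auts"
  using order_auts.m_closed[of f g] by simp

lemma conj_order_auts:
  assumes "c \<in> carrier order_auts" "d \<in> carrier order_auts" "\<And>x. c (d x) = x"
    and P: "log_realizable order_auts P" and R: "\<And>r. r \<in> R \<Longrightarrow> \<exists>p\<in>P. r = c \<circ> p \<circ> d"
  shows "log_realizable order_auts R"
proof -
  have "d = inv_into UNIV c"
    using assms(1,3) inv_into_order_auts[of c] by (metis ext order_auts_simps(3))
  then have "m_inv order_auts c = d" using assms(1) inv_order_auts by metis
  then show ?thesis using R by (intro order_auts.log_realizable_conj[OF P assms(1)]) auto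
qed

lemma affine_order_auts: "a > 0 \<Longrightarrow> (\<lambda>x::real. a * x + b) \<in> carrier order_auts"
  by (auto simp: strict_mono_def intro!: surjI[of _ "\<lambda>x. (x - b) / a"])

text \<open>Such a map preserves every interval \<open>[m, m + 1)\<close>, so it is the product of
  its parts over even and over odd \<open>m\<close>. Translation by 1 conjugates the second kind to
  the first.\<close>

lemma realizable_fix_integers:
  "log_realizable order_auts {g \<in> carrier order_auts. \<forall>m::int. g (of_int m) = of_int m}"
    (is "log_realizable _ ?Z")
proof -
  let ?Q = "{g \<in> carrier order_auts. \<forall>x. odd \<lfloor>x\<rfloor> \<longrightarrow> g x = x}"
  define R where "R = {g \<in> carrier order_auts. \<forall>x. even \<lfloor>x\<rfloor> \<longrightarrow> g x = x}"
  have R: "log_realizable order_auts R"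
  proof (rule conj_order_auts[OF _ _ _ realizable_even_floor])
    show "(\<lambda>x::real. 1 * x + 1) \<in> carrier order_auts" "(\<lambda>x::real. 1 * x + (- 1)) \<in> carrier order_auts"
      by (rule affine_order_auts, simp)+
    fix g assume g: "g \<in> R"
    define p where "p = (\<lambda>x. 1 * x + (- 1)) \<circ> g \<circ> (\<lambda>x. 1 * x + 1)"
    have "p \<in> carrier order_auts"
      unfolding p_def using g by (intro comp_order_auts affine_order_auts) (auto simp: R_def)
    moreover have "p x = x" if "odd \<lfloor>x\<rfloor>" for x
    proof -
      have "even \<lfloor>x + 1\<rfloor>" using that by simp
      then have "g (x + 1) = x + 1" using g by (simp add: R_def)
      then show ?thesis by (simp add: p_def)
    qed
    moreover have "g = (\<lambda>x. 1 * x + 1) \<circ> p \<circ> (\<lambda>x. 1 * x + (- 1))" by (auto simp: p_def)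
    ultimately show "\<exists>p\<in>?Q. g = (\<lambda>x. 1 * x + 1) \<circ> p \<circ> (\<lambda>x. 1 * x + (- 1))" by blast
  qed simp
  show ?thesis
  proof (rule order_auts.log_realizable_mult[OF realizable_even_floor R])
    fix g assume "g \<in> ?Z"
    then have g: "strict_mono g" "surj g" "\<And>m::int. g (of_int m) = of_int m" by auto
    have fl: "\<lfloor>g x\<rfloor> = \<lfloor>x\<rfloor>" for x
    proof -
      have "g (of_int \<lfloor>x\<rfloor>) \<le> g x" using strict_mono_less_eq[OF g(1)] by simp
      moreover have "g x < g (of_int (\<lfloor>x\<rfloor> + 1))" using strict_mono_less[OF g(1)] by simp
      ultimately show ?thesis using g(3) by (metis floor_unique of_int_1 of_int_add)
    qed
    define p where "p = (\<lambda>S x. if \<lfloor>x\<rfloor> \<in> S then g x else x)"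
    have p: "p S \<in> carrier order_auts" for S
    proof -
      have "p S x < p S y" if "x < y" for x y
      proof (cases "\<lfloor>x\<rfloor> = \<lfloor>y\<rfloor>")
        case True
        then show ?thesis using that strict_mono_less[OF g(1)] by (simp add: p_def)
      next
        case False
        then have "\<lfloor>x\<rfloor> < \<lfloor>y\<rfloor>" using floor_mono[of x y] that by linarith
        then have "\<lfloor>p S x\<rfloor> < \<lfloor>p S y\<rfloor>" using fl by (simp add: p_def)
        then show ?thesis by (metis floor_mono leD leI)
      qed
      moreover have "\<exists>x. p S x = y" for y
      proof (cases "\<lfloor>y\<rfloor> \<in> S")
        case True
        obtain x where x: "y = g x" using g(2) by (auto simp: surj_def)
        then have "p S x = y" using fl[of x] True by (simp add: p_def)
        then show ?thesis by blast
      next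
        case False
        then have "p S y = y" by (simp add: p_def)
        then show ?thesis by blast
      qed
      ultimately show ?thesis unfolding order_auts_simps strict_mono_def surj_def by metis
    qed
    have "g = p {m. even m} \<otimes>\<^bsub>order_auts\<^esub> p {m. odd m}"
      using fl by (auto simp: p_def)
    moreover have "p {m. even m} \<in> ?Q" "p {m. odd m} \<in> R"
      using p[of "{m. even m}"] p[of "{m. odd m}"] unfolding R_def by (simp_all add: p_def)
    ultimately show "\<exists>p\<in>?Q. \<exists>q\<in>R. g = p \<otimes>\<^bsub>order_auts\<^esub> q" by blast
  qed
qed

text \<open>A displacement below \<open>1/2\<close> leaves \<open>g m\<close> strictly between
  \<open>m - 1/2\<close> and \<open>m + 1/2\<close>. So there is an automorphism that agrees with
  \<open>g\<close> on the integers and fixes all half-integers \<open>m + 1/2\<close>; after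
  dividing it out the integers are fixed. Both factors are covered by the preceding case, the first
  one up to a translation by \<open>1/2\<close>.\<close>

lemma realizable_small_displacement:
  "log_realizable order_auts {g \<in> carrier order_auts. \<forall>x. \<bar>g x - x\<bar> < 1/2}" (is "log_realizable _ ?D")
proof -
  let ?Z = "{g \<in> carrier order_auts. \<forall>m::int. g (of_int m) = of_int m}"
  define R where "R = {g \<in> carrier order_auts. \<forall>m::int. g (of_int m + 1/2) = of_int m + 1/2}"
  have R: "log_realizable order_auts R"
  proof (rule conj_order_auts[OF _ _ _ realizable_fix_integers])
    show "(\<lambda>x::real. 1 * x + 1/2) \<in> carrier order_auts" "(\<lambda>x::real. 1 * x + (- 1/2)) \<in> carrier order_auts"
      by (rule affine_order_auts, simp)+
    fix g assume g: "g \<in> R"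
    define p where "p = (\<lambda>x. 1 * x + (- 1/2)) \<circ> g \<circ> (\<lambda>x. 1 * x + 1/2)"
    have "p \<in> carrier order_auts"
      unfolding p_def using g by (intro comp_order_auts affine_order_auts) (auto simp: R_def)
    moreover have "p (of_int m) = of_int m" for m
      using g by (simp add: p_def R_def)
    moreover have "g = (\<lambda>x. 1 * x + 1/2) \<circ> p \<circ> (\<lambda>x. 1 * x + (- 1/2))" by (auto simp: p_def)
    ultimately show "\<exists>p\<in>?Z. g = (\<lambda>x. 1 * x + 1/2) \<circ> p \<circ> (\<lambda>x. 1 * x + (- 1/2))" by blast
  qed simp
  show ?thesis
  proof (rule order_auts.log_realizable_mult[OF R realizable_fix_integers])
    fix g assume "g \<in> ?D"
    then have g: "g \<in> carrier order_auts" and gd: "\<And>x. \<bar>g x - x\<bar> < 1/2" by auto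
    have gd1: "g x < x + 1/2" "x - 1/2 < g x" for x using gd[of x] by linarith+
    define r where "r = (\<lambda>m::int. if even m then g (of_int m / 2) else of_int m / 2)"
    have rd: "\<bar>r m - of_int m / 2\<bar> < 1/2" for m using gd[of "of_int m / 2"] by (simp add: r_def)
    have "interp r \<in> carrier order_auts"
    proof (rule interp_order_auts)
      fix m
      show "r m < r (m + 1)"
      proof (cases "even m")
        case True
        then have "r m = g (of_int m / 2)" "r (m + 1) = of_int m / 2 + 1/2"
          by (auto simp: r_def add_divide_distrib)
        then show ?thesis using gd1(1)[of "of_int m / 2"] by simp
      next
        case False
        then have "r m = of_int (m + 1) / 2 - 1/2" "r (m + 1) = g (of_int (m + 1) / 2)"
          by (auto simp: r_def add_divide_distrib)
        then show ?thesis using gd1(2)[of "of_int (m + 1) / 2"] by simp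
      qed
    next
      fix y :: real
      have r2: "r (2 * n) = g (of_int n)" for n by (simp add: r_def)
      have "r (2 * \<lfloor>y - 1\<rfloor>) < of_int \<lfloor>y - 1\<rfloor> + 1/2"
        unfolding r2 by (rule gd1)
      then have "r (2 * \<lfloor>y - 1\<rfloor>) \<le> y" by linarith
      then show "\<exists>m. r m \<le> y" by blast
      have "of_int (\<lfloor>y\<rfloor> + 2) - 1/2 < r (2 * (\<lfloor>y\<rfloor> + 2))"
        unfolding r2 by (rule gd1)
      moreover have "y < of_int (\<lfloor>y\<rfloor> + 2) - 1/2" unfolding of_int_add by linarith
      ultimately have "y < r (2 * (\<lfloor>y\<rfloor> + 2))" by simp
      then show "\<exists>m. y < r m" by blast
    qed
    then have "interp r \<otimes>\<^bsub>order_auts\<^esub> (\<lambda>x. 2 * x + 0) \<in> carrier order_auts"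
      using affine_order_auts[of 2 0] by (intro order_auts.m_closed) auto
    moreover define a where "a = interp r \<otimes>\<^bsub>order_auts\<^esub> (\<lambda>x. 2 * x + 0)"
    ultimately have a: "a \<in> carrier order_auts" by simp
    have a1: "a (of_int m) = g (of_int m)" for m
      using interp_of_int[of r "2 * m"] by (simp add: a_def r_def)
    have "a (of_int m + 1/2) = of_int m + 1/2" for m
      using interp_of_int[of r "2 * m + 1"] by (simp add: a_def r_def add_divide_distrib distrib_left)
    then have aR: "a \<in> R" using a by (simp add: R_def)
    define b where "b = m_inv order_auts a \<otimes>\<^bsub>order_auts\<^esub> g"
    have "b \<in> carrier order_auts" unfolding b_def using a g by (intro order_auts.m_closed order_auts.inv_closed)
    moreover have "b (of_int m) = of_int m" for m
      using inv_into_order_auts(4)[of a "of_int m"] a a1[of m] by (simp add: b_def inv_order_auts)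
    ultimately have "b \<in> ?Z" by blast
    moreover have "g = a \<otimes>\<^bsub>order_auts\<^esub> b"
      unfolding b_def using a g order_auts.m_assoc order_auts.r_inv order_auts.l_one order_auts.inv_closed by metis
    ultimately show "\<exists>p\<in>R. \<exists>q\<in>?Z. g = p \<otimes>\<^bsub>order_auts\<^esub> q" using aR by blast
  qed
qed

text \<open>Conjugation with multiplication by 16 turns displacement 8 into \<open>1/2\<close>. The
  bound 8 is generous: the maps to which it will be applied move points by at most 4.\<close>

lemma realizable_bounded_displacement:
  "log_realizable order_auts {g \<in> carrier order_auts. \<forall>x. \<bar>g x - x\<bar> < 8}"
proof (rule conj_order_auts[OF _ _ _ realizable_small_displacement])
  show "(\<lambda>x::real. 16 * x + 0) \<in> carrier order_auts" "(\<lambda>x::real. (1/16) * x + 0) \<in> carrier order_auts"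
    by (rule affine_order_auts, simp)+
  fix g :: "real \<Rightarrow> real" assume g: "g \<in> {g \<in> carrier order_auts. \<forall>x. \<bar>g x - x\<bar> < 8}"
  define p where "p = (\<lambda>x. (1/16) * x + 0) \<circ> g \<circ> (\<lambda>x. 16 * x + 0)"
  have "p \<in> carrier order_auts"
    unfolding p_def using g by (intro comp_order_auts affine_order_auts) auto
  moreover have "\<bar>p x - x\<bar> < 1/2" for x
  proof -
    have "\<bar>g (16 * x) - 16 * x\<bar> < 8" using g by blast
    moreover have e: "p x - x = (g (16 * x) - 16 * x) / 16" by (simp add: p_def diff_divide_distrib)
    ultimately show ?thesis unfolding e abs_divide by simp
  qed
  moreover have "g = (\<lambda>x. 16 * x + 0) \<circ> p \<circ> (\<lambda>x. (1/16) * x + 0)" by (auto simp: p_def)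
  ultimately show "\<exists>p\<in>{g \<in> carrier order_auts. \<forall>x. \<bar>g x - x\<bar> < 1/2}.
      g = (\<lambda>x. 16 * x + 0) \<circ> p \<circ> (\<lambda>x. (1/16) * x + 0)" by blast
qed simp

subsection \<open>All order automorphisms of the line\<close>

text \<open>A rapidly growing change of coordinates \<open>\<theta>\<close> moves every germ at infinity in the family to one of
  bounded displacement, and a further rescaling by \<open>2^k\<close> makes the \<open>k\<close>-th batch uniformly bounded.\<close>

lemma obtain_fast_sequence:
  fixes F :: "real \<Rightarrow> nat \<Rightarrow> real"
  obtains r :: "nat \<Rightarrow> real" where "r 0 = 0" "\<And>m. r m + 1 \<le> r (Suc m)" "\<And>m. F (r m) m \<le> r (Suc m)"
proof -
  define r where "r = rec_nat (0::real) (\<lambda>m x. x + 1 + \<bar>F x m\<bar> + \<bar>x\<bar>)"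
  have "r 0 = 0" and S: "\<And>m. r (Suc m) = r m + 1 + \<bar>F (r m) m\<bar> + \<bar>r m\<bar>" by (auto simp: r_def)
  then have "r m + 1 \<le> r (Suc m)" "F (r m) m \<le> r (Suc m)" for m by (auto simp: S)
  with that \<open>r 0 = 0\<close> show ?thesis by blast
qed

text \<open>The node \<open>r (Suc m)\<close> dominates the values of finitely many maps and of
  their inverses at the nodes \<open>r m\<close> and \<open>- r m\<close>, so these maps carry nodes
  at most to the neighbouring nodes. At each stage only finitely many maps can be dominated; hence
  the batches are finite, and the \<open>k\<close>-th one is controlled only away from the
  origin.\<close>

lemma obtain_bounded_displacement:
  fixes h :: "nat \<Rightarrow> nat \<Rightarrow> real \<Rightarrow> real" and N :: "nat \<Rightarrow> nat"
  assumes h: "\<And>k i. i < N k \<Longrightarrow> h k i \<in> carrier order_auts"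
  obtains \<theta> where "\<theta> \<in> carrier order_auts"
    "\<And>k i x. i < N k \<Longrightarrow> real k + 1 \<le> \<bar>x\<bar> \<Longrightarrow> \<bar>inv_into UNIV \<theta> (h k i (\<theta> x)) - x\<bar> \<le> 2"
proof -
  \<comment> \<open>Batches up to \<open>Suc m\<close>, not just \<open>m\<close>: the image of the
    node with index \<open>Suc m\<close> is bounded on the inner side through the inverse map at the
    node with index \<open>m\<close>.\<close>
  define F where "F = (\<lambda>x m. \<Sum>k\<le>Suc m. \<Sum>i<N k. \<bar>h k i x\<bar> + \<bar>h k i (- x)\<bar>
     + \<bar>inv_into UNIV (h k i) x\<bar> + \<bar>inv_into UNIV (h k i) (- x)\<bar>)"
  obtain r :: "nat \<Rightarrow> real" where r: "r 0 = 0" "\<And>m. r m + 1 \<le> r (Suc m)" "\<And>m. F (r m) m \<le> r (Suc m)"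
    using obtain_fast_sequence[of F] by blast
  have Fle: "\<bar>h k i (r m)\<bar> \<le> r (Suc m) \<and> \<bar>h k i (- r m)\<bar> \<le> r (Suc m) \<and>
      \<bar>inv_into UNIV (h k i) (r m)\<bar> \<le> r (Suc m) \<and> \<bar>inv_into UNIV (h k i) (- r m)\<bar> \<le> r (Suc m)"
    if "i < N k" "k \<le> Suc m" for k i m
  proof -
    let ?f = "\<lambda>k i. \<bar>h k i (r m)\<bar> + \<bar>h k i (- r m)\<bar> + \<bar>inv_into UNIV (h k i) (r m)\<bar>
        + \<bar>inv_into UNIV (h k i) (- r m)\<bar>"
    have "?f k i \<le> (\<Sum>i<N k. ?f k i)"
      using that by (intro member_le_sum) auto
    also have "\<dots> \<le> (\<Sum>k\<le>Suc m. \<Sum>i<N k. ?f k i)"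
      by (rule member_le_sum[where f = "\<lambda>k. \<Sum>i<N k. ?f k i"]) (use that in \<open>auto intro!: sum_nonneg\<close>)
    also have "\<dots> = F (r m) m" by (simp add: F_def)
    finally have "?f k i \<le> r (Suc m)" using r(3)[of m] by linarith
    then show ?thesis by linarith
  qed
  define R where "R = (\<lambda>n::int. if 0 \<le> n then r (nat n) else - r (nat (- n)))"
  have Rstep: "R n + 1 \<le> R (n + 1)" for n
  proof -
    consider "0 \<le> n" | "n = -1" | "n < -1" by linarith
    then show ?thesis
    proof cases
      case 1
      then have "nat (n + 1) = Suc (nat n)" by simp
      then show ?thesis using 1 r(2)[of "nat n"] by (simp add: R_def)
    next
      case 2
      then show ?thesis using r(1) r(2)[of 0] by (simp add: R_def)
    next
      case 3
      then have "nat (- n) = Suc (nat (- (n + 1)))" by simp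
      then show ?thesis using 3 r(2)[of "nat (- (n + 1))"] by (simp add: R_def)
    qed
  qed
  have rge: "real m \<le> r m" for m
  proof (induction m)
    case (Suc m)
    then show ?case using r(2)[of m] by simp
  qed (simp add: r(1))
  have \<theta>: "interp R \<in> carrier order_auts"
  proof (rule interp_order_auts)
    show "R m < R (m + 1)" for m using Rstep[of m] by linarith
    fix y
    obtain n :: nat where n: "\<bar>y\<bar> < real n" using reals_Archimedean2 by blast
    then have n0: "0 < int n" by (cases n) auto
    have "R (- int n) = - r n" "R (int n) = r n" using n0 by (auto simp: R_def)
    then have "R (- int n) \<le> y" "y < R (int n)" using rge[of n] n by linarith+
    then show "\<exists>m. R m \<le> y" "\<exists>m. y < R m" by blast+
  qed
  \<comment> \<open>A move away from the origin is bounded by the growth of \<open>r\<close>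
    directly, a move towards it by the same growth applied to the inverse map.\<close>
  have key: "h k i (R n) \<le> R (n + 1)" "R (n - 1) \<le> h k i (R n)" if i: "i < N k" and n: "int k \<le> \<bar>n\<bar>" for k i n
  proof -
    have hk: "strict_mono (h k i)" "surj (h k i)" using h[OF i] by auto
    note hinv = inv_into_order_auts(3)[OF hk]
    have le: "h k i x \<le> h k i y" if "x \<le> y" for x y using that hk(1) by (simp add: strict_mono_less_eq)
    show "h k i (R n) \<le> R (n + 1)"
    proof (cases "0 \<le> n")
      case True
      then have "nat (n + 1) = Suc (nat n)" by simp
      moreover have "k \<le> Suc (nat n)" using n True by linarith
      ultimately show ?thesis using Fle[OF i, of "nat n"] True by (auto simp: R_def abs_le_iff)
    next
      case False
      define m where "m = nat (- n - 1)"
      have m: "n = - int (Suc m)" using False by (simp add: m_def)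
      have "\<bar>inv_into UNIV (h k i) (- r m)\<bar> \<le> r (Suc m)" using Fle[OF i, of m] n m by auto
      then have "- r (Suc m) \<le> inv_into UNIV (h k i) (- r m)" by linarith
      from le[OF this] have "h k i (- r (Suc m)) \<le> - r m" using hinv by simp
      moreover have "R n = - r (Suc m)" "R (n + 1) = - r m" using m r(1) by (auto simp: R_def nat_add_distrib)
      ultimately show ?thesis by simp
    qed
    show "R (n - 1) \<le> h k i (R n)"
    proof (cases "n \<le> 0")
      case True
      define m where "m = nat (- n)"
      have m: "n = - int m" using True by (simp add: m_def)
      have "R n = - r m" "R (n - 1) = - r (Suc m)" using m r(1) by (auto simp: R_def nat_add_distrib)
      moreover have "\<bar>h k i (- r m)\<bar> \<le> r (Suc m)" using Fle[OF i, of m] n m by auto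
      ultimately show ?thesis by simp
    next
      case False
      define m where "m = nat (n - 1)"
      have m: "n = int (Suc m)" using False by (simp add: m_def)
      have "\<bar>inv_into UNIV (h k i) (r m)\<bar> \<le> r (Suc m)" using Fle[OF i, of m] n m by auto
      then have "inv_into UNIV (h k i) (r m) \<le> r (Suc m)" by linarith
      from le[OF this] have "r m \<le> h k i (r (Suc m))" using hinv by simp
      moreover have "R n = r (Suc m)" "R (n - 1) = r m" using m by (auto simp: R_def nat_add_distrib)
      ultimately show ?thesis by simp
    qed
  qed
  define \<theta> where "\<theta> = interp R"
  have th: "strict_mono \<theta>" "surj \<theta>" using \<theta> by (auto simp: \<theta>_def)
  note inv = inv_into_order_auts[OF th]
  have thR: "\<theta> (of_int n) = R n" for n by (simp add: \<theta>_def)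
  have "\<bar>inv_into UNIV \<theta> (h k i (\<theta> x)) - x\<bar> \<le> 2" if i: "i < N k" and x: "real k + 1 \<le> \<bar>x\<bar>" for k i x
  proof -
    have hk: "strict_mono (h k i)" "surj (h k i)" using h[OF i] by auto
    define n where "n = \<lfloor>x\<rfloor>"
    have n: "of_int n \<le> x" "x < of_int (n + 1)" by (auto simp: n_def)
    have "int k \<le> \<bar>n\<bar>" "int k \<le> \<bar>n + 1\<bar>"
    proof -
      have "real_of_int (int k) + 1 \<le> x \<or> x \<le> - (real_of_int (int k) + 1)" using x by auto
      then have "int k + 1 \<le> n \<or> n \<le> - (int k + 1)" unfolding n_def by linarith
      then show "int k \<le> \<bar>n\<bar>" "int k \<le> \<bar>n + 1\<bar>" by auto
    qed
    note k1 = key(1)[OF i this(2)] and k2 = key(2)[OF i this(1)]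
    have "h k i (\<theta> x) \<le> h k i (R (n + 1))"
      using n(2) thR[of "n + 1"] strict_mono_less_eq[OF hk(1)] strict_mono_less_eq[OF th(1)] by (metis less_imp_le)
    then have "h k i (\<theta> x) \<le> \<theta> (of_int (n + 2))" using k1 thR[of "n + 2"] by (simp add: algebra_simps)
    then have "inv_into UNIV \<theta> (h k i (\<theta> x)) \<le> of_int (n + 2)"
      using strict_mono_less_eq[OF inv(1)] inv(4) by metis
    moreover have "h k i (R n) \<le> h k i (\<theta> x)"
      using n(1) thR[of n] strict_mono_less_eq[OF hk(1)] strict_mono_less_eq[OF th(1)] by metis
    then have "\<theta> (of_int (n - 1)) \<le> h k i (\<theta> x)" using k2 thR[of "n - 1"] by simp
    then have "of_int (n - 1) \<le> inv_into UNIV \<theta> (h k i (\<theta> x))"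
      using strict_mono_less_eq[OF inv(1)] inv(4) by metis
    ultimately show ?thesis using n by (simp add: abs_le_iff)
  qed
  then show ?thesis using that[of \<theta>] \<theta> by (simp add: \<theta>_def)
qed

lemma realizable_order_auts: "log_realizable order_auts (carrier order_auts)"
proof (rule log_realizableI)
  fix h and N :: "nat \<Rightarrow> nat" assume h: "\<And>k i. i < N k \<Longrightarrow> h k i \<in> carrier order_auts"
  obtain \<theta> where \<theta>: "\<theta> \<in> carrier order_auts"
    and disp: "\<And>k i x. i < N k \<Longrightarrow> real k + 1 \<le> \<bar>x\<bar> \<Longrightarrow> \<bar>inv_into UNIV \<theta> (h k i (\<theta> x)) - x\<bar> \<le> 2"
    using obtain_bounded_displacement[of N h] h by blast
  define \<sigma> where "\<sigma> = (\<lambda>x::real. 2 * x + 0)"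
  have \<sigma>: "\<sigma> \<in> carrier order_auts" unfolding \<sigma>_def by (rule affine_order_auts) simp
  \<comment> \<open>Here the penalty is spent: \<open>c k\<close> is a word of \<open>k + 1\<close>
    letters and is used on both sides of \<open>g k i\<close>. Because
    \<open>k + 1 \<le> 2 ^ k\<close>, the uncontrolled region of the \<open>k\<close>-th batch
    shrinks into \<open>[-1, 1]\<close>.\<close>
  define c where "c = (\<lambda>k::nat. \<theta> \<otimes>\<^bsub>order_auts\<^esub> \<sigma> [^]\<^bsub>order_auts\<^esub> k)"
  have c: "c k \<in> carrier order_auts" for k
    unfolding c_def using \<theta> \<sigma> by (intro order_auts.m_closed order_auts.nat_pow_closed)
  have \<sigma>k: "(\<sigma> [^]\<^bsub>order_auts\<^esub> k) x = 2 ^ k * x" for k x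
    by (induction k arbitrary: x) (simp_all add: \<sigma>_def)
  define g where "g = (\<lambda>k i. m_inv order_auts (c k) \<otimes>\<^bsub>order_auts\<^esub> h k i \<otimes>\<^bsub>order_auts\<^esub> c k)"
  have gc: "g k i \<in> carrier order_auts" if "i < N k" for k i
    unfolding g_def using h[OF that] c by (intro order_auts.m_closed order_auts.inv_closed)
  have inv\<theta>: "inv_into UNIV \<theta> (\<theta> x) = x" "\<theta> (inv_into UNIV \<theta> x) = x" for x
    using inv_into_order_auts[of \<theta>] \<theta> by auto
  have gv: "g k i x = inv_into UNIV \<theta> (h k i (\<theta> (2 ^ k * x))) / 2 ^ k" for k i x
  proof -
    have ic: "inv_into UNIV (c k) y = inv_into UNIV \<theta> y / 2 ^ k" for y
    proof -
      have "c k (inv_into UNIV \<theta> y / 2 ^ k) = y" by (simp add: c_def \<sigma>k inv\<theta>)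
      then show ?thesis using inv_into_order_auts(4)[of "c k"] c[of k] by (metis order_auts_simps(3))
    qed
    show ?thesis unfolding g_def inv_order_auts[OF c] by (simp add: ic) (simp add: c_def \<sigma>k)
  qed
  have small: "\<bar>g k i x - x\<bar> \<le> 2" if i: "i < N k" and x: "1 \<le> \<bar>x\<bar>" for k i x
  proof -
    have "real k + 1 \<le> 2 ^ k" by (induction k) auto
    also have "\<dots> \<le> \<bar>2 ^ k * x\<bar>" using x by (simp add: abs_mult)
    finally have "\<bar>inv_into UNIV \<theta> (h k i (\<theta> (2 ^ k * x))) - 2 ^ k * x\<bar> \<le> 2" by (rule disp[OF i])
    then have "\<bar>inv_into UNIV \<theta> (h k i (\<theta> (2 ^ k * x))) - 2 ^ k * x\<bar> / 2 ^ k \<le> 2 / 2 ^ k"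
      by (rule divide_right_mono) simp
    also have "\<dots> \<le> 2" by (simp add: divide_le_eq)
    also have "\<bar>inv_into UNIV \<theta> (h k i (\<theta> (2 ^ k * x))) - 2 ^ k * x\<bar> / 2 ^ k = \<bar>g k i x - x\<bar>"
    proof -
      have "g k i x - x = (inv_into UNIV \<theta> (h k i (\<theta> (2 ^ k * x))) - 2 ^ k * x) / 2 ^ k"
        by (simp add: gv diff_divide_distrib)
      then show ?thesis by (simp add: abs_divide)
    qed
    finally show ?thesis .
  qed
  have gD: "g k i \<in> {g \<in> carrier order_auts. \<forall>x. \<bar>g x - x\<bar> < 8}" if i: "i < N k" for k i
  proof -
    have "\<bar>g k i x - x\<bar> < 8" for x
    proof (cases "1 \<le> \<bar>x\<bar>")
      case True
      then show ?thesis using small[OF i True] by linarith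
    next
      case False
      have le: "g k i x \<le> g k i y" if "x \<le> y" for x y using gc[OF i] that by (simp add: strict_mono_less_eq)
      \<comment> \<open>Between \<open>-1\<close> and 1 monotonicity traps the values between those
        at the two ends, which lie in \<open>[-3, 3]\<close>.\<close>
      have "g k i (- 1) \<le> g k i x" "g k i x \<le> g k i 1" using False by (auto intro!: le)
      then show ?thesis using False small[OF i, of 1] small[OF i, of "-1"] by linarith
    qed
    then show ?thesis using gc[OF i] by simp
  qed
  obtain S C where S: "finite S" "S \<subseteq> carrier order_auts"
    and gS: "\<forall>k i. i < N k \<longrightarrow> g k i \<in> word_ball order_auts S (C * (1 + k + length (code i)))"
    using log_realizableD[OF realizable_bounded_displacement, of N g, OF gD] by blast
  define S' where "S' = insert \<theta> (insert \<sigma> S)"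
  have S': "finite S'" "S' \<subseteq> carrier order_auts" "S \<subseteq> S'" "\<theta> \<in> S'" "\<sigma> \<in> S'"
    using S \<theta> \<sigma> by (auto simp: S'_def)
  have "h k i \<in> word_ball order_auts S' ((C + 2) * (1 + k + length (code i)))" if i: "i < N k" for k i
  proof -
    let ?w = "C * (1 + k + length (code i))"
    have cS: "c k \<in> word_ball order_auts S' (1 + k * 1)"
      unfolding c_def using S' by (intro order_auts.word_ball_mult order_auts.word_ball_pow order_auts.word_ball_gen) auto
    have gS': "g k i \<in> word_ball order_auts S' ?w"
      using gS i word_ball_mono[of ?w ?w S S' order_auts] S'(3) by blast
    have "c k \<otimes>\<^bsub>order_auts\<^esub> g k i \<otimes>\<^bsub>order_auts\<^esub> m_inv order_auts (c k) \<in> word_ball order_auts S' (1 + k * 1 + ?w + (1 + k * 1))"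
      by (intro order_auts.word_ball_mult order_auts.word_ball_inv cS gS' S')
    moreover have "c k \<otimes>\<^bsub>order_auts\<^esub> g k i \<otimes>\<^bsub>order_auts\<^esub> m_inv order_auts (c k) = h k i"
    proof
      fix x
      have cc: "c k (m_inv order_auts (c k) y) = y" for y
        using inv_order_auts[OF c[of k]] inv_into_order_auts(3)[of "c k"] c[of k] by simp
      show "(c k \<otimes>\<^bsub>order_auts\<^esub> g k i \<otimes>\<^bsub>order_auts\<^esub> m_inv order_auts (c k)) x = h k i x"
        by (simp add: g_def cc)
    qed
    moreover have "1 + k * 1 + ?w + (1 + k * 1) \<le> (C + 2) * (1 + k + length (code i))"
      by (simp add: algebra_simps)
    ultimately show ?thesis using word_ball_mono[of "1 + k * 1 + ?w + (1 + k * 1)" "(C + 2) * (1 + k + length (code i))" S' S' order_auts]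
      by auto
  qed
  then show "realized order_auts N h"
    using S' by (intro exI[of _ S'] exI[of _ "C + 2"]) simp
qed

section \<open>Compactly supported homeomorphisms of a closed cone\<close>

text \<open>Points live in \<open>nat \<Rightarrow> real\<close> with the product topology. On the
  sets considered below, the coordinates from \<open>d\<close> on vanish, so there this is the
  Euclidean norm.\<close>

definition nrm :: "nat \<Rightarrow> (nat \<Rightarrow> real) \<Rightarrow> real" where
  "nrm d x = L2_set x {..<d}"

definition dst :: "nat \<Rightarrow> (nat \<Rightarrow> real) \<Rightarrow> (nat \<Rightarrow> real) \<Rightarrow> real" where
  "dst d x y = nrm d (\<lambda>i. x i - y i)"

lemma nrm_nonneg [simp]: "0 \<le> nrm d x"
  by (simp add: nrm_def)

lemma nrm_scale: "nrm d (\<lambda>i. c * x i) = \<bar>c\<bar> * nrm d x"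
proof -
  have "nrm d (\<lambda>i. c * x i) = sqrt (c\<^sup>2 * (\<Sum>i<d. (x i)\<^sup>2))"
    by (simp add: nrm_def L2_set_def power_mult_distrib sum_distrib_left)
  then show ?thesis by (simp add: real_sqrt_mult nrm_def L2_set_def)
qed

lemma nrm_triangle: "nrm d (\<lambda>i. x i + y i) \<le> nrm d x + nrm d y"
  unfolding nrm_def by (rule L2_set_triangle_ineq)

lemma abs_le_nrm: "i < d \<Longrightarrow> \<bar>x i\<bar> \<le> nrm d x"
  using member_le_L2_set[of "{..<d}" i x] member_le_L2_set[of "{..<d}" i "\<lambda>i. - 1 * x i"] nrm_scale[of d "-1" x]
  by (simp add: nrm_def)

lemma continuous_on_coord [continuous_intros]: "continuous_on S (\<lambda>x::nat \<Rightarrow> real. x i)"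
  by (rule continuous_on_subset[OF continuous_on_product_coordinates]) simp

lemma continuous_on_nrm [continuous_intros]:
  assumes "\<And>i. continuous_on S (\<lambda>x. f x i)"
  shows "continuous_on S (\<lambda>x. nrm d (f x))"
  unfolding nrm_def L2_set_def by (intro continuous_intros assms)

lemma dst_nonneg [simp]: "0 \<le> dst d x y"
  by (simp add: dst_def)

lemma dst_triangle: "dst d x z \<le> dst d x y + dst d y z"
  using nrm_triangle[of d "\<lambda>i. x i - y i" "\<lambda>i. y i - z i"] by (simp add: dst_def)

lemma dst_commute: "dst d x y = dst d y x"
  using nrm_scale[of d "-1" "\<lambda>i. x i - y i"] by (simp add: dst_def)

lemma nrm_le_dst: "nrm d x \<le> dst d x y + nrm d y"
  using nrm_triangle[of d "\<lambda>i. x i - y i" y] by (simp add: dst_def)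

lemma dst_le_nrm: "dst d x y \<le> nrm d x + nrm d y"
  using nrm_triangle[of d x "\<lambda>i. - 1 * y i"] nrm_scale[of d "-1" y] by (simp add: dst_def)

text \<open>The maps are bijections of the whole function space and equal the identity off
  \<open>T\<close>, so inverses and composition are those of total functions, while continuity
  refers to \<open>T\<close>. In a closed cone the bounded support makes the inverse continuous
  too.\<close>

definition homeo_group :: "nat \<Rightarrow> (nat \<Rightarrow> real) set \<Rightarrow> ((nat \<Rightarrow> real) \<Rightarrow> (nat \<Rightarrow> real)) monoid" where
  "homeo_group d T = \<lparr>carrier = {\<phi>. bij \<phi> \<and> (\<forall>x. x \<notin> T \<longrightarrow> \<phi> x = x) \<and> continuous_on T \<phi> \<and>
      (\<exists>R. \<forall>x. R < nrm d x \<longrightarrow> \<phi> x = x)}, mult = (\<circ>), one = id\<rparr>"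

lemma homeo_group_simps [simp]: "mult (homeo_group d T) = (\<circ>)" "one (homeo_group d T) = id"
  by (auto simp: homeo_group_def)

lemma homeo_groupI:
  assumes "bij \<phi>" "\<And>x. x \<notin> T \<Longrightarrow> \<phi> x = x" "continuous_on T \<phi>" "\<And>x. R < nrm d x \<Longrightarrow> \<phi> x = x"
  shows "\<phi> \<in> carrier (homeo_group d T)"
  using assms by (auto simp: homeo_group_def)

lemma homeo_groupD:
  assumes "\<phi> \<in> carrier (homeo_group d T)"
  shows "bij \<phi>" "x \<notin> T \<Longrightarrow> \<phi> x = x" "continuous_on T \<phi>" "\<exists>R. \<forall>x. R < nrm d x \<longrightarrow> \<phi> x = x"
  using assms by (auto simp: homeo_group_def)

lemma bij_fixed_off_iff:
  assumes "bij \<phi>" "\<And>x. x \<notin> T \<Longrightarrow> \<phi> x = x" shows "\<phi> x \<in> T \<longleftrightarrow> x \<in> T"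
  using assms(2)[of "\<phi> x"] assms(2)[of x] bij_is_inj[OF assms(1)] by (metis injD)

lemma bij_inv_into_cancel:
  assumes "bij \<phi>" shows "inv_into UNIV \<phi> (\<phi> x) = x" "\<phi> (inv_into UNIV \<phi> x) = x"
  using assms by (auto simp: bij_def surj_f_inv_f)

lemma homeo_group_into: "\<phi> \<in> carrier (homeo_group d T) \<Longrightarrow> \<phi> x \<in> T \<longleftrightarrow> x \<in> T"
  using bij_fixed_off_iff homeo_groupD(1,2) by metis

abbreviation ball_homeos :: "nat \<Rightarrow> (nat \<Rightarrow> real) set \<Rightarrow> ((nat \<Rightarrow> real) \<Rightarrow> (nat \<Rightarrow> real)) set" where
  "ball_homeos d T \<equiv>
     {h \<in> carrier (homeo_group d T). \<forall>x. x \<notin> {x \<in> T. nrm d x \<le> 1} \<longrightarrow> h x = x}"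

text \<open>Scaling is what the Alexander isotopy uses, and the vanishing coordinates make closed
  bounded parts compact. The instances are Euclidean spaces, half-spaces and the half-line.\<close>

locale cone =
  fixes d :: nat and T :: "(nat \<Rightarrow> real) set"
  assumes closed_T: "closed T" and coord_T: "x \<in> T \<Longrightarrow> d \<le> i \<Longrightarrow> x i = 0"
    and scale_T: "x \<in> T \<Longrightarrow> 0 \<le> c \<Longrightarrow> (\<lambda>i. c * x i) \<in> T"
begin

lemma closed_nrm_le: "closed {x. nrm d x \<le> R}" "closed {x. R \<le> nrm d x}"
  by (intro closed_Collect_le continuous_intros)+

lemma compact_cball: "compact (T \<inter> {x. nrm d x \<le> R})"
proof -
  have "compactin (product_topology (\<lambda>i::nat. euclideanreal) UNIV) (PiE UNIV (\<lambda>i. {-R..R}))"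
    by (subst compactin_PiE) simp
  then have "compact (PiE UNIV (\<lambda>i::nat. {-R..R}))"
    by (simp add: euclidean_product_topology)
  moreover have "T \<inter> {x. nrm d x \<le> R} \<subseteq> PiE UNIV (\<lambda>i. {-R..R})"
  proof
    fix x assume x: "x \<in> T \<inter> {x. nrm d x \<le> R}"
    then have R: "0 \<le> R" using nrm_nonneg[of d x] by (simp del: nrm_nonneg)
    have "\<bar>x i\<bar> \<le> R" for i
      using abs_le_nrm[of i d x] coord_T[of x i] x R by (cases "i < d") auto
    then have "- R \<le> x i \<and> x i \<le> R" for i by (metis abs_le_D1 abs_le_D2 minus_le_iff)
    then show "x \<in> PiE UNIV (\<lambda>i. {-R..R})" by auto
  qed
  moreover have "closed (T \<inter> {x. nrm d x \<le> R})"
    by (intro closed_Int closed_T closed_nrm_le)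
  ultimately show ?thesis by (metis compact_Int_closed inf.absorb_iff2)
qed

text \<open>On the part of radius at most \<open>R + 1\<close> this is the inverse of a continuous
  injection of a compact set, on the part of radius at least \<open>R + 1\<close> it is the
  identity; both parts are closed. The added 1 makes the second part lie beyond \<open>R\<close>,
  where points are fixed.\<close>

lemma continuous_inv:
  assumes "\<phi> \<in> carrier (homeo_group d T)" shows "continuous_on T (inv_into UNIV \<phi>)"
proof -
  obtain R where R: "\<And>x. R < nrm d x \<Longrightarrow> \<phi> x = x" using homeo_groupD(4)[OF assms] by blast
  note b = bij_inv_into_cancel[OF homeo_groupD(1)[OF assms]]
  define K where "K = T \<inter> {x. nrm d x \<le> R + 1}"
  have "\<phi> x = x" if "x \<notin> K" for x
    using that R[of x] homeo_groupD(2)[OF assms, of x] by (auto simp: K_def)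
  then have "\<phi> x \<in> K \<longleftrightarrow> x \<in> K" for x
    using bij_fixed_off_iff[OF homeo_groupD(1)[OF assms]] by blast
  then have K: "\<phi> ` K = K" using b by (auto simp: image_iff) metis
  have c1: "continuous_on (\<phi> ` K) (inv_into UNIV \<phi>)"
    using homeo_groupD(3)[OF assms] compact_cball[of "R + 1"] b
    by (intro continuous_on_inv) (auto simp: K_def intro: continuous_on_subset)
  have c2: "continuous_on (T \<inter> {x. R + 1 \<le> nrm d x}) (inv_into UNIV \<phi>)"
  proof (rule continuous_on_eq[OF continuous_on_id])
    fix x assume "x \<in> T \<inter> {x. R + 1 \<le> nrm d x}"
    then have "\<phi> x = x" using R by simp
    then show "x = inv_into UNIV \<phi> x" using b(1)[of x] by simp
  qed
  have "closed K" "closed (T \<inter> {x. R + 1 \<le> nrm d x})"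
    unfolding K_def by (intro closed_Int closed_T closed_nrm_le)+
  from continuous_on_closed_Un[OF this c1[unfolded K] c2]
  have "continuous_on (K \<union> (T \<inter> {x. R + 1 \<le> nrm d x})) (inv_into UNIV \<phi>)" .
  moreover have "K \<union> (T \<inter> {x. R + 1 \<le> nrm d x}) = T" by (auto simp: K_def)
  ultimately show ?thesis by simp
qed

lemma inv_homeo_group:
  assumes "\<phi> \<in> carrier (homeo_group d T)" shows "inv_into UNIV \<phi> \<in> carrier (homeo_group d T)"
proof -
  obtain R where R: "\<And>x. R < nrm d x \<Longrightarrow> \<phi> x = x" using homeo_groupD(4)[OF assms] by blast
  note b = bij_inv_into_cancel[OF homeo_groupD(1)[OF assms]]
  show ?thesis
  proof (rule homeo_groupI[where R = R])
    show "bij (inv_into UNIV \<phi>)" using homeo_groupD(1)[OF assms] by (rule bij_imp_bij_inv)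
    show "inv_into UNIV \<phi> x = x" if "x \<notin> T" for x using b(1)[of x] homeo_groupD(2)[OF assms that] by simp
    show "inv_into UNIV \<phi> x = x" if "R < nrm d x" for x using b(1)[of x] R[OF that] by simp
  qed (rule continuous_inv[OF assms])
qed

lemma group_homeo_group: "group (homeo_group d T)"
proof (rule groupI)
  fix \<phi> \<psi> assume p: "\<phi> \<in> carrier (homeo_group d T)" "\<psi> \<in> carrier (homeo_group d T)"
  obtain R R' where R: "\<And>x. R < nrm d x \<Longrightarrow> \<phi> x = x" "\<And>x. R' < nrm d x \<Longrightarrow> \<psi> x = x"
    using homeo_groupD(4)[OF p(1)] homeo_groupD(4)[OF p(2)] by blast
  have "\<phi> \<circ> \<psi> \<in> carrier (homeo_group d T)"
  proof (rule homeo_groupI[where R = "max R R'"])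
    show "bij (\<phi> \<circ> \<psi>)" using p homeo_groupD(1) bij_comp by blast
    show "continuous_on T (\<phi> \<circ> \<psi>)"
      using homeo_groupD(3)[OF p(1)] homeo_groupD(3)[OF p(2)] homeo_group_into[OF p(2)]
      by (intro continuous_on_compose) (auto intro: continuous_on_subset)
  qed (use R homeo_groupD(2)[OF p(1)] homeo_groupD(2)[OF p(2)] in auto)
  then show "\<phi> \<otimes>\<^bsub>homeo_group d T\<^esub> \<psi> \<in> carrier (homeo_group d T)" by simp
next
  show "\<one>\<^bsub>homeo_group d T\<^esub> \<in> carrier (homeo_group d T)"
    by (auto intro: homeo_groupI continuous_on_id')
next
  fix \<phi> assume p: "\<phi> \<in> carrier (homeo_group d T)"
  then show "\<exists>\<psi>\<in>carrier (homeo_group d T). \<psi> \<otimes>\<^bsub>homeo_group d T\<^esub> \<phi> = \<one>\<^bsub>homeo_group d T\<^esub>"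
    using inv_homeo_group bij_inv_into_cancel(1)[OF homeo_groupD(1)[OF p]]
    by (intro bexI[of _ "inv_into UNIV \<phi>"]) auto
qed (auto simp: o_assoc)

lemma comp_homeo_group:
  "\<phi> \<in> carrier (homeo_group d T) \<Longrightarrow> \<psi> \<in> carrier (homeo_group d T) \<Longrightarrow> \<phi> \<circ> \<psi> \<in> carrier (homeo_group d T)"
  using monoid.m_closed[OF group.is_monoid[OF group_homeo_group], of \<phi> \<psi>] by simp

lemma id_homeo_group: "id \<in> carrier (homeo_group d T)"
  using monoid.one_closed[OF group.is_monoid[OF group_homeo_group]] by simp

lemma funpow_homeo_group: "\<phi> \<in> carrier (homeo_group d T) \<Longrightarrow> \<phi> ^^ n \<in> carrier (homeo_group d T)"
  by (induction n) (auto simp: id_homeo_group intro: comp_homeo_group)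

lemma word_act_homeo_group:
  "(\<And>b. s b \<in> carrier (homeo_group d T)) \<Longrightarrow> word_act s bs \<in> carrier (homeo_group d T)"
  by (induction bs) (auto simp del: word_act_simps(2) simp: word_act_simps(2)[abs_def] id_homeo_group intro: comp_homeo_group)

text \<open>The infinite product is a uniform limit of finite products, since the pieces form a null family.\<close>

lemma patch_homeo_group:
  fixes u :: "'j \<Rightarrow> (nat \<Rightarrow> real) \<Rightarrow> (nat \<Rightarrow> real)" and J :: "nat \<Rightarrow> 'j set"
  assumes dp: "disjoint_pieces u B" and B: "B \<subseteq> T"
    and u: "\<And>j. u j \<in> carrier (homeo_group d T)" and h: "\<And>j. h j \<in> carrier (homeo_group d T)"
    and hB: "\<And>j x. x \<notin> B \<Longrightarrow> h j x = x"
    and bounded: "\<And>j x. x \<in> B \<Longrightarrow> nrm d (u j x) \<le> R"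
    and J: "\<And>m. finite (J m)" and \<epsilon>: "\<epsilon> \<longlonglongrightarrow> 0"
    and small: "\<And>m j x y. j \<notin> J m \<Longrightarrow> x \<in> B \<Longrightarrow> y \<in> B \<Longrightarrow> dst d (u j x) (u j y) \<le> \<epsilon> m"
  shows "patch u h B UNIV \<in> carrier (homeo_group d T)"
proof -
  interpret disjoint_pieces u B by fact
  note b = bij_inv_into_cancel[OF bij_u]
  have hBiff: "h j x \<in> B \<longleftrightarrow> x \<in> B" for j x
    using bij_fixed_off_iff[OF homeo_groupD(1)[OF h[of j]]] hB by blast
  have fin: "patch u h B F \<in> carrier (homeo_group d T)" if "finite F" for F
    using that
  proof (induction F)
    case empty
    have "patch u h B {} = id" by (auto simp: patch_def)
    then show ?case using id_homeo_group by (simp only:)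
  next
    case (insert j F)
    define g where "g = u j \<circ> h j \<circ> inv_into UNIV (u j)"
    \<comment> \<open>A further index contributes one more conjugate as a factor, since this
      conjugate is the identity on all the other pieces.\<close>
    have "patch u h B (insert j F) = g \<circ> patch u h B F"
    proof
      fix z
      show "patch u h B (insert j F) z = (g \<circ> patch u h B F) z"
      proof (cases z rule: patch_cases[of "insert j F"])
        case (1 k x)
        show ?thesis
        proof (cases "k = j")
          case True
          have "patch u h B F z = z"
            by (rule patch_out) (use 1 True insert.hyps disj_u in blast)
          then show ?thesis using 1 True b by (simp add: patch_in g_def)
        next
          case False
          then have "k \<in> F" using 1 by simp
          moreover have "inv_into UNIV (u j) (u k (h k x)) \<notin> B"
          proof
            assume "inv_into UNIV (u j) (u k (h k x)) \<in> B"
            then have "k = j" using disj_u[of "h k x" "inv_into UNIV (u j) (u k (h k x))" k j] hBiff 1 b by simp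
            then show False using False by simp
          qed
          ultimately show ?thesis using 1 b hB by (simp add: patch_in g_def)
        qed
      next
        case 2
        then have "patch u h B (insert j F) z = z" "patch u h B F z = z" by (auto intro!: patch_out)
        moreover have "inv_into UNIV (u j) z \<notin> B" using 2[of j] b(2)[of j z] by (metis imageI insertI1)
        ultimately show ?thesis using hB b by (simp add: g_def)
      qed
    qed
    then show ?case unfolding g_def using insert.IH u h inv_homeo_group by (metis comp_homeo_group)
  qed
  have TT: "patch u h B F z \<in> T" if "z \<in> T" for F z
  proof (cases z rule: patch_cases[of F])
    case (1 k x)
    then show ?thesis using B hBiff homeo_group_into[OF u] by (auto simp: patch_in)
  next
    case 2
    then have "patch u h B F z = z" by (intro patch_out) auto
    then show ?thesis using that by simp
  qed
  \<comment> \<open>The partial and the full product differ only inside pieces not indexed by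
    \<open>J m\<close>, and there by at most the diameter of the piece.\<close>
  have close: "dst d (patch u h B (J m) z) (patch u h B UNIV z) \<le> \<bar>\<epsilon> m\<bar>" for m z
  proof -
    have z0: "dst d z z = 0" for z by (simp add: dst_def nrm_def L2_set_0')
    show ?thesis
    proof (cases z rule: patch_cases[of UNIV])
      case (1 k x)
      show ?thesis
      proof (cases "k \<in> J m")
        case True
        then show ?thesis using 1 z0 by (simp add: patch_in)
      next
        case False
        have "patch u h B (J m) z = z"
          by (rule patch_out) (use 1 False disj_u in blast)
        then show ?thesis using 1 small[OF False, of x "h k x"] hBiff by (simp add: patch_in)
      qed
    next
      case 2
      then have "patch u h B (J m) z = z" "patch u h B UNIV z = z" by (auto intro!: patch_out)
      then show ?thesis using z0 by simp
    qed
  qed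
  have cont: "continuous_on T (\<lambda>z. patch u h B UNIV z c)" for c
  proof (rule uniform_limit_theorem[where F = sequentially and f = "\<lambda>m z. patch u h B (J m) z c"])
    have "continuous_on T (\<lambda>z. patch u h B (J m) z c)" for m
      using continuous_on_product_then_coordinatewise[OF homeo_groupD(3)[OF fin[OF J[of m]]]] .
    then show "\<forall>\<^sub>F m in sequentially. continuous_on T (\<lambda>z. patch u h B (J m) z c)"
      by (intro always_eventually allI)
    show "uniform_limit T (\<lambda>m z. patch u h B (J m) z c) (\<lambda>z. patch u h B UNIV z c) sequentially"
    proof (rule uniform_limitI)
      fix e :: real assume "e > 0"
      have "\<forall>\<^sub>F m in sequentially. \<bar>\<epsilon> m\<bar> < e"
        using tendstoD[OF \<epsilon> \<open>e > 0\<close>] by simp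
      then show "\<forall>\<^sub>F m in sequentially. \<forall>z\<in>T. dist (patch u h B (J m) z c) (patch u h B UNIV z c) < e"
      proof eventually_elim
        case (elim m)
        show ?case
        proof
          fix z assume z: "z \<in> T"
          have "\<bar>patch u h B (J m) z c - patch u h B UNIV z c\<bar> \<le> \<bar>\<epsilon> m\<bar>"
          proof (cases "c < d")
            case True
            then show ?thesis
              using abs_le_nrm[OF True, of "\<lambda>i. patch u h B (J m) z i - patch u h B UNIV z i"] close[of m z]
              by (simp add: dst_def)
          next
            case False
            then show ?thesis using coord_T[OF TT[OF z]] by simp
          qed
          then show "dist (patch u h B (J m) z c) (patch u h B UNIV z c) < e"
            using elim by (simp add: dist_real_def)
        qed
      qed
    qed
  qed simp
  show ?thesis
  proof (rule homeo_groupI[where R = R])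
    show "bij (patch u h B UNIV)" by (rule bij_patch[OF homeo_groupD(1)[OF h] hB])
    show "continuous_on T (patch u h B UNIV)" by (rule continuous_on_coordinatewise_then_product) (rule cont)
    show "patch u h B UNIV x = x" if "x \<notin> T" for x
    proof (rule patch_out, rule notI)
      fix j assume "x \<in> u j ` B"
      then show False using that B homeo_group_into[OF u] by auto
    qed
    show "patch u h B UNIV x = x" if "R < nrm d x" for x
    proof (rule patch_out, rule notI)
      fix j assume "x \<in> u j ` B"
      then show False using that bounded[of _ j] by (auto simp: not_less[symmetric])
    qed
  qed
qed

end

subsection \<open>Cones invariant under translation along the last coordinate\<close>

definition last_vec :: "nat \<Rightarrow> real \<Rightarrow> nat \<Rightarrow> real" where
  "last_vec d v = (\<lambda>i. if i = d - 1 then v else 0)"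

section \<open>Radial contractions\<close>

definition ramp :: "real \<Rightarrow> real \<Rightarrow> real \<Rightarrow> real" where
  "ramp l a r = min 1 (max l (l + (1 - l) * (r - a)))"

lemma ramp:
  assumes "0 < l" "l < 1"
  shows "l \<le> ramp l a r" "0 < ramp l a r" "r \<le> a \<Longrightarrow> ramp l a r = l" "a + 1 \<le> r \<Longrightarrow> ramp l a r = 1"
    "r \<le> s \<Longrightarrow> ramp l a r \<le> ramp l a s"
proof -
  show "l \<le> ramp l a r" using assms by (simp add: ramp_def)
  then show "0 < ramp l a r" using assms by linarith
  show "ramp l a r = l" if "r \<le> a"
    using mult_nonneg_nonpos[of "1 - l" "r - a"] that assms by (simp add: ramp_def)
  show "ramp l a r = 1" if "a + 1 \<le> r"
  proof -
    have "1 - l \<le> (1 - l) * (r - a)" using mult_left_mono[of 1 "r - a" "1 - l"] that assms by simp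
    then show ?thesis using assms unfolding ramp_def by linarith
  qed
  show "ramp l a r \<le> ramp l a s" if "r \<le> s"
  proof -
    have "(1 - l) * (r - a) \<le> (1 - l) * (s - a)" using that assms by (intro mult_left_mono) auto
    then show ?thesis unfolding ramp_def by linarith
  qed
qed

lemma ramp_strict:
  assumes "0 < l" "l < 1" "0 \<le> r" "r < s" shows "r * ramp l a r < s * ramp l a s"
proof -
  have "r * ramp l a r \<le> r * ramp l a s" using ramp(5)[of l r s a] assms by (intro mult_left_mono) auto
  also have "\<dots> < s * ramp l a s" using ramp(2)[of l a s] assms by simp
  finally show ?thesis .
qed

lemma ramp_surj:
  assumes "0 < l" "l < 1" "0 \<le> s" obtains r where "0 \<le> r" "r * ramp l a r = s"
proof -
  have "\<exists>r\<ge>0. r \<le> s / l \<and> r * ramp l a r = s"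
  proof (rule IVT')
    have "s = (s / l) * l" using assms by simp
    also have "\<dots> \<le> (s / l) * ramp l a (s / l)" using ramp(1)[of l a] assms by (intro mult_left_mono) auto
    finally show "s \<le> s / l * ramp l a (s / l)" .
    show "continuous_on {0..s / l} (\<lambda>r. r * ramp l a r)"
      unfolding ramp_def by (intro continuous_intros)
  qed (use assms in auto)
  then show ?thesis using that by blast
qed

lemma nrm_last_vec: "0 < d \<Longrightarrow> nrm d (last_vec d v) = \<bar>v\<bar>"
proof -
  assume d: "0 < d"
  have "(\<Sum>i<d. (if i = d - 1 then v else 0)\<^sup>2) = (\<Sum>i<d. if i = d - 1 then v\<^sup>2 else 0)"
    by (intro sum.cong) auto
  also have "\<dots> = v\<^sup>2" using d by simp
  finally show ?thesis by (simp add: nrm_def L2_set_def last_vec_def)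
qed

lemma dst_last_vec: "0 < d \<Longrightarrow> dst d (last_vec d v) (last_vec d w) = \<bar>v - w\<bar>"
proof -
  assume d: "0 < d"
  have "(\<lambda>i. last_vec d v i - last_vec d w i) = last_vec d (v - w)" by (auto simp: last_vec_def)
  then show ?thesis using nrm_last_vec[OF d] by (simp add: dst_def)
qed

locale line_cone = cone +
  assumes d_pos: "0 < d" and line_T: "x \<in> T \<Longrightarrow> (\<lambda>i. x i + last_vec d v i) \<in> T"
begin

text \<open>A homothety of ratio \<open>l\<close> up to distance \<open>a\<close> from the point at
  height \<open>v\<close> on the last axis, damped to the identity at distance
  \<open>a + 1\<close>.\<close>

definition rad :: "real \<Rightarrow> real \<Rightarrow> real \<Rightarrow> (nat \<Rightarrow> real) \<Rightarrow> (nat \<Rightarrow> real)" where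
  "rad v l a x = (if x \<in> T then (\<lambda>i. last_vec d v i + ramp l a (dst d x (last_vec d v)) * (x i - last_vec d v i)) else x)"

text \<open>For \<open>m > 1\<close> this is not a convex combination; translations in both
  directions along the axis account for that case, which occurs when \<open>rad\<close> is
  inverted.\<close>

lemma homothety_T: "x \<in> T \<Longrightarrow> 0 \<le> m \<Longrightarrow> (\<lambda>i. last_vec d v i + m * (x i - last_vec d v i)) \<in> T"
proof -
  assume "x \<in> T" "0 \<le> m"
  then have "(\<lambda>i. m * x i + last_vec d ((1 - m) * v) i) \<in> T" by (intro line_T scale_T)
  moreover have "(\<lambda>i. m * x i + last_vec d ((1 - m) * v) i) = (\<lambda>i. last_vec d v i + m * (x i - last_vec d v i))"
    by (auto simp: last_vec_def algebra_simps)
  ultimately show ?thesis by simp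
qed

lemma dst_homothety:
  "dst d (\<lambda>i. c i + m * (x i - c i)) c = \<bar>m\<bar> * dst d x c"
  "dst d (\<lambda>i. c i + m * (x i - c i)) (\<lambda>i. c i + m * (y i - c i)) = \<bar>m\<bar> * dst d x y"
  using nrm_scale[of d m "\<lambda>i. x i - c i"] nrm_scale[of d m "\<lambda>i. x i - y i"]
  by (auto simp: dst_def algebra_simps)

text \<open>On every ray from the centre the distance \<open>r\<close> becomes
  \<open>r * ramp l a r\<close>, a strictly increasing function; surjectivity comes from the
  intermediate value theorem.\<close>

lemma rad_homeo:
  assumes l: "0 < l" "l < 1"
  shows "rad v l a \<in> carrier (homeo_group d T)"
proof (rule homeo_groupI[where R = "a + 1 + \<bar>v\<bar>"])
  define c where "c = last_vec d v"
  define \<rho> where "\<rho> = (\<lambda>r. r * ramp l a r)"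
  note rp = ramp[OF l, of a]
  have radT: "rad v l a x \<in> T" if "x \<in> T" for x
    using homothety_T[OF that less_imp_le[OF rp(2)]] that by (simp add: rad_def)
  have dr: "dst d (rad v l a x) c = \<rho> (dst d x c)" if "x \<in> T" for x
    using dst_homothety(1)[of c "ramp l a (dst d x c)" x] that
    by (simp add: rad_def c_def \<rho>_def mult.commute abs_of_pos[OF rp(2)])
  have inj: "x = y" if "x \<in> T" "y \<in> T" "rad v l a x = rad v l a y" for x y
  proof -
    have "\<rho> (dst d x c) = \<rho> (dst d y c)" using dr that by metis
    then have e: "dst d x c = dst d y c"
      using ramp_strict[OF l dst_nonneg, of d x c "dst d y c" a] ramp_strict[OF l dst_nonneg, of d y c "dst d x c" a]
      unfolding \<rho>_def by (cases "dst d x c" "dst d y c" rule: linorder_cases) auto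
    have "x i = y i" for i
    proof -
      have "rad v l a x i = rad v l a y i" using that by simp
      then have "ramp l a (dst d y c) * (x i - c i) = ramp l a (dst d y c) * (y i - c i)"
        using that e by (simp add: rad_def c_def)
      then show ?thesis using rp(2)[of "dst d y c"] by simp
    qed
    then show ?thesis by blast
  qed
  have surj: "\<exists>x\<in>T. rad v l a x = y" if "y \<in> T" for y
  proof -
    obtain r where r: "0 \<le> r" "r * ramp l a r = dst d y c" by (rule ramp_surj[OF l dst_nonneg])
    define m where "m = ramp l a r"
    have m: "0 < m" by (simp add: m_def rp)
    define x where "x = (\<lambda>i. c i + (1 / m) * (y i - c i))"
    have xT: "x \<in> T" unfolding x_def c_def using m by (intro homothety_T that) auto
    have "dst d x c = (1 / m) * dst d y c" unfolding x_def dst_homothety using m by simp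
    also have "\<dots> = r" using r m by (simp add: m_def[symmetric] field_simps)
    finally have "rad v l a x = (\<lambda>i. c i + m * (x i - c i))" using xT by (simp add: rad_def c_def m_def)
    then have "rad v l a x = y" using m by (simp add: x_def)
    then show ?thesis using xT by blast
  qed
  show "bij (rad v l a)"
  proof (rule bijI')
    fix x y show "rad v l a x = rad v l a y \<longleftrightarrow> x = y"
      using inj radT by (metis rad_def)
  next
    fix y show "\<exists>x. y = rad v l a x"
      using surj[of y] by (cases "y \<in> T") (auto simp: rad_def)
  qed
  show "rad v l a x = x" if "x \<notin> T" for x using that by (simp add: rad_def)
  have "continuous_on T (\<lambda>x i. last_vec d v i + ramp l a (dst d x (last_vec d v)) * (x i - last_vec d v i))"
    unfolding ramp_def dst_def by (intro continuous_on_coordinatewise_then_product continuous_intros)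
  then show "continuous_on T (rad v l a)"
    by (rule continuous_on_eq) (simp add: rad_def)
  show "rad v l a x = x" if "a + 1 + \<bar>v\<bar> < nrm d x" for x
  proof -
    have "a + 1 \<le> dst d x c" using nrm_le_dst[of d x c] nrm_last_vec[OF d_pos, of v] that by (simp add: c_def)
    then show ?thesis using rp(4) by (simp add: rad_def c_def)
  qed
qed

lemma rad_near:
  assumes "0 < l" "l < 1" "x \<in> T" "dst d x (last_vec d v) \<le> a"
  shows "rad v l a x = (\<lambda>i. last_vec d v i + l * (x i - last_vec d v i))"
    "dst d (rad v l a x) (last_vec d v) = l * dst d x (last_vec d v)"
  using assms ramp(3)[OF assms(1,2,4)] by (simp_all add: rad_def dst_homothety)

text \<open>Write \<open>e\<close> for the last unit vector. The core lies in \<open>2 \<le> \<bar>x - 3e\<bar> \<le> 4\<close>, where \<open>shrink\<close> is the homothety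
  of centre \<open>3e\<close> and ratio \<open>1/4\<close>, so its iterates are disjoint; \<open>fork\<close> maps the room into the balls of
  radius \<open>7/4\<close> about \<open>6e\<close> and \<open>-6e\<close>.\<close>

definition core :: "(nat \<Rightarrow> real) set" where "core = {x \<in> T. nrm d x \<le> 1}"
definition room :: "(nat \<Rightarrow> real) set" where "room = {x \<in> T. nrm d x \<le> 8}"
definition shrink :: "(nat \<Rightarrow> real) \<Rightarrow> (nat \<Rightarrow> real)" where "shrink = rad 3 (1/4) 4"
definition fork :: "bool \<Rightarrow> (nat \<Rightarrow> real) \<Rightarrow> (nat \<Rightarrow> real)" where
  "fork b = rad (if b then 6 else - 6) (1/8) 14"

lemma shrink_homeo: "shrink \<in> carrier (homeo_group d T)"
  unfolding shrink_def by (rule rad_homeo) auto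

lemma fork_homeo: "fork b \<in> carrier (homeo_group d T)"
  unfolding fork_def by (rule rad_homeo) auto

lemma funpow_shrink:
  assumes "x \<in> core"
  shows "(shrink ^^ n) x \<in> T" "dst d ((shrink ^^ n) x) (last_vec d 3) \<le> 4 * (1/4) ^ n"
    "(shrink ^^ n) x = (\<lambda>i. last_vec d 3 i + (1/4) ^ n * (x i - last_vec d 3 i))"
proof -
  have "(shrink ^^ n) x \<in> T \<and> dst d ((shrink ^^ n) x) (last_vec d 3) \<le> 4 * (1/4) ^ n \<and>
    (shrink ^^ n) x = (\<lambda>i. last_vec d 3 i + (1/4) ^ n * (x i - last_vec d 3 i))"
  proof (induction n)
    case 0
    then show ?case using assms dst_le_nrm[of d x "last_vec d 3"] nrm_last_vec[OF d_pos, of 3] by (simp add: core_def)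
  next
    case (Suc n)
    define z where "z = (shrink ^^ n) x"
    have z: "z \<in> T" "dst d z (last_vec d 3) \<le> 4 * (1/4) ^ n"
      "z = (\<lambda>i. last_vec d 3 i + (1/4) ^ n * (x i - last_vec d 3 i))" using Suc by (auto simp: z_def)
    have "(1/4::real) ^ n \<le> 1" by (simp add: power_le_one)
    then have "dst d z (last_vec d 3) \<le> 4" using z(2) by linarith
    note rn = rad_near[of "1/4" z 3 4, OF _ _ z(1) this]
    have "shrink z \<in> T" using z(1) homeo_group_into[OF shrink_homeo] by blast
    moreover have "dst d (shrink z) (last_vec d 3) \<le> 4 * (1/4) ^ Suc n"
      using rn(2) z(2) by (simp add: shrink_def)
    moreover have "shrink z = (\<lambda>i. last_vec d 3 i + (1/4) ^ Suc n * (x i - last_vec d 3 i))"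
      using rn(1) by (simp add: shrink_def) (simp add: z(3))
    ultimately show ?case by (simp add: z_def)
  qed
  then show "(shrink ^^ n) x \<in> T" "dst d ((shrink ^^ n) x) (last_vec d 3) \<le> 4 * (1/4) ^ n"
    "(shrink ^^ n) x = (\<lambda>i. last_vec d 3 i + (1/4) ^ n * (x i - last_vec d 3 i))" by auto
qed

lemma fork_near:
  fixes b :: bool
  assumes "x \<in> room"
  defines "c \<equiv> last_vec d (if b then 6 else - 6)"
  shows "fork b x = (\<lambda>i. c i + (1/8) * (x i - c i))" "dst d (fork b x) c \<le> 7/4"
proof -
  have x: "x \<in> T" "dst d x c \<le> 14"
    using assms dst_le_nrm[of d x c] nrm_last_vec[OF d_pos, of 6] nrm_last_vec[OF d_pos, of "- 6"]
    by (auto simp: room_def)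
  note rn = rad_near[of "1/8" x "if b then 6 else - 6" 14, OF _ _ x(1) x(2)[unfolded c_def]]
  show "fork b x = (\<lambda>i. c i + (1/8) * (x i - c i))"
    using rn(1) unfolding fork_def c_def by simp
  have "dst d (fork b x) c = (1/8) * dst d x c"
    using rn(2) unfolding fork_def c_def by simp
  then show "dst d (fork b x) c \<le> 7/4" using x(2) by linarith
qed

sublocale tower core room shrink fork
proof
  show "bij shrink" "bij (fork b)" for b
    using homeo_groupD(1) shrink_homeo fork_homeo by blast+
  show "core \<subseteq> room" by (auto simp: core_def room_def)
  show "shrink x = x" if "x \<notin> room" for x
  proof (cases "x \<in> T")
    case True
    then have "8 < nrm d x" using that by (auto simp: room_def)
    \<comment> \<open>This fixes the radius of the room: 8 is 5, the distance at which
      \<open>shrink\<close> becomes the identity, plus 3, the distance of its centre from the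
      origin.\<close>
    then have "4 + 1 \<le> dst d x (last_vec d 3)" using nrm_le_dst[of d x "last_vec d 3"] nrm_last_vec[OF d_pos, of 3] by simp
    then show ?thesis using ramp(4)[of "1/4" 4] by (simp add: shrink_def rad_def)
  qed (simp add: shrink_def rad_def)
  show "(shrink ^^ Suc n) x \<notin> core" if "x \<in> core" for x n
  proof
    define z where "z = (shrink ^^ Suc n) x"
    assume "(shrink ^^ Suc n) x \<in> core"
    then have "nrm d z \<le> 1" by (simp add: core_def z_def)
    have "(1/4::real) ^ n \<le> 1" by (simp add: power_le_one)
    \<comment> \<open>One contraction brings the point within 1 of the centre, while the core keeps
      distance at least 2 from it.\<close>
    then have "dst d z (last_vec d 3) \<le> 1" using funpow_shrink(2)[OF that, of "Suc n"] unfolding z_def by simp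
    then show False
      using nrm_le_dst[of d "last_vec d 3" z] dst_commute[of d z "last_vec d 3"] nrm_last_vec[OF d_pos, of 3] \<open>nrm d z \<le> 1\<close> by simp
  qed
  show "fork b ` room \<subseteq> room" for b
  proof
    fix y assume "y \<in> fork b ` room"
    then obtain x where x: "x \<in> room" "y = fork b x" by blast
    \<comment> \<open>The radius 14 in \<open>fork\<close> is 8 + 6, so that the whole room is
      contracted by \<open>1/8\<close>, into radius \<open>7/4\<close>; and 6 + 7/4 is below
      8.\<close>
    have "nrm d y \<le> 8"
      using fork_near(2)[OF x(1), of b] nrm_le_dst[of d y "last_vec d (if b then 6 else - 6)"]
        nrm_last_vec[OF d_pos, of 6] nrm_last_vec[OF d_pos, of "- 6"] x(2) by (auto split: if_splits)
    moreover have "y \<in> T" using x homeo_group_into[OF fork_homeo] by (auto simp: room_def)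
    ultimately show "y \<in> room" by (simp add: room_def)
  qed
  show "fork True ` room \<inter> fork False ` room = {}"
  proof (rule ccontr)
    assume "fork True ` room \<inter> fork False ` room \<noteq> {}"
    then obtain x y where xy: "x \<in> room" "y \<in> room" "fork True x = fork False y" by blast
    \<comment> \<open>The two centres are 12 apart, more than twice \<open>7/4\<close>.\<close>
    have "dst d (last_vec d 6) (last_vec d (- 6)) \<le> dst d (last_vec d 6) (fork True x) + dst d (fork True x) (last_vec d (- 6))"
      by (rule dst_triangle)
    then show False
      using fork_near(2)[OF xy(1), of True] fork_near(2)[OF xy(2), of False] xy(3)
        dst_last_vec[OF d_pos, of 6 "- 6"] dst_commute[of d "last_vec d 6" "fork True x"] by simp
  qed
qed

text \<open>The letters contract by \<open>1/8\<close>; the weaker \<open>1/4\<close> is the ratio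
  of \<open>shrink\<close>, so that in \<open>dst_piece\<close> the two exponents simply
  add.\<close>

lemma dst_word_act:
  assumes "x \<in> room" "y \<in> room"
  shows "dst d (word_act fork bs x) (word_act fork bs y) \<le> (1/4) ^ length bs * dst d x y"
proof (induction bs)
  case (Cons b bs)
  have r: "word_act fork bs x \<in> room" "word_act fork bs y \<in> room"
    by (rule word_act_into[where s = fork and B = room, OF s_into]; fact assms)+
  have "dst d (word_act fork (b # bs) x) (word_act fork (b # bs) y)
      = (1/8) * dst d (word_act fork bs x) (word_act fork bs y)"
    unfolding word_act_simps o_apply fork_near(1)[OF r(1)] fork_near(1)[OF r(2)] dst_homothety(2) by simp
  also have "\<dots> \<le> (1/4) * dst d (word_act fork bs x) (word_act fork bs y)"
    by (intro mult_right_mono) auto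
  also have "\<dots> \<le> (1/4) * ((1/4) ^ length bs * dst d x y)" using Cons by simp
  finally show ?case by simp
qed simp

lemma dst_piece:
  assumes "x \<in> core" "y \<in> core"
  shows "dst d (piece (n, i) x) (piece (n, i) y) \<le> 2 * (1/4) ^ (length (code n) + i)"
proof -
  have r: "(shrink ^^ i) x \<in> room" "(shrink ^^ i) y \<in> room" using assms funpow_t_into sub by blast+
  have "dst d x y \<le> 2" using dst_le_nrm[of d x y] assms by (simp add: core_def)
  have "dst d (piece (n, i) x) (piece (n, i) y) \<le> (1/4) ^ length (code n) * dst d ((shrink ^^ i) x) ((shrink ^^ i) y)"
    using dst_word_act[OF r] by (simp add: piece_def)
  also have "dst d ((shrink ^^ i) x) ((shrink ^^ i) y) = (1/4) ^ i * dst d x y"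
    unfolding funpow_shrink(3)[OF assms(1)] funpow_shrink(3)[OF assms(2)] dst_homothety by simp
  also have "(1/4) ^ length (code n) * ((1/4) ^ i * dst d x y) \<le> (1/4) ^ length (code n) * ((1/4) ^ i * 2)"
    using \<open>dst d x y \<le> 2\<close> by (intro mult_left_mono) auto
  finally show ?thesis by (simp add: power_add mult_ac)
qed

lemma realizable_core:
  "log_realizable (homeo_group d T) {h \<in> carrier (homeo_group d T). \<forall>x. x \<notin> core \<longrightarrow> h x = x}"
    (is "log_realizable _ ?P")
proof (rule log_realizable_tower)
  fix h assume h: "\<And>n::nat. h n \<in> ?P"
  \<comment> \<open>Finite, because bounded code length bounds \<open>n\<close>; outside
    \<open>J m\<close> the pieces have diameter at most \<open>2 * (1/4) ^ m\<close>.\<close>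
  define J where "J = (\<lambda>m. {(n, i). length (code n) + i < m})"
  show "patch piece (h \<circ> fst) core UNIV \<in> carrier (homeo_group d T)"
  proof (rule patch_homeo_group[where J = J and \<epsilon> = "\<lambda>m. 2 * (1/4) ^ m" and R = 8])
    show "disjoint_pieces piece core" by (rule disjoint_pieces_axioms)
    show "core \<subseteq> T" by (auto simp: core_def)
    show "piece j \<in> carrier (homeo_group d T)" for j
      unfolding piece_def
      by (intro comp_homeo_group word_act_homeo_group funpow_homeo_group fork_homeo shrink_homeo)
    show "(h \<circ> fst) j \<in> carrier (homeo_group d T)" for j using h[of "fst j"] by simp
    show "(h \<circ> fst) j x = x" if "x \<notin> core" for j x using h[of "fst j"] that by simp
    show "nrm d (piece j x) \<le> 8" if "x \<in> core" for j x
    proof -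
      have "(shrink ^^ snd j) x \<in> room" using that funpow_t_into sub by blast
      then have "piece j x \<in> room"
        using word_act_into[where s = fork and B = room, OF s_into] by (simp add: piece_def)
      then show ?thesis by (simp add: room_def)
    qed
    show "finite (J m)" for m
    proof (rule finite_subset)
      show "J m \<subseteq> {..<2 ^ m} \<times> {..<m}"
      proof clarsimp
        fix n i assume "(n, i) \<in> J m"
        then have a: "length (code n) + i < m" by (simp add: J_def)
        have "n < 2 ^ length (code n)" by (rule less_two_power_length_code)
        also have "\<dots> \<le> 2 ^ m" using a by (intro power_increasing) auto
        finally show "n < 2 ^ m \<and> i < m" using a by simp
      qed
    qed simp
    show "(\<lambda>m. 2 * (1/4::real) ^ m) \<longlonglongrightarrow> 0"
      by (intro tendsto_mult_right_zero LIMSEQ_power_zero) simp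
    show "dst d (piece j x) (piece j y) \<le> 2 * (1/4) ^ m"
      if "j \<notin> J m" "x \<in> core" "y \<in> core" for m j x y
    proof -
      obtain n i where j: "j = (n, i)" by (cases j)
      then have "m \<le> length (code n) + i" using that(1) by (auto simp: J_def)
      then have "(1/4::real) ^ (length (code n) + i) \<le> (1/4) ^ m" by (intro power_decreasing) auto
      then have "2 * (1/4::real) ^ (length (code n) + i) \<le> 2 * (1/4) ^ m" by (rule mult_left_mono) simp
      with dst_piece[OF that(2,3), of n i] show ?thesis unfolding j by (rule order_trans)
    qed
  qed
qed (use group_homeo_group shrink_homeo fork_homeo homeo_groupD(1) id_homeo_group in auto)

end

subsection \<open>The half-line\<close>

definition half_line :: "(nat \<Rightarrow> real) set" where
  "half_line = {x. 0 \<le> x 0 \<and> (\<forall>i\<ge>1. x i = 0)}"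

section \<open>The unit interval as a compactified line\<close>

definition logistic :: "real \<Rightarrow> real" where "logistic y = 1 / (1 + exp (- y))"
definition logit :: "real \<Rightarrow> real" where "logit p = ln (p / (1 - p))"

lemma logistic_less: "x < y \<Longrightarrow> logistic x < logistic y"
  unfolding logistic_def by (intro divide_strict_left_mono) (auto simp: add_pos_pos)

lemma logistic_bounds: "0 < logistic y" "logistic y < 1"
  by (auto simp: logistic_def add_pos_pos)

lemma logit_logistic [simp]: "logit (logistic y) = y"
proof -
  have "0 < 1 + exp (- y)" by (simp add: add_pos_pos)
  then have "logistic y / (1 - logistic y) = 1 / exp (- y)" by (simp add: logistic_def field_simps)
  then show ?thesis by (simp add: logit_def ln_div)
qed

lemma logistic_logit: "0 < p \<Longrightarrow> p < 1 \<Longrightarrow> logistic (logit p) = p"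
  by (simp add: logistic_def logit_def exp_minus field_simps)

lemma logit_less: "0 < p \<Longrightarrow> p < q \<Longrightarrow> q < 1 \<Longrightarrow> logit p < logit q"
  using logistic_less[of "logit q" "logit p"] logistic_logit[of p] logistic_logit[of q]
  by (cases "logit p" "logit q" rule: linorder_cases) auto

text \<open>Acts on the open unit interval as \<open>f\<close> in the logistic coordinate. Whatever
  \<open>f\<close> does at infinity, the extension by the identity is continuous at 0 and 1.\<close>

definition squeeze :: "(real \<Rightarrow> real) \<Rightarrow> real \<Rightarrow> real" where
  "squeeze f y = (if 0 < y \<and> y < 1 then logistic (f (logit y)) else y)"

lemma squeeze_in: "0 < y \<and> y < 1 \<Longrightarrow> 0 < squeeze f y \<and> squeeze f y < 1"
  by (simp add: squeeze_def logistic_bounds)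

lemma squeeze_comp: "squeeze f (squeeze g y) = squeeze (f \<circ> g) y"
  using squeeze_in[of y g] by (auto simp: squeeze_def)

lemma squeeze_id: "squeeze id y = y"
  by (simp add: squeeze_def logistic_logit)

lemma squeeze_nonneg: "0 \<le> squeeze f y \<longleftrightarrow> 0 \<le> y"
  using squeeze_in[of y f] by (auto simp: squeeze_def)

text \<open>The map is increasing and onto, the latter because the squeeze of the inverse is a right
  inverse, and a monotone surjection of the line is continuous.\<close>

lemma continuous_squeeze:
  assumes f: "f \<in> carrier order_auts" shows "continuous_on S (squeeze f)"
proof -
  have mono: "squeeze f x < squeeze f y" if "x < y" for x y
  proof (cases "0 < x \<and> x < 1"; cases "0 < y \<and> y < 1")
    assume "0 < x \<and> x < 1" "0 < y \<and> y < 1"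
    then show ?thesis using that f logit_less logistic_less by (simp add: squeeze_def strict_mono_less)
  qed (use that squeeze_in[of x f] squeeze_in[of y f] in \<open>auto simp: squeeze_def split: if_splits\<close>)
  have "f \<circ> inv_into UNIV f = id" using inv_into_order_auts(3)[of f] f by auto
  then have "squeeze f (squeeze (inv_into UNIV f) y) = y" for y by (simp only: squeeze_comp squeeze_id)
  then have "range (squeeze f) = UNIV" by (metis surjI)
  then have "continuous_on UNIV (squeeze f)"
    using mono by (intro continuous_onI_mono) (auto simp: le_less)
  then show ?thesis by (rule continuous_on_subset) simp
qed

definition squeeze_map :: "(real \<Rightarrow> real) \<Rightarrow> (nat \<Rightarrow> real) \<Rightarrow> (nat \<Rightarrow> real)" where
  "squeeze_map f x = (if x \<in> half_line then x(0 := squeeze f (x 0)) else x)"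

lemma squeeze_map_into: "squeeze_map f x \<in> half_line \<longleftrightarrow> x \<in> half_line"
  by (auto simp: squeeze_map_def half_line_def squeeze_nonneg)

lemma squeeze_map_comp: "squeeze_map f (squeeze_map g x) = squeeze_map (f \<circ> g) x"
  using squeeze_map_into[of g x] squeeze_comp by (auto simp: squeeze_map_def fun_upd_def)

lemma nrm_1: "nrm (Suc 0) x = \<bar>x 0\<bar>"
  by (simp add: nrm_def L2_set_def)

interpretation half_line: cone 1 half_line
proof
  have "closed {x::nat \<Rightarrow> real. 0 \<le> x 0}" by (intro closed_Collect_le continuous_intros)
  moreover have "closed {x::nat \<Rightarrow> real. \<forall>i\<ge>1. x i = 0}"
    by (intro closed_Collect_all closed_Collect_imp closed_Collect_eq continuous_intros) simp
  ultimately show "closed half_line" unfolding half_line_def by (rule closed_Collect_conj)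
qed (auto simp: half_line_def)

lemma squeeze_map_homeo:
  assumes f: "f \<in> carrier order_auts" shows "squeeze_map f \<in> carrier (homeo_group 1 half_line)"
proof (rule homeo_groupI[where R = 1])
  have "inv_into UNIV f \<circ> f = id" "f \<circ> inv_into UNIV f = id"
    using inv_into_order_auts(3,4)[of f] f by auto
  then have "squeeze_map (inv_into UNIV f) (squeeze_map f x) = x"
    "squeeze_map f (squeeze_map (inv_into UNIV f) x) = x" for x
    by (simp_all only: squeeze_map_comp) (simp_all add: squeeze_map_def squeeze_id)
  then show "bij (squeeze_map f)" by (metis bijI')
  have "continuous_on half_line (\<lambda>x i. if i = 0 then squeeze f (x 0) else x i)"
  proof (rule continuous_on_coordinatewise_then_product)
    show "continuous_on half_line (\<lambda>x. if i = 0 then squeeze f (x 0) else x i)" for i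
      using continuous_on_compose2[OF continuous_squeeze[OF f, of UNIV] continuous_on_coord[of half_line 0]]
        continuous_on_coord[of half_line i]
      by (cases "i = 0") auto
  qed
  then show "continuous_on half_line (squeeze_map f)"
    by (rule continuous_on_eq) (auto simp: squeeze_map_def)
  show "squeeze_map f x = x" if "1 < nrm 1 x" for x
    using that by (auto simp: squeeze_map_def squeeze_def nrm_1)
qed (simp add: squeeze_map_def)

lemma group_hom_squeeze: "group_hom order_auts (homeo_group 1 half_line) squeeze_map"
  by (intro group_hom.intro group_hom_axioms.intro group_order_auts half_line.group_homeo_group homI
      squeeze_map_homeo) (auto simp: squeeze_map_comp)

text \<open>A homeomorphism of the half-line that is the identity beyond 1 is increasing and fixes 0
  and 1. Hence it acts on the open unit interval as an order automorphism, read in the logistic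
  coordinate.\<close>

lemma squeeze_map_surj:
  assumes h: "h \<in> carrier (homeo_group 1 half_line)" and id: "\<And>x. x \<in> half_line \<Longrightarrow> 1 < nrm 1 x \<Longrightarrow> h x = x"
  shows "h \<in> squeeze_map ` carrier order_auts"
proof -
  define pt where "pt = (\<lambda>(y::real) (i::nat). if i = 0 then y else 0)"
  have ptT: "pt y \<in> half_line \<longleftrightarrow> 0 \<le> y" for y by (auto simp: pt_def half_line_def)
  have xpt: "x = pt (x 0)" if "x \<in> half_line" for x
    using that by (auto simp: half_line_def pt_def)
  define q where "q = (\<lambda>y. h (pt y) 0)"
  note hb = homeo_groupD(1)[OF h]
  have hpt: "h (pt y) = pt (q y)" if "0 \<le> y" for y
    using xpt[of "h (pt y)"] homeo_group_into[OF h] ptT that by (simp add: q_def)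
  have q0: "0 \<le> q y" if "0 \<le> y" for y using hpt[OF that] homeo_group_into[OF h, of "pt y"] ptT that by metis
  have qinj: "y = z" if "0 \<le> y" "0 \<le> z" "q y = q z" for y z
  proof -
    have "pt y = pt z" using hpt that bij_is_inj[OF hb] by (metis injD)
    then show ?thesis by (metis pt_def)
  qed
  have q1: "q y = y" if "1 < y" for y
    using id[of "pt y"] that ptT by (simp add: q_def nrm_1) (simp add: pt_def)
  have qsurj: "\<exists>y\<ge>0. q y = z" if "0 \<le> z" for z
  proof -
    obtain x where x: "h x = pt z" using hb by (metis bij_pointE)
    then have "x \<in> half_line" using homeo_group_into[OF h] ptT that by metis
    then have "0 \<le> x 0" "q (x 0) = z" using xpt x by (auto simp: half_line_def q_def pt_def)
    then show ?thesis by blast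
  qed
  have "continuous_on {0..} (\<lambda>y. h (pt y))"
  proof (rule continuous_on_compose2[OF homeo_groupD(3)[OF h]])
    show "continuous_on {0..} pt"
    proof (rule continuous_on_coordinatewise_then_product)
      show "continuous_on {0..} (\<lambda>y. pt y i)" for i by (cases "i = 0") (simp_all add: pt_def)
    qed
  qed (use ptT in auto)
  then have qc: "continuous_on {0..} q"
    unfolding q_def by (rule continuous_on_product_then_coordinatewise)
  have qmono: "q y < q z" if yz: "0 \<le> y" "y < z" for y z
  proof -
    \<comment> \<open>The third point \<open>z + 2\<close> lies beyond 1, where \<open>q\<close> is
      the identity; comparison with it decides the orientation.\<close>
    have "(q y < q z \<and> q z < q (z + 2)) \<or> (q (z + 2) < q z \<and> q z < q y)"
    proof (rule continuous_inj_imp_mono[where f = q and a = y and b = "z + 2" and x = z])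
      show "continuous_on {y..z + 2} q" using qc by (rule continuous_on_subset) (use yz in auto)
      show "inj_on q {y..z + 2}" using qinj yz by (auto simp: inj_on_def)
    qed (use yz in auto)
    moreover have "\<not> q (z + 2) < q z"
    proof
      assume "q (z + 2) < q z"
      then have "z + 2 < q z" using q1[of "z + 2"] yz by simp
      then have "q (q z) = q z" using q1 yz by simp
      then have "q z = z" using qinj[of "q z" z] q0 yz by simp
      then show False using \<open>z + 2 < q z\<close> by simp
    qed
    ultimately show ?thesis by blast
  qed
  have q00: "q 0 = 0"
  proof -
    obtain y where y: "0 \<le> y" "q y = 0" using qsurj[of 0] by auto
    then show ?thesis using qmono[of 0 y] q0[of 0] by (cases "y = 0") auto
  qed
  have q11: "q 1 = 1"
  proof -
    obtain y where y: "0 \<le> y" "q y = 1" using qsurj[of 1] by auto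
    have "\<not> 1 < y" using q1[of y] y by auto
    moreover have False if "y < 1"
    proof -
      have "1 < q 1" using qmono[OF y(1) that] y by simp
      then have "q (q 1) = q 1" using q1 by simp
      then have "q 1 = 1" using qinj[of "q 1" 1] q0[of 1] by simp
      then show False using \<open>1 < q 1\<close> by simp
    qed
    ultimately have "y = 1" by force
    then show ?thesis using y by simp
  qed
  have qin: "0 < q y \<and> q y < 1" if "0 < y" "y < 1" for y
    using qmono[of 0 y] qmono[of y 1] q00 q11 that by simp
  define f where "f = (\<lambda>u. logit (q (logistic u)))"
  have "f x < f y" if "x < y" for x y
    unfolding f_def using qmono[of "logistic x" "logistic y"] logistic_less[OF that] logistic_bounds
    by (intro logit_less) (auto simp: qin less_imp_le)
  moreover have "\<exists>u. f u = v" for v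
  proof -
    obtain y where y: "0 \<le> y" "q y = logistic v" using qsurj[of "logistic v"] logistic_bounds[of v] by auto
    have "y \<noteq> 0" using y q00 logistic_bounds[of v] by auto
    moreover have "y < 1" using y q11 q1[of y] logistic_bounds[of v] by (cases y "1::real" rule: linorder_cases) auto
    ultimately have "f (logit y) = v" using y by (simp add: f_def logistic_logit)
    then show ?thesis by blast
  qed
  ultimately have f: "f \<in> carrier order_auts" unfolding order_auts_simps strict_mono_def surj_def by metis
  have sq: "squeeze f y = q y" if "0 \<le> y" for y
    using that q00 q11 q1[of y] qin[of y]
    by (cases y "1::real" rule: linorder_cases; cases "y = 0") (auto simp: squeeze_def f_def logistic_logit)
  have "h x = squeeze_map f x" for x
  proof (cases "x \<in> half_line")
    case True
    then have "h x = pt (q (x 0))" using hpt[of "x 0"] xpt by (auto simp: half_line_def)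
    also have "\<dots> = x(0 := q (x 0))" using True by (auto simp: pt_def half_line_def)
    finally show ?thesis using True sq by (auto simp: squeeze_map_def half_line_def)
  next
    case False
    then show ?thesis using homeo_groupD(2)[OF h] by (simp add: squeeze_map_def)
  qed
  then show ?thesis using f by blast
qed

lemma realizable_half_line:
  "log_realizable (homeo_group 1 half_line)
     (ball_homeos 1 half_line)"
  by (rule log_realizable_hom[OF group_hom_squeeze realizable_order_auts])
    (auto intro!: squeeze_map_surj)

section \<open>The identity component of the homeomorphism group\<close>

lemma homeosI:
  assumes "f \<in> extensional (topspace M)" "homeomorphic_maps M M f g" shows "f \<in> homeos M"
  using assms homeomorphic_map_maps unfolding homeos_def by blast

lemma homeos_Bij: "homeos M \<subseteq> Bij (topspace M)"
  unfolding homeos_def Bij_def by (auto simp: bij_betw_def homeomorphic_eq_everything_map)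

lemma homeos_into: "f \<in> homeos M \<Longrightarrow> x \<in> topspace M \<Longrightarrow> f x \<in> topspace M"
  using homeos_Bij[of M] Bij_imp_funcset by fastforce

lemma one_homeos: "\<one>\<^bsub>BijGroup (topspace M)\<^esub> \<in> homeos M"
proof (rule homeosI)
  show "homeomorphic_maps M M \<one>\<^bsub>BijGroup (topspace M)\<^esub> id"
    by (auto simp: BijGroup_def homeomorphic_maps_def intro: continuous_map_eq[OF continuous_map_id])
qed (simp add: BijGroup_def)

lemma mult_homeos:
  assumes "f \<in> homeos M" "g \<in> homeos M"
  shows "f \<otimes>\<^bsub>BijGroup (topspace M)\<^esub> g = compose (topspace M) f g" "compose (topspace M) f g \<in> homeos M"
proof -
  show "f \<otimes>\<^bsub>BijGroup (topspace M)\<^esub> g = compose (topspace M) f g"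
    using assms homeos_Bij by (auto simp: BijGroup_def)
  have "homeomorphic_map M M (f \<circ> g)"
    using assms by (intro homeomorphic_map_compose) (auto simp: homeos_def)
  then have "homeomorphic_map M M (compose (topspace M) f g)"
    by (rule homeomorphic_map_eq) (simp add: compose_def)
  then show "compose (topspace M) f g \<in> homeos M" by (simp add: homeos_def)
qed

lemma inv_homeos:
  assumes "f \<in> homeos M" shows "m_inv (BijGroup (topspace M)) f \<in> homeos M"
proof -
  have f: "f \<in> Bij (topspace M)" using assms homeos_Bij by blast
  obtain g where g: "homeomorphic_maps M M f g"
    using assms homeomorphic_map_maps unfolding homeos_def by blast
  have "inv_into (topspace M) f x = g x" if "x \<in> topspace M" for x
    using that g f by (intro inv_into_f_eq)
      (auto simp: homeomorphic_maps_def Bij_def bij_betw_def continuous_map_def)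
  then have "homeomorphic_map M M (\<lambda>x\<in>topspace M. inv_into (topspace M) f x)"
    using homeomorphic_map_eq[of M M g "\<lambda>x\<in>topspace M. inv_into (topspace M) f x"] g
      homeomorphic_maps_map[of M M f g] by auto
  then show ?thesis unfolding inv_BijGroup[OF f] by (simp add: homeos_def)
qed

lemma topspace_homeo_topology: "topspace (homeo_topology M) = homeos M"
proof -
  have "homeos M = {f \<in> homeos M. f ` {} \<subseteq> {}}" by simp
  then have "homeos M \<in> {{f \<in> homeos M. f ` K \<subseteq> U} | K U. compactin M K \<and> openin M U}"
    using compactin_empty openin_empty by blast
  then show ?thesis unfolding homeo_topology_def by auto
qed

lemma continuous_map_homeo_topology:
  assumes into: "\<And>x. x \<in> topspace Y \<Longrightarrow> \<theta> x \<in> homeos M"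
    and "\<And>K U. compactin M K \<Longrightarrow> openin M U \<Longrightarrow> openin Y {x \<in> topspace Y. \<theta> x ` K \<subseteq> U}"
  shows "continuous_map Y (homeo_topology M) \<theta>"
  unfolding homeo_topology_def
proof (rule continuous_on_generated_topo)
  fix V assume "V \<in> {{f \<in> homeos M. f ` K \<subseteq> U} | K U. compactin M K \<and> openin M U}"
  then obtain K U where "V = {f \<in> homeos M. f ` K \<subseteq> U}" "compactin M K" "openin M U" by blast
  moreover from this have "\<theta> -` V \<inter> topspace Y = {x \<in> topspace Y. \<theta> x ` K \<subseteq> U}" using into by auto
  ultimately show "openin Y (\<theta> -` V \<inter> topspace Y)" using assms(2) by simp
next
  show "\<theta> ` topspace Y \<subseteq> \<Union> {{f \<in> homeos M. f ` K \<subseteq> U} | K U. compactin M K \<and> openin M U}"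
    using into topspace_homeo_topology[of M] unfolding homeo_topology_def topology_generated_by_topspace by blast
qed

text \<open>Pulling back the subbasic set given by \<open>K\<close> and \<open>U\<close> replaces
  \<open>U\<close> by its preimage under \<open>g\<close>.\<close>

lemma continuous_left_translation:
  assumes g: "g \<in> homeos M"
  shows "continuous_map (homeo_topology M) (homeo_topology M) (\<lambda>f. compose (topspace M) g f)"
proof (rule continuous_map_homeo_topology)
  fix K U assume K: "compactin M K" and U: "openin M U"
  have KS: "K \<subseteq> topspace M" using K by (rule compactin_subset_topspace)
  have "continuous_map M M g" using g by (auto simp: homeos_def homeomorphic_eq_everything_map)
  then have o: "openin M {x \<in> topspace M. g x \<in> U}" using U by (rule openin_continuous_map_preimage)
  have "compose (topspace M) g f ` K \<subseteq> U \<longleftrightarrow> f ` K \<subseteq> {x \<in> topspace M. g x \<in> U}" if f: "f \<in> homeos M" for f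
  proof -
    have "compose (topspace M) g f x = g (f x)" "f x \<in> topspace M" if "x \<in> K" for x
      using that KS homeos_into[OF f, of x] by (auto simp: compose_def)
    then show ?thesis by (auto simp: image_subset_iff)
  qed
  then have "{f \<in> topspace (homeo_topology M). compose (topspace M) g f ` K \<subseteq> U}
      = {f \<in> homeos M. f ` K \<subseteq> {x \<in> topspace M. g x \<in> U}}"
    unfolding topspace_homeo_topology by (intro Collect_cong conj_cong refl)
  moreover have "openin (homeo_topology M) {f \<in> homeos M. f ` K \<subseteq> {x \<in> topspace M. g x \<in> U}}"
    unfolding homeo_topology_def by (rule topology_generated_by_Basis) (use K o in blast)
  ultimately show "openin (homeo_topology M) {f \<in> topspace (homeo_topology M). compose (topspace M) g f ` K \<subseteq> U}"
    by simp
qed (use g mult_homeos in \<open>auto simp: topspace_homeo_topology\<close>)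

abbreviation in_id_component :: "'a topology \<Rightarrow> ('a \<Rightarrow> 'a) \<Rightarrow> bool" where
  "in_id_component M f \<equiv> connected_component_of (homeo_topology M) \<one>\<^bsub>BijGroup (topspace M)\<^esub> f"

lemma in_id_component_homeos: "in_id_component M f \<Longrightarrow> f \<in> homeos M"
  using connectedin_subset_topspace topspace_homeo_topology unfolding connected_component_of_def by blast

lemma connected_component_translate:
  assumes "g \<in> homeos M" "connected_component_of (homeo_topology M) f f'"
  shows "connected_component_of (homeo_topology M) (compose (topspace M) g f) (compose (topspace M) g f')"
proof -
  obtain T where "connectedin (homeo_topology M) T" "f \<in> T" "f' \<in> T"
    using assms(2) unfolding connected_component_of_def by blast
  then show ?thesis
    using connectedin_continuous_map_image[OF continuous_left_translation[OF assms(1)]]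
    unfolding connected_component_of_def by blast
qed

text \<open>A connected set joining the identity to \<open>g\<close>, translated by
  \<open>f\<close>, joins \<open>f\<close> to the product of \<open>f\<close> and \<open>g\<close>;
  one joining the identity to \<open>f\<close>, translated by the inverse of \<open>f\<close>, joins
  that inverse to the identity.\<close>

lemma subgroup_id_component: "subgroup {f. in_id_component M f} (BijGroup (topspace M))"
proof -
  interpret G: group "BijGroup (topspace M)" by (rule group_BijGroup)
  have car: "f \<in> carrier (BijGroup (topspace M))" if "in_id_component M f" for f
    using that in_id_component_homeos homeos_Bij by (fastforce simp: BijGroup_def)
  show ?thesis
  proof (rule subgroup.intro)
    show "{f. in_id_component M f} \<subseteq> carrier (BijGroup (topspace M))" using car by blast
    show "\<one>\<^bsub>BijGroup (topspace M)\<^esub> \<in> {f. in_id_component M f}"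
      using one_homeos connected_component_of_refl topspace_homeo_topology by fastforce
  next
    fix f g assume "f \<in> {f. in_id_component M f}" "g \<in> {f. in_id_component M f}"
    then have fg: "in_id_component M f" "in_id_component M g" by auto
    note h = fg[THEN in_id_component_homeos]
    have "connected_component_of (homeo_topology M)
      (compose (topspace M) f \<one>\<^bsub>BijGroup (topspace M)\<^esub>) (compose (topspace M) f g)"
      by (rule connected_component_translate[OF h(1) fg(2)])
    moreover have "compose (topspace M) f \<one>\<^bsub>BijGroup (topspace M)\<^esub> = f"
      using mult_homeos(1)[OF h(1) one_homeos] G.r_one[OF car[OF fg(1)]] by simp
    ultimately show "f \<otimes>\<^bsub>BijGroup (topspace M)\<^esub> g \<in> {f. in_id_component M f}"
      using fg(1) mult_homeos(1)[OF h] connected_component_of_trans by fastforce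
  next
    fix f assume "f \<in> {f. in_id_component M f}"
    then have f: "in_id_component M f" by auto
    note h = in_id_component_homeos[OF f]
    let ?i = "m_inv (BijGroup (topspace M)) f"
    have "connected_component_of (homeo_topology M)
      (compose (topspace M) ?i \<one>\<^bsub>BijGroup (topspace M)\<^esub>) (compose (topspace M) ?i f)"
      by (rule connected_component_translate[OF inv_homeos[OF h] f])
    moreover have "compose (topspace M) ?i \<one>\<^bsub>BijGroup (topspace M)\<^esub> = ?i"
      using mult_homeos(1)[OF inv_homeos[OF h] one_homeos] G.r_one G.inv_closed[OF car[OF f]] by simp
    moreover have "compose (topspace M) ?i f = \<one>\<^bsub>BijGroup (topspace M)\<^esub>"
      using mult_homeos(1)[OF inv_homeos[OF h] h] G.l_inv[OF car[OF f]] by simp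
    ultimately show "?i \<in> {f. in_id_component M f}"
      using connected_component_of_sym by fastforce
  qed
qed

lemma carrier_Homeo0: "carrier (Homeo0 M) = {f. in_id_component M f}"
  by (simp add: Homeo0_def)

lemma group_Homeo0: "group (Homeo0 M)"
  unfolding Homeo0_def by (rule group.subgroup_imp_group[OF group_BijGroup subgroup_id_component])

lemma mult_Homeo0:
  assumes "f \<in> carrier (Homeo0 M)" "g \<in> carrier (Homeo0 M)"
  shows "f \<otimes>\<^bsub>Homeo0 M\<^esub> g = compose (topspace M) f g"
  using assms in_id_component_homeos mult_homeos(1)[of f M g] unfolding carrier_Homeo0 by (auto simp: Homeo0_def)

lemma one_Homeo0: "\<one>\<^bsub>Homeo0 M\<^esub> = (\<lambda>x\<in>topspace M. x)"
  by (simp add: Homeo0_def BijGroup_def)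

lemma Homeo0_homeos: "f \<in> carrier (Homeo0 M) \<Longrightarrow> f \<in> homeos M"
  using in_id_component_homeos unfolding carrier_Homeo0 by blast

text \<open>By the tube lemma, an isotopy that is jointly continuous is a continuous path in the
  compact-open topology, and a path from the identity stays in its component.\<close>

lemma isotopy_Homeo0:
  assumes cont: "continuous_map (prod_topology (top_of_set {0..1::real}) M) M (\<lambda>(t, x). \<theta> t x)"
    and homeo: "\<And>t. t \<in> {0..1} \<Longrightarrow> restrict (\<theta> t) (topspace M) \<in> homeos M"
    and start: "\<And>x. x \<in> topspace M \<Longrightarrow> \<theta> 0 x = x"
  shows "restrict (\<theta> 1) (topspace M) \<in> carrier (Homeo0 M)"
proof -
  let ?I = "{0..1::real}"
  have "continuous_map (top_of_set ?I) (homeo_topology M) (\<lambda>t. restrict (\<theta> t) (topspace M))"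
  proof (rule continuous_map_homeo_topology)
    fix K U assume K: "compactin M K" and U: "openin M U"
    have KS: "K \<subseteq> topspace M" using K by (rule compactin_subset_topspace)
    define W where "W = {z \<in> topspace (prod_topology (top_of_set ?I) M). (\<lambda>(t, x). \<theta> t x) z \<in> U}"
    have W: "openin (prod_topology (top_of_set ?I) M) W"
      unfolding W_def by (rule openin_continuous_map_preimage[OF cont U])
    show "openin (top_of_set ?I) {t \<in> topspace (top_of_set ?I). restrict (\<theta> t) (topspace M) ` K \<subseteq> U}"
    proof (subst openin_subopen, intro ballI)
      fix t assume "t \<in> {t \<in> topspace (top_of_set ?I). restrict (\<theta> t) (topspace M) ` K \<subseteq> U}"
      then have t: "t \<in> ?I" "restrict (\<theta> t) (topspace M) ` K \<subseteq> U" by auto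
      have "{t} \<times> K \<subseteq> W" using t KS by (fastforce simp: W_def)
      then obtain A V where A: "openin (top_of_set ?I) A" "t \<in> A" "K \<subseteq> V" "A \<times> V \<subseteq> W"
        using tube_lemma_right[OF W K, of t] t(1) by auto
      have "A \<subseteq> {t \<in> topspace (top_of_set ?I). restrict (\<theta> t) (topspace M) ` K \<subseteq> U}"
      proof
        fix s assume s: "s \<in> A"
        have "s \<in> ?I" using openin_subset[OF A(1)] s by auto
        moreover have "\<theta> s x \<in> U" if "x \<in> K" for x
        proof -
          have "(s, x) \<in> W" using A(3,4) s that by blast
          then show ?thesis by (simp add: W_def)
        qed
        ultimately show "s \<in> {t \<in> topspace (top_of_set ?I). restrict (\<theta> t) (topspace M) ` K \<subseteq> U}"
          using KS by auto
      qed
      then show "\<exists>A. openin (top_of_set ?I) A \<and> t \<in> A \<and>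
          A \<subseteq> {t \<in> topspace (top_of_set ?I). restrict (\<theta> t) (topspace M) ` K \<subseteq> U}"
        using A by blast
    qed
  qed (use homeo in auto)
  then have "connectedin (homeo_topology M) ((\<lambda>t. restrict (\<theta> t) (topspace M)) ` ?I)"
    by (rule connectedin_continuous_map_image)
      (simp add: connectedin_subtopology connectedin_iff_connected)
  moreover have "restrict (\<theta> 0) (topspace M) = \<one>\<^bsub>BijGroup (topspace M)\<^esub>"
    using start by (auto simp: BijGroup_def)
  ultimately show ?thesis
    unfolding carrier_Homeo0 connected_component_of_def
    by (auto intro!: exI[of _ "(\<lambda>t. restrict (\<theta> t) (topspace M)) ` ?I"])
      (metis atLeastAtMost_iff image_eqI order_refl zero_le_one)
qed

subsection \<open>Extension by the identity\<close>

text \<open>The Alexander isotopy: the conjugate of \<open>\<phi>\<close> by the homothety of ratio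
  \<open>t\<close>, completed by the identity at time 0.\<close>

definition alexander :: "((nat \<Rightarrow> real) \<Rightarrow> (nat \<Rightarrow> real)) \<Rightarrow> real \<Rightarrow> (nat \<Rightarrow> real) \<Rightarrow> (nat \<Rightarrow> real)" where
  "alexander \<phi> t x = (if t = 0 then x else (\<lambda>i. t * \<phi> (\<lambda>j. x j / t) i))"

lemma alexander_0: "alexander \<phi> 0 x = x" and alexander_1: "alexander \<phi> 1 x = \<phi> x"
  by (simp_all add: alexander_def)

lemma alexander_comp: "alexander \<phi> t (alexander \<psi> t x) = alexander (\<phi> \<circ> \<psi>) t x"
  by (simp add: alexander_def)

lemma alexander_id: "alexander id t x = x"
  by (simp add: alexander_def)

context cone
begin

lemma alexander_into:
  assumes "\<phi> \<in> carrier (homeo_group d T)" "0 \<le> t" "x \<in> T" shows "alexander \<phi> t x \<in> T"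
proof (cases "t = 0")
  case False
  have "(\<lambda>j. (1 / t) * x j) \<in> T" using assms by (intro scale_T) auto
  then have "\<phi> (\<lambda>j. x j / t) \<in> T" using homeo_group_into[OF assms(1)] by simp
  then show ?thesis using scale_T[of _ t] assms False by (simp add: alexander_def)
qed (use assms in \<open>simp add: alexander_def\<close>)

lemma alexander_outside:
  assumes "\<And>x. R < nrm d x \<Longrightarrow> \<phi> x = x" "0 \<le> t" "t \<le> 1" "R < nrm d x"
  shows "alexander \<phi> t x = x"
proof (cases "t = 0")
  case False
  have "nrm d x * 1 \<le> nrm d x * (1 / t)" using assms False by (intro mult_left_mono) auto
  then have "R < nrm d (\<lambda>j. x j / t)" using nrm_scale[of d "1 / t" x] assms False by simp
  then have "\<phi> (\<lambda>j. x j / t) = (\<lambda>j. x j / t)" by (rule assms(1))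
  then show ?thesis using False by (simp add: alexander_def)
qed (simp add: alexander_def)

text \<open>The map preserves the ball of radius \<open>R\<close> that contains its support, so it
  moves points by at most \<open>2 * R\<close>; conjugation by scaling multiplies this by
  \<open>t\<close>. The estimate yields continuity at time 0.\<close>

lemma alexander_close:
  assumes \<phi>: "\<phi> \<in> carrier (homeo_group d T)" and R: "\<And>x. R < nrm d x \<Longrightarrow> \<phi> x = x" "0 \<le> R"
    and "0 \<le> t" "x \<in> T"
  shows "\<bar>alexander \<phi> t x i - x i\<bar> \<le> 2 * R * t"
proof (cases "t = 0")
  case False
  then have t: "0 < t" using assms by simp
  define y where "y = (\<lambda>j. x j / t)"
  have xy: "x = (\<lambda>j. t * y j)" using t by (simp add: y_def)
  have "(\<lambda>j. (1 / t) * x j) \<in> T" using assms by (intro scale_T) auto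
  then have y: "y \<in> T" "\<phi> y \<in> T" using homeo_group_into[OF \<phi>] by (simp_all add: y_def)
  have al: "alexander \<phi> t x i = t * \<phi> y i" using t by (simp add: alexander_def y_def)
  have "\<bar>\<phi> y i - y i\<bar> \<le> 2 * R"
  proof (cases "R < nrm d y")
    case True
    then show ?thesis using R by simp
  next
    case F: False
    have "\<not> R < nrm d (\<phi> y)"
    proof
      assume a: "R < nrm d (\<phi> y)"
      then have "\<phi> (\<phi> y) = \<phi> y" by (rule R)
      then have "\<phi> y = y" using bij_is_inj[OF homeo_groupD(1)[OF \<phi>]] by (metis injD)
      then show False using a F by simp
    qed
    then have "dst d (\<phi> y) y \<le> 2 * R" using F dst_le_nrm[of d "\<phi> y" y] by simp
    show ?thesis
    proof (cases "i < d")
      case True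
      then show ?thesis
        using abs_le_nrm[OF True, of "\<lambda>i. \<phi> y i - y i"] \<open>dst d (\<phi> y) y \<le> 2 * R\<close> by (simp add: dst_def)
    next
      case False
      then show ?thesis using coord_T[OF y(1), of i] coord_T[OF y(2), of i] R by simp
    qed
  qed
  then have "t * \<bar>\<phi> y i - y i\<bar> \<le> t * (2 * R)" using t by (intro mult_left_mono) auto
  moreover have "alexander \<phi> t x i - x i = t * (\<phi> y i - y i)"
    unfolding al by (subst xy) (simp add: algebra_simps)
  ultimately show ?thesis using t by (simp add: abs_mult mult_ac)
qed (simp add: alexander_def)

lemma continuous_alexander:
  assumes \<phi>: "\<phi> \<in> carrier (homeo_group d T)"
  shows "continuous_on ({0..1} \<times> T) (\<lambda>z. alexander \<phi> (fst z) (snd z))"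
proof (rule continuous_on_coordinatewise_then_product)
  fix i
  obtain R' where R': "\<And>x. R' < nrm d x \<Longrightarrow> \<phi> x = x" using homeo_groupD(4)[OF \<phi>] by blast
  define R where "R = max 0 R'"
  have R: "\<And>x. R < nrm d x \<Longrightarrow> \<phi> x = x" "0 \<le> R" using R' by (auto simp: R_def)
  have coord: "continuous_on S (\<lambda>z::real \<times> (nat \<Rightarrow> real). snd z j)" for S j
    using continuous_on_product_then_coordinatewise[OF continuous_on_snd[OF continuous_on_id]] .
  show "continuous_on ({0..1} \<times> T) (\<lambda>z. alexander \<phi> (fst z) (snd z) i)"
    unfolding continuous_on_eq_continuous_within
  proof
    fix z assume z: "z \<in> {0..1::real} \<times> T"
    show "continuous (at z within {0..1} \<times> T) (\<lambda>z. alexander \<phi> (fst z) (snd z) i)"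
    proof (cases "fst z = 0")
      case True
      have "((\<lambda>w. alexander \<phi> (fst w) (snd w) i - snd w i) \<longlongrightarrow> 0) (at z within {0..1} \<times> T)"
      proof (rule Lim_null_comparison)
        show "\<forall>\<^sub>F w in at z within {0..1} \<times> T. norm (alexander \<phi> (fst w) (snd w) i - snd w i) \<le> 2 * R * fst w"
          unfolding eventually_at_filter
          using alexander_close[OF \<phi> R] by (intro always_eventually allI impI) auto
        have "((\<lambda>w. 2 * R * fst w) \<longlongrightarrow> 2 * R * fst z) (at z within {0..1} \<times> T)"
          by (intro tendsto_intros)
        then show "((\<lambda>w. 2 * R * fst w) \<longlongrightarrow> 0) (at z within {0..1} \<times> T)" using True by simp
      qed
      moreover have "((\<lambda>w. snd w i) \<longlongrightarrow> snd z i) (at z within {0..1} \<times> T)"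
        using coord[of "{0..1} \<times> T" i] z unfolding continuous_on_def by blast
      ultimately have "((\<lambda>w. (alexander \<phi> (fst w) (snd w) i - snd w i) + snd w i) \<longlongrightarrow> 0 + snd z i)
          (at z within {0..1} \<times> T)"
        by (rule tendsto_add)
      then show ?thesis using True by (simp add: continuous_within alexander_0)
    next
      case False
      have "continuous_on ({0<..1} \<times> T) (\<lambda>z. fst z * \<phi> (\<lambda>j. snd z j / fst z) i)"
      proof (intro continuous_on_mult continuous_on_fst continuous_on_id)
        have "continuous_on ({0<..1} \<times> T) (\<lambda>z. \<phi> (\<lambda>j. snd z j / fst z))"
        proof (rule continuous_on_compose2[OF homeo_groupD(3)[OF \<phi>]])
          show "continuous_on ({0<..1} \<times> T) (\<lambda>z j. snd z j / fst z)"
            by (intro continuous_on_coordinatewise_then_product continuous_on_divide coord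
                continuous_on_fst continuous_on_id) auto
          show "(\<lambda>z j. snd z j / fst z) ` ({0<..1} \<times> T) \<subseteq> T"
          proof clarsimp
            fix t :: real and x assume "0 < t" "x \<in> T"
            then show "(\<lambda>j. x j / t) \<in> T" using scale_T[of x "1 / t"] by simp
          qed
        qed
        then show "continuous_on ({0<..1} \<times> T) (\<lambda>z. \<phi> (\<lambda>j. snd z j / fst z) i)"
          by (rule continuous_on_product_then_coordinatewise)
      qed
      then have "continuous_on ({0<..1} \<times> T) (\<lambda>z. alexander \<phi> (fst z) (snd z) i)"
        by (rule continuous_on_eq) (auto simp: alexander_def)
      then have "continuous (at z within {0<..1} \<times> T) (\<lambda>z. alexander \<phi> (fst z) (snd z) i)"
        using z False unfolding continuous_on_eq_continuous_within by force
      \<comment> \<open>At a positive time the restriction to positive times does not change the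
        neighbourhoods, so the explicit formula may be used.\<close>
      moreover have "at z within {0..1} \<times> T = at z within {0<..1} \<times> T"
      proof (rule at_within_nhd[where S = "{w. 0 < fst w}"])
        show "open {w::real \<times> (nat \<Rightarrow> real). 0 < fst w}"
          by (intro open_Collect_less continuous_intros)
      qed (use z False in auto)
      ultimately show ?thesis by simp
    qed
  qed
qed

end

section \<open>Charts with open image\<close>

locale chart = cone +
  fixes M :: "'a topology" and p :: "(nat \<Rightarrow> real) \<Rightarrow> 'a"
  assumes Hausdorff: "Hausdorff_space M" and emb: "embedding_map (top_of_set T) M p"
    and open_image: "openin M (p ` T)"
begin

definition q :: "'a \<Rightarrow> (nat \<Rightarrow> real)" where "q = inv_into T p"

lemma p_into: "x \<in> T \<Longrightarrow> p x \<in> topspace M"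
  using openin_subset[OF open_image] by blast

lemma inj_p: "inj_on p T"
  using emb by (simp add: embedding_map_def homeomorphic_eq_everything_map)

lemma qp [simp]: "x \<in> T \<Longrightarrow> q (p x) = x"
  using inj_p by (simp add: q_def)

lemma continuous_p: "continuous_map (top_of_set T) M p"
  using emb by (simp add: embedding_map_def homeomorphic_eq_everything_map continuous_map_in_subtopology)

lemma continuous_q: "continuous_map (subtopology M (p ` T)) (top_of_set T) q"
proof -
  obtain g where g: "homeomorphic_maps (top_of_set T) (subtopology M (p ` T)) p g"
    using emb unfolding embedding_map_def homeomorphic_map_maps by auto
  then have "continuous_map (subtopology M (p ` T)) (top_of_set T) g" by (simp add: homeomorphic_maps_def)
  then show ?thesis
  proof (rule continuous_map_eq)
    fix y assume "y \<in> topspace (subtopology M (p ` T))"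
    then obtain x where "x \<in> T" "y = p x" by auto
    then show "g y = q y" using g by (simp add: homeomorphic_maps_def)
  qed
qed

definition ext :: "((nat \<Rightarrow> real) \<Rightarrow> (nat \<Rightarrow> real)) \<Rightarrow> 'a \<Rightarrow> 'a" where
  "ext \<phi> y = (if y \<in> p ` T then p (\<phi> (q y)) else y)"

lemma ext_p: "x \<in> T \<Longrightarrow> ext \<phi> (p x) = p (\<phi> x)"
  by (simp add: ext_def)

lemma ext_comp: "(\<And>x. x \<in> T \<Longrightarrow> \<psi> x \<in> T) \<Longrightarrow> ext \<phi> (ext \<psi> y) = ext (\<lambda>x. \<phi> (\<psi> x)) y"
  by (cases "y \<in> p ` T") (auto simp: ext_p, simp add: ext_def)

lemma ext_id: "(\<And>x. x \<in> T \<Longrightarrow> \<phi> x = x) \<Longrightarrow> ext \<phi> y = y"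
  by (auto simp: ext_def)

text \<open>Two open sets are pasted: the image of the chart, and the complement of the image of the
  ball of radius \<open>R\<close>, which is compact and therefore closed in the Hausdorff space
  \<open>M\<close>. The radius has to serve all times.\<close>

lemma continuous_ext:
  assumes cont: "continuous_on ({0..1::real} \<times> T) (\<lambda>z. F (fst z) (snd z))"
    and into: "\<And>t x. t \<in> {0..1} \<Longrightarrow> x \<in> T \<Longrightarrow> F t x \<in> T"
    and out: "\<And>t x. t \<in> {0..1} \<Longrightarrow> R < nrm d x \<Longrightarrow> F t x = x"
  shows "continuous_map (prod_topology (top_of_set {0..1}) M) M (\<lambda>z. ext (F (fst z)) (snd z))"
proof (rule pasting_lemma[where I = "UNIV :: bool set"])
  let ?I = "{0..1::real}"
  define K where "K = T \<inter> {x. nrm d x \<le> R}"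
  have "compactin (top_of_set T) K"
    using compact_cball[of R] by (auto simp: K_def compactin_subtopology)
  then have "compactin M (p ` K)" by (rule image_compactin[OF _ continuous_p])
  then have "closedin M (p ` K)" by (rule compactin_imp_closedin[OF Hausdorff])
  then have oK: "openin M (topspace M - p ` K)" by blast
  define A where "A = (\<lambda>b. if b then ?I \<times> p ` T else ?I \<times> (topspace M - p ` K))"
  define f where "f = (\<lambda>b z. if b then p (F (fst z) (q (snd z))) else (snd z :: 'a))"
  show "openin (prod_topology (top_of_set ?I) M) (A b)" for b
    using oK open_image by (auto simp: A_def openin_prod_Times_iff)
  show "continuous_map (subtopology (prod_topology (top_of_set ?I) M) (A b)) M (f b)" for b
  proof (cases b)
    case True
    have sub: "subtopology (prod_topology (top_of_set ?I) M) (?I \<times> p ` T)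
        = prod_topology (top_of_set ?I) (subtopology M (p ` T))"
      by (simp add: subtopology_Times subtopology_subtopology)
    have "continuous_map (prod_topology (top_of_set ?I) (subtopology M (p ` T))) (top_of_set T) (\<lambda>z. q (snd z))"
      using continuous_map_compose[OF continuous_map_snd continuous_q] by (simp add: o_def)
    then have "continuous_map (prod_topology (top_of_set ?I) (subtopology M (p ` T)))
        (prod_topology (top_of_set ?I) (top_of_set T)) (\<lambda>z. (fst z, q (snd z)))"
      by (intro continuous_map_pairedI continuous_map_fst)
    moreover have "continuous_map (prod_topology (top_of_set ?I) (top_of_set T)) (top_of_set T) (\<lambda>z. F (fst z) (snd z))"
      using cont into by auto
    ultimately have "continuous_map (prod_topology (top_of_set ?I) (subtopology M (p ` T))) (top_of_set T)
        ((\<lambda>z. F (fst z) (snd z)) \<circ> (\<lambda>z. (fst z, q (snd z))))"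
      by (rule continuous_map_compose)
    from continuous_map_compose[OF this continuous_p] show ?thesis
      using True sub by (simp add: A_def f_def o_def)
  next
    case False
    then show ?thesis
      unfolding f_def by (simp add: continuous_map_from_subtopology continuous_map_snd)
  qed
  show "f b z = f c z" if "z \<in> topspace (prod_topology (top_of_set ?I) M) \<inter> A b \<inter> A c" for b c z
  proof -
    have *: "p (F (fst z) (q (snd z))) = snd z" if z: "z \<in> ?I \<times> p ` T" "snd z \<notin> p ` K" for z
    proof -
      obtain t x where tx: "z = (t, p x)" "t \<in> ?I" "x \<in> T" using z by auto
      then have "R < nrm d x" using z by (auto simp: K_def not_le[symmetric])
      then show ?thesis using tx out by simp
    qed
    show ?thesis using that *[of z] by (cases b; cases c) (auto simp: f_def A_def)
  qed
  show "\<exists>b. b \<in> UNIV \<and> z \<in> A b \<and> ext (F (fst z)) (snd z) = f b z"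
    if "z \<in> topspace (prod_topology (top_of_set ?I) M)" for z
  proof (cases "snd z \<in> p ` T")
    case True
    then show ?thesis using that by (intro exI[of _ True]) (auto simp: A_def f_def ext_def)
  next
    case False
    then have "snd z \<notin> p ` K" by (auto simp: K_def)
    then show ?thesis using that False by (intro exI[of _ False]) (auto simp: A_def f_def ext_def)
  qed
qed

definition extend :: "((nat \<Rightarrow> real) \<Rightarrow> (nat \<Rightarrow> real)) \<Rightarrow> 'a \<Rightarrow> 'a" where
  "extend \<phi> = restrict (ext \<phi>) (topspace M)"

text \<open>At every time the Alexander isotopy of the inverse inverts that of
  \<open>\<phi>\<close>, so each stage of the extended isotopy is a homeomorphism.\<close>

lemma extend_Homeo0:
  assumes \<phi>: "\<phi> \<in> carrier (homeo_group d T)"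
  shows "extend \<phi> \<in> carrier (Homeo0 M)"
proof -
  let ?I = "{0..1::real}"
  have cont: "continuous_map (prod_topology (top_of_set ?I) M) M (\<lambda>z. ext (alexander \<psi> (fst z)) (snd z))"
    if \<psi>: "\<psi> \<in> carrier (homeo_group d T)" for \<psi>
  proof -
    obtain R where R: "\<And>x. R < nrm d x \<Longrightarrow> \<psi> x = x" using homeo_groupD(4)[OF \<psi>] by blast
    show ?thesis
      by (rule continuous_ext[OF continuous_alexander[OF \<psi>]])
        (use alexander_into[OF \<psi>] alexander_outside[OF R] in auto)
  qed
  have cont_t: "continuous_map M M (ext (alexander \<psi> t))"
    if \<psi>: "\<psi> \<in> carrier (homeo_group d T)" and t: "t \<in> ?I" for \<psi> t
  proof -
    have "continuous_map M (prod_topology (top_of_set ?I) M) (\<lambda>y. (t, y))"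
      using t by (intro continuous_map_pairedI) auto
    from continuous_map_compose[OF this cont[OF \<psi>]] show ?thesis by (simp add: o_def)
  qed
  define \<psi> where "\<psi> = inv_into UNIV \<phi>"
  have \<psi>: "\<psi> \<in> carrier (homeo_group d T)" unfolding \<psi>_def by (rule inv_homeo_group[OF \<phi>])
  have inv: "\<psi> \<circ> \<phi> = id" "\<phi> \<circ> \<psi> = id"
    using bij_inv_into_cancel[OF homeo_groupD(1)[OF \<phi>]] by (auto simp: \<psi>_def)
  have "restrict (ext (alexander \<phi> 1)) (topspace M) \<in> carrier (Homeo0 M)"
  proof (rule isotopy_Homeo0)
    show "continuous_map (prod_topology (top_of_set ?I) M) M (\<lambda>(t, y). ext (alexander \<phi> t) y)"
      using cont[OF \<phi>] by (simp add: case_prod_unfold)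
    show "ext (alexander \<phi> 0) y = y" for y by (rule ext_id) (simp add: alexander_0)
    fix t assume t: "t \<in> ?I"
    have *: "ext (alexander \<alpha> t) (ext (alexander \<beta> t) y) = y"
      if "\<alpha> \<circ> \<beta> = id" "\<beta> \<in> carrier (homeo_group d T)" for \<alpha> \<beta> y
    proof -
      have "ext (alexander \<alpha> t) (ext (alexander \<beta> t) y) = ext (\<lambda>x. alexander \<alpha> t (alexander \<beta> t x)) y"
        using alexander_into[OF that(2)] t by (intro ext_comp) auto
      also have "\<dots> = y" by (rule ext_id) (simp add: alexander_comp that(1) alexander_id)
      finally show ?thesis .
    qed
    have into: "ext (alexander \<alpha> t) y \<in> topspace M"
      if "\<alpha> \<in> carrier (homeo_group d T)" "y \<in> topspace M" for \<alpha> y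
      using continuous_map_image_subset_topspace[OF cont_t[OF that(1) t]] that(2) by blast
    have "homeomorphic_maps M M (ext (alexander \<phi> t)) (ext (alexander \<psi> t))"
      unfolding homeomorphic_maps_def using cont_t[OF _ t] \<phi> \<psi> *[OF inv(1) \<phi>] *[OF inv(2) \<psi>] by auto
    then have "homeomorphic_maps M M (restrict (ext (alexander \<phi> t)) (topspace M)) (ext (alexander \<psi> t))"
      by (rule homeomorphic_maps_eq) auto
    then show "restrict (ext (alexander \<phi> t)) (topspace M) \<in> homeos M"
      by (intro homeosI) auto
  qed
  moreover have "ext (alexander \<phi> 1) = ext \<phi>" by (auto simp: ext_def alexander_1)
  ultimately show ?thesis by (simp add: extend_def)
qed

lemma group_hom_extend: "group_hom (homeo_group d T) (Homeo0 M) extend"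
proof (intro group_hom.intro group_hom_axioms.intro group_homeo_group group_Homeo0 homI extend_Homeo0)
  fix \<phi> \<psi> assume p: "\<phi> \<in> carrier (homeo_group d T)" "\<psi> \<in> carrier (homeo_group d T)"
  have into: "ext \<psi> y \<in> topspace M" if "y \<in> topspace M" for y
    using homeos_into[OF Homeo0_homeos[OF extend_Homeo0[OF p(2)]] that] that by (simp add: extend_def)
  have "extend (\<phi> \<circ> \<psi>) = compose (topspace M) (extend \<phi>) (extend \<psi>)"
    using ext_comp[of \<psi> \<phi>] homeo_group_into[OF p(2)] into
    by (auto simp: extend_def compose_def o_def)
  then show "extend (\<phi> \<otimes>\<^bsub>homeo_group d T\<^esub> \<psi>) = extend \<phi> \<otimes>\<^bsub>Homeo0 M\<^esub> extend \<psi>"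
    by (simp only: homeo_group_simps mult_Homeo0[OF extend_Homeo0[OF p(1)] extend_Homeo0[OF p(2)]])
qed

text \<open>Off the ball \<open>h\<close> is the identity, so by injectivity no point of the chart
  is carried out of it, and likewise for the inverse. Both can be read in coordinates and continued
  by the identity off \<open>T\<close>.\<close>

lemma supported_in_chart:
  assumes h: "h \<in> carrier (Homeo0 M)" and supp: "homeo_support M h \<subseteq> p ` {x \<in> T. nrm d x \<le> 1}"
  shows "h \<in> extend ` (ball_homeos d T)"
proof -
  let ?K = "{x \<in> T. nrm d x \<le> 1}"
  obtain g where g: "homeomorphic_maps M M h g"
    using Homeo0_homeos[OF h] unfolding homeos_def homeomorphic_map_maps by blast
  have hext: "h \<in> extensional (topspace M)" using Homeo0_homeos[OF h] by (simp add: homeos_def)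
  have hg: "continuous_map M M h" "continuous_map M M g"
    "\<And>y. y \<in> topspace M \<Longrightarrow> g (h y) = y" "\<And>y. y \<in> topspace M \<Longrightarrow> h (g y) = y"
    using g by (auto simp: homeomorphic_maps_def)
  have into: "h y \<in> topspace M" "g y \<in> topspace M" if "y \<in> topspace M" for y
    using hg(1,2) that by (auto simp: continuous_map_def Pi_iff)
  have hfix: "h y = y" if "y \<in> topspace M" "y \<notin> p ` ?K" for y
  proof (rule ccontr)
    assume "h y \<noteq> y"
    then have "y \<in> {y \<in> topspace M. h y \<noteq> y}" using that by simp
    then have "y \<in> homeo_support M h"
      unfolding homeo_support_def using closure_of_subset[of "{y \<in> topspace M. h y \<noteq> y}" M] by blast
    then show False using supp that by blast
  qed
  have gfix: "g y = y" if "y \<in> topspace M" "y \<notin> p ` ?K" for y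
    using hfix[OF that] hg(3)[OF that(1)] by simp
  have *: "k y \<in> p ` T"
    if y: "y \<in> p ` T" and k: "\<And>y. y \<in> topspace M \<Longrightarrow> k y \<in> topspace M" "\<And>y. y \<in> topspace M \<Longrightarrow> k' (k y) = y"
      "\<And>y. y \<in> topspace M \<Longrightarrow> y \<notin> p ` ?K \<Longrightarrow> k y = y" for k k' y
  proof (rule ccontr)
    have ys: "y \<in> topspace M" using y p_into by blast
    assume a: "k y \<notin> p ` T"
    then have "k (k y) = k y" using k(1)[OF ys] by (intro k(3)) auto
    then have "k y = y" using k(2)[OF k(1)[OF ys]] k(2)[OF ys] by simp
    then show False using a y by simp
  qed
  have hT: "h y \<in> p ` T" if "y \<in> p ` T" for y using *[OF that into(1) hg(3) hfix] .
  have gT: "g y \<in> p ` T" if "y \<in> p ` T" for y using *[OF that into(2) hg(4) gfix] .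
  define \<phi> where "\<phi> = (\<lambda>x. if x \<in> T then q (h (p x)) else x)"
  define \<psi> where "\<psi> = (\<lambda>x. if x \<in> T then q (g (p x)) else x)"
  have p\<phi>: "p (\<phi> x) = h (p x)" "\<phi> x \<in> T" if "x \<in> T" for x
    using hT[of "p x"] that by (auto simp: \<phi>_def)
  have p\<psi>: "p (\<psi> x) = g (p x)" "\<psi> x \<in> T" if "x \<in> T" for x
    using gT[of "p x"] that by (auto simp: \<psi>_def)
  have "\<psi> (\<phi> x) = x" "\<phi> (\<psi> x) = x" for x
  proof -
    have "\<psi> (\<phi> x) = x \<and> \<phi> (\<psi> x) = x"
    proof (cases "x \<in> T")
      case True
      have "\<psi> (\<phi> x) = q (g (h (p x)))" using p\<phi>[OF True] by (simp add: \<psi>_def)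
      moreover have "\<phi> (\<psi> x) = q (h (g (p x)))" using p\<psi>[OF True] by (simp add: \<phi>_def)
      ultimately show ?thesis using hg p_into[OF True] True by simp
    qed (simp add: \<phi>_def \<psi>_def)
    then show "\<psi> (\<phi> x) = x" "\<phi> (\<psi> x) = x" by auto
  qed
  then have bij: "bij \<phi>" by (metis bijI')
  have fix': "\<phi> x = x" if "x \<notin> ?K" for x
  proof (cases "x \<in> T")
    case True
    then have "p x \<notin> p ` ?K" using that inj_p by (auto dest: inj_onD)
    then show ?thesis using hfix p_into True by (simp add: \<phi>_def)
  qed (simp add: \<phi>_def)
  have "continuous_map (top_of_set T) M (h \<circ> p)" by (rule continuous_map_compose[OF continuous_p hg(1)])
  then have "continuous_map (top_of_set T) (subtopology M (p ` T)) (h \<circ> p)"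
    using hT by (auto simp: continuous_map_in_subtopology)
  from continuous_map_compose[OF this continuous_q]
  have "continuous_on T (q \<circ> (h \<circ> p))" by (simp add: continuous_map_in_subtopology)
  then have "continuous_on T \<phi>" by (rule continuous_on_eq) (simp add: \<phi>_def)
  then have "\<phi> \<in> carrier (homeo_group d T)"
    using bij fix' by (intro homeo_groupI[where R = 1]) auto
  moreover have "h = extend \<phi>"
  proof
    fix y show "h y = extend \<phi> y"
    proof (cases "y \<in> topspace M")
      case True
      show ?thesis
      proof (cases "y \<in> p ` T")
        case T: True
        then obtain x where "x \<in> T" "y = p x" by blast
        then show ?thesis using True p\<phi> by (simp add: extend_def ext_p)
      next
        case False
        then have "h y = y" using True by (intro hfix) auto
        then show ?thesis using True False by (simp add: extend_def ext_def)
      qed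
    next
      case False
      then show ?thesis using hext by (simp add: extend_def extensional_def)
    qed
  qed
  ultimately show ?thesis using fix' by blast
qed

lemma realizable_chart:
  assumes "log_realizable (homeo_group d T)
    (ball_homeos d T)"
  shows "log_realizable (Homeo0 M)
    {h \<in> carrier (Homeo0 M). homeo_support M h \<subseteq> p ` {x \<in> T. nrm d x \<le> 1}}"
  by (rule log_realizable_hom[OF group_hom_extend assms]) (use supported_in_chart in blast)

end

section \<open>Balls and half-balls have open neighbourhoods\<close>

definition Eucl :: "nat \<Rightarrow> (nat \<Rightarrow> real) set" where
  "Eucl d = {x. \<forall>i\<ge>d. x i = 0}"

definition Half :: "nat \<Rightarrow> (nat \<Rightarrow> real) set" where
  "Half d = {x \<in> Eucl d. 0 \<le> x 0}"

lemma Euclidean_space_eq: "Euclidean_space d = top_of_set (Eucl d)"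
  by (simp add: Euclidean_space_def euclidean_product_topology Eucl_def)

lemma half_space_eq: "half_space d = top_of_set (Half d)"
proof -
  have "Half d = Eucl d \<inter> {x. 0 \<le> x 0}" by (auto simp: Half_def)
  then show ?thesis by (simp only: half_space_def Euclidean_space_eq subtopology_subtopology)
qed

lemma unit_ball_eq: "unit_ball d = {x \<in> Eucl d. nrm d x \<le> 1}"
  by (simp add: unit_ball_def Euclidean_space_eq nrm_def L2_set_def)

lemma unit_half_ball_eq: "unit_ball d \<inter> topspace (half_space d) = {x \<in> Half d. nrm d x \<le> 1}"
  by (auto simp: unit_ball_eq half_space_eq Half_def)

lemma closed_Eucl: "closed (Eucl d)"
  unfolding Eucl_def by (intro closed_Collect_all closed_Collect_imp closed_Collect_eq continuous_intros) simp

lemma closed_Half: "closed (Half d)"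
proof -
  have "closed {x::nat \<Rightarrow> real. 0 \<le> x 0}" by (intro closed_Collect_le continuous_intros)
  moreover have "Half d = Eucl d \<inter> {x. 0 \<le> x 0}" by (auto simp: Half_def)
  ultimately show ?thesis using closed_Eucl by (simp add: closed_Int)
qed

lemma cone_Eucl: "cone d (Eucl d)"
  by (unfold_locales, rule closed_Eucl) (auto simp: Eucl_def)

lemma cone_Half: "cone d (Half d)"
  by (unfold_locales, rule closed_Half) (auto simp: Half_def Eucl_def)

section \<open>Invariance of domain for Euclidean spaces and half-spaces\<close>

lemma invariance_of_domain_Eucl:
  assumes "openin (top_of_set (Eucl d)) W" "continuous_on W f" "f ` W \<subseteq> Eucl d" "inj_on f W"
  shows "openin (top_of_set (Eucl d)) (f ` W)"
proof -
  have W: "W \<subseteq> Eucl d" using openin_subset[OF assms(1)] by simp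
  have "continuous_map (subtopology (Euclidean_space d) W) (Euclidean_space d) f"
    unfolding Euclidean_space_eq using assms(2,3) W
    by (auto simp: subtopology_subtopology continuous_map_in_subtopology Int_absorb1)
  then show ?thesis
    using invariance_of_domain_Euclidean_space[of d W f] assms(1,4) by (simp add: Euclidean_space_eq)
qed

text \<open>Around a point of the hyperplane, a set open in Euclidean space also contains points
  with negative first coordinate.\<close>

lemma openin_Eucl_in_Half:
  assumes "0 < d" "openin (top_of_set (Eucl d)) A" "A \<subseteq> Half d" "a \<in> A" shows "0 < a 0"
proof (rule ccontr)
  assume "\<not> 0 < a 0"
  then have a0: "a 0 = 0" using assms(3,4) by (force simp: Half_def)
  obtain U where U: "open U" "A = Eucl d \<inter> U" using assms(2) by (auto simp: openin_open)
  have "continuous_on UNIV (\<lambda>s. a(0 := s))"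
  proof (rule continuous_on_coordinatewise_then_product)
    show "continuous_on UNIV (\<lambda>s. (a(0 := s)) i)" for i by (cases "i = 0") auto
  qed
  then have o: "open ((\<lambda>s. a(0 := s)) -` U)" using U(1) by (simp add: open_vimage)
  have "a(0 := 0) = a" using a0 by auto
  then have "0 \<in> (\<lambda>s. a(0 := s)) -` U" using U assms(4) by auto
  then obtain e where e: "e > 0" "ball 0 e \<subseteq> (\<lambda>s. a(0 := s)) -` U"
    using o open_contains_ball by blast
  then have "- e / 2 \<in> (\<lambda>s. a(0 := s)) -` U" by (intro subsetD[OF e(2)]) (simp add: dist_real_def)
  moreover have "a(0 := - e / 2) \<in> Eucl d" using assms(1,4) U by (auto simp: Eucl_def)
  ultimately have "a(0 := - e / 2) \<in> Half d" using U assms(3) by auto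
  then show False using e(1) by (simp add: Half_def)
qed

text \<open>Invariance of domain for the half-space is obtained by doubling along the boundary.\<close>

lemma invariance_of_domain_Half:
  assumes d: "0 < d" and W: "openin (top_of_set (Half d)) W" and cont: "continuous_on W k"
    and into: "k ` W \<subseteq> Half d" and inj: "inj_on k W"
    and bdry: "\<And>x. x \<in> W \<Longrightarrow> x 0 = 0 \<Longrightarrow> k x 0 = 0"
  shows "openin (top_of_set (Half d)) (k ` W)"
proof -
  define \<rho> where "\<rho> = (\<lambda>(x::nat \<Rightarrow> real) i. if i = 0 then - x 0 else x i)"
  have \<rho>\<rho>: "\<rho> (\<rho> x) = x" and \<rho>0: "\<rho> x 0 = - x 0" for x by (auto simp: \<rho>_def)
  have \<rho>id: "\<rho> x = x" if "x 0 = 0" for x using that by (auto simp: \<rho>_def)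
  have \<rho>E: "\<rho> x \<in> Eucl d \<longleftrightarrow> x \<in> Eucl d" for x using d by (auto simp: \<rho>_def Eucl_def)
  have \<rho>c: "continuous_on S (\<lambda>x. \<rho> (g x))" if "continuous_on S g" for S and g :: "(nat \<Rightarrow> real) \<Rightarrow> (nat \<Rightarrow> real)"
  proof (rule continuous_on_coordinatewise_then_product)
    show "continuous_on S (\<lambda>x. \<rho> (g x) i)" for i
      using continuous_on_product_then_coordinatewise[OF that, of i]
      by (cases "i = 0") (auto simp: \<rho>_def intro: continuous_on_minus)
  qed
  obtain U where U: "open U" "W = Half d \<inter> U" using W by (auto simp: openin_open)
  \<comment> \<open>Interior points stay interior: the part of \<open>W\<close> off the hyperplane
    is open in Euclidean space, and so is its image, which then cannot touch the hyperplane.\<close>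
  have pos: "0 < k x 0" if x: "x \<in> W" "0 < x 0" for x
  proof -
    define W' where "W' = Eucl d \<inter> (U \<inter> {x. 0 < x 0})"
    have "open (U \<inter> {x::nat \<Rightarrow> real. 0 < x 0})"
      by (intro open_Int U open_Collect_less continuous_intros)
    then have W': "openin (top_of_set (Eucl d)) W'" unfolding W'_def by (auto simp: openin_open)
    have W'W: "W' \<subseteq> W" by (auto simp: W'_def U(2) Half_def)
    have "openin (top_of_set (Eucl d)) (k ` W')"
      using W' W'W into continuous_on_subset[OF cont] inj_on_subset[OF inj]
      by (intro invariance_of_domain_Eucl) (auto simp: Half_def)
    moreover have "k ` W' \<subseteq> Half d" using W'W into by blast
    moreover have "x \<in> W'" using x by (auto simp: W'_def U(2) Half_def)
    ultimately show ?thesis using openin_Eucl_in_Half[OF d] by blast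
  qed
  \<comment> \<open>\<open>D\<close> is \<open>W\<close> together with its mirror image, and
    \<open>K\<close> below extends \<open>k\<close> compatibly with the reflection
    \<open>\<rho>\<close>. The two halves of \<open>K\<close> agree on the hyperplane by
    \<open>bdry\<close>, and \<open>pos\<close> keeps their values apart elsewhere, so
    \<open>K\<close> is injective.\<close>
  define D where "D = {x \<in> Eucl d. (if x 0 \<le> 0 then \<rho> x else x) \<in> U}"
  have DW: "x \<in> D \<longleftrightarrow> x \<in> W" if "0 \<le> x 0" for x
    using that \<rho>id[of x] by (cases "x 0 = 0") (auto simp: D_def U(2) Half_def)
  have DW': "x \<in> D \<longleftrightarrow> \<rho> x \<in> W" if "x 0 \<le> 0" for x
    using that \<rho>E[of x] \<rho>0[of x] by (auto simp: D_def U(2) Half_def)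
  have "continuous_on UNIV (\<lambda>x. if x 0 \<le> 0 then \<rho> x else x)"
    by (rule continuous_on_cases_le) (auto intro: continuous_on_coord \<rho>c continuous_on_id \<rho>id)
  then have "open ((\<lambda>x. if x 0 \<le> 0 then \<rho> x else x) -` U)" using U(1) by (rule open_vimage[rotated])
  then have D: "openin (top_of_set (Eucl d)) D"
    by (auto simp: openin_open D_def intro!: exI[of _ "(\<lambda>x. if x 0 \<le> 0 then \<rho> x else x) -` U"])
  define K where "K = (\<lambda>x. if x 0 \<le> 0 then \<rho> (k (\<rho> x)) else k x)"
  have Kneg: "K x = \<rho> (k (\<rho> x))" "\<rho> x \<in> W" "K x 0 \<le> 0" if "x \<in> D" "x 0 \<le> 0" for x
  proof -
    show "K x = \<rho> (k (\<rho> x))" using that by (simp add: K_def)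
    show w: "\<rho> x \<in> W" using that DW' by blast
    then have "0 \<le> k (\<rho> x) 0" using into by (auto simp: Half_def)
    then show "K x 0 \<le> 0" using that by (simp add: K_def \<rho>0)
  qed
  have Kpos: "K x = k x" "x \<in> W" "0 < K x 0" if "x \<in> D" "0 < x 0" for x
    using that DW[of x] pos[of x] by (auto simp: K_def)
  have "openin (top_of_set (Eucl d)) (K ` D)"
  proof (rule invariance_of_domain_Eucl[OF D])
    show "continuous_on D K"
      unfolding K_def
    proof (rule continuous_on_cases_le)
      have "continuous_on {x \<in> D. x 0 \<le> 0} (\<lambda>x. k (\<rho> x))"
        by (rule continuous_on_compose2[OF cont \<rho>c[OF continuous_on_id]]) (use DW' in auto)
      then show "continuous_on {x \<in> D. x 0 \<le> 0} (\<lambda>x. \<rho> (k (\<rho> x)))" by (rule \<rho>c)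
      show "continuous_on {x \<in> D. 0 \<le> x 0} k"
        by (rule continuous_on_subset[OF cont]) (use DW in auto)
      show "\<rho> (k (\<rho> x)) = k x" if "x \<in> D" "x 0 = 0" for x
        using that bdry[of x] DW[of x] by (simp add: \<rho>id)
    qed (rule continuous_on_coord)
    show "K ` D \<subseteq> Eucl d"
    proof
      fix y assume "y \<in> K ` D"
      then obtain x where x: "x \<in> D" "y = K x" by blast
      then show "y \<in> Eucl d"
        using Kneg[of x] Kpos[of x] into \<rho>E[of "k (\<rho> x)"] by (cases "x 0 \<le> 0") (auto simp: Half_def)
    qed
    show "inj_on K D"
    proof (rule inj_onI)
      fix x y assume xy: "x \<in> D" "y \<in> D" "K x = K y"
      show "x = y"
      proof (cases "x 0 \<le> 0"; cases "y 0 \<le> 0")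
        assume a: "x 0 \<le> 0" "y 0 \<le> 0"
        then have "k (\<rho> x) = k (\<rho> y)" using Kneg(1)[of x] Kneg(1)[of y] xy \<rho>\<rho> by metis
        then have "\<rho> x = \<rho> y" using Kneg(2)[of x] Kneg(2)[of y] xy a inj by (auto dest: inj_onD)
        then show ?thesis using \<rho>\<rho> by metis
      next
        assume a: "x 0 \<le> 0" "\<not> y 0 \<le> 0"
        then show ?thesis using Kneg(3)[of x] Kpos(3)[of y] xy by simp
      next
        assume a: "\<not> x 0 \<le> 0" "y 0 \<le> 0"
        then show ?thesis using Kneg(3)[of y] Kpos(3)[of x] xy by simp
      next
        assume a: "\<not> x 0 \<le> 0" "\<not> y 0 \<le> 0"
        then show ?thesis using Kpos[of x] Kpos[of y] xy inj by (auto dest: inj_onD)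
      qed
    qed
  qed
  then have "openin (top_of_set (Half d)) (Half d \<inter> K ` D)"
    by (auto simp: openin_open Half_def)
  moreover have "Half d \<inter> K ` D = k ` W"
  proof (intro equalityI subsetI)
    fix y assume "y \<in> Half d \<inter> K ` D"
    then obtain x where x: "x \<in> D" "y = K x" "0 \<le> y 0" by (auto simp: Half_def)
    show "y \<in> k ` W"
    proof (cases "x 0 \<le> 0")
      case True
      have "K x 0 = 0" using Kneg(3)[OF x(1) True] x by simp
      then have "k (\<rho> x) 0 = 0" using Kneg(1)[OF x(1) True] \<rho>0[of "k (\<rho> x)"] by simp
      then have "y = k (\<rho> x)" using Kneg(1)[OF x(1) True] x \<rho>id by simp
      then show ?thesis using Kneg(2)[OF x(1) True] by blast
    next
      case False
      then show ?thesis using Kpos[OF x(1)] x by auto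
    qed
  next
    fix y assume "y \<in> k ` W"
    then obtain x where x: "x \<in> W" "y = k x" by blast
    then have x0: "0 \<le> x 0" using U by (auto simp: Half_def)
    then have xD: "x \<in> D" using DW x by blast
    have "K x = k x"
    proof (cases "x 0 = 0")
      case True
      then show ?thesis using bdry[OF x(1)] by (simp add: K_def \<rho>id)
    next
      case False
      then show ?thesis using Kpos xD x0 by simp
    qed
    then have "y = K x" using x by simp
    then show "y \<in> Half d \<inter> K ` D" using x xD into by blast
  qed
  ultimately show ?thesis by simp
qed

text \<open>Openness is local, so the embedding may be read in a chart of \<open>M\<close>, where it
  becomes a map into a half-space. The openness of the image there is the point at which balls and
  half-balls differ; it is left as the hypothesis \<open>dom\<close>.\<close>

lemma openin_embedding_image:
  assumes M: "manifold_with_boundary d M" and emb: "embedding_map (top_of_set T) M p"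
    and dom: "\<And>U V g g' W. openin M U \<Longrightarrow> openin (top_of_set (Half d)) V \<Longrightarrow>
       homeomorphic_maps (subtopology M U) (top_of_set V) g g' \<Longrightarrow> W = {z \<in> T. p z \<in> U} \<Longrightarrow>
       openin (top_of_set T) W \<Longrightarrow> continuous_on W (g \<circ> p) \<Longrightarrow> (g \<circ> p) ` W \<subseteq> V \<Longrightarrow> inj_on (g \<circ> p) W \<Longrightarrow>
       openin (top_of_set (Half d)) ((g \<circ> p) ` W)"
  shows "openin M (p ` T)"
proof (subst openin_subopen, rule ballI)
  have cp: "continuous_map (top_of_set T) M p" and inj: "inj_on p T"
    using emb by (auto simp: embedding_map_def homeomorphic_eq_everything_map continuous_map_in_subtopology)
  have pM: "p z \<in> topspace M" if "z \<in> T" for z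
    using cp that by (auto simp: continuous_map_def Pi_iff)
  fix y assume "y \<in> p ` T"
  then obtain z0 where z0: "z0 \<in> T" "y = p z0" by blast
  then have "y \<in> topspace M" using pM by blast
  then obtain U V where U: "openin M U" "y \<in> U" and V: "openin (half_space d) V"
    and hom: "subtopology M U homeomorphic_space subtopology (half_space d) V"
    using M unfolding manifold_with_boundary_def by blast
  have V': "openin (top_of_set (Half d)) V" using V by (simp add: half_space_eq)
  then have VH: "V \<subseteq> Half d" using openin_subset by fastforce
  then have sub: "subtopology (half_space d) V = top_of_set V"
    by (simp add: half_space_eq subtopology_subtopology Int_absorb1)
  obtain g g' where g: "homeomorphic_maps (subtopology M U) (top_of_set V) g g'"
    using hom unfolding sub homeomorphic_space_def by blast
  have US: "U \<subseteq> topspace M" using U openin_subset by blast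
  have gm: "continuous_map (subtopology M U) (top_of_set V) g" "\<And>u. u \<in> U \<Longrightarrow> g' (g u) = u"
    using g US by (auto simp: homeomorphic_maps_def)
  define W where "W = {z \<in> T. p z \<in> U}"
  have W: "openin (top_of_set T) W"
    using openin_continuous_map_preimage[OF cp U(1)] by (simp add: W_def)
  have WT: "W \<subseteq> T" by (auto simp: W_def)
  have "continuous_map (top_of_set W) (subtopology M U) p"
    using continuous_map_from_subtopology[OF cp, of W] WT
    by (auto simp: continuous_map_in_subtopology subtopology_subtopology Int_absorb1 W_def)
  from continuous_map_compose[OF this gm(1)]
  have c: "continuous_on W (g \<circ> p)" "(g \<circ> p) ` W \<subseteq> V" by (auto simp: continuous_map_in_subtopology)
  have "inj_on (g \<circ> p) W"
  proof (rule inj_onI)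
    fix a b assume ab: "a \<in> W" "b \<in> W" "(g \<circ> p) a = (g \<circ> p) b"
    then have "p a \<in> U" "p b \<in> U" "g (p a) = g (p b)" by (simp_all add: W_def)
    then have "p a = p b" using gm(2) by metis
    then show "a = b" using inj_onD[OF inj] ab WT by blast
  qed
  then have o: "openin (top_of_set (Half d)) ((g \<circ> p) ` W)"
    using dom[OF U(1) V' g W_def W c] by blast
  then have "openin (top_of_set V) ((g \<circ> p) ` W)" using c(2) VH by (rule openin_subset_trans)
  then have "openin (subtopology M U) {u \<in> topspace (subtopology M U). g u \<in> (g \<circ> p) ` W}"
    by (rule openin_continuous_map_preimage[OF gm(1)])
  moreover have "{u \<in> topspace (subtopology M U). g u \<in> (g \<circ> p) ` W} = p ` W"
  proof (intro equalityI subsetI)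
    fix u assume "u \<in> {u \<in> topspace (subtopology M U). g u \<in> (g \<circ> p) ` W}"
    then obtain z where z: "u \<in> U" "z \<in> W" "g u = g (p z)" by auto
    moreover from this have "p z \<in> U" by (simp add: W_def)
    ultimately have "u = p z" using gm(2) by metis
    then show "u \<in> p ` W" using z by blast
  qed (use US in \<open>auto simp: W_def\<close>)
  ultimately have "openin (subtopology M U) (p ` W)" by simp
  then have "openin M (p ` W)" using U(1) by (rule openin_trans_full)
  moreover have "y \<in> p ` W" using z0 U by (auto simp: W_def)
  ultimately show "\<exists>A. openin M A \<and> y \<in> A \<and> A \<subseteq> p ` T" using WT by blast
qed

text \<open>Read in a chart, the image is open in Euclidean space by invariance of domain and lies
  in the half-space, so it is open there as well.\<close>

lemma openin_ball_chart:
  assumes M: "manifold_with_boundary d M" and emb: "embedding_map (top_of_set (Eucl d)) M p"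
  shows "openin M (p ` Eucl d)"
proof (rule openin_embedding_image[OF M emb])
  fix V W and k :: "(nat \<Rightarrow> real) \<Rightarrow> (nat \<Rightarrow> real)" and g
  assume V: "openin (top_of_set (Half d)) V" and W: "openin (top_of_set (Eucl d)) W"
    and k: "continuous_on W (g \<circ> p)" "(g \<circ> p) ` W \<subseteq> V" "inj_on (g \<circ> p) W"
  have VH: "V \<subseteq> Half d" using openin_subset[OF V] by simp
  have "openin (top_of_set (Eucl d)) ((g \<circ> p) ` W)"
    using W k VH by (intro invariance_of_domain_Eucl) (auto simp: Half_def)
  then show "openin (top_of_set (Half d)) ((g \<circ> p) ` W)"
    by (rule openin_subset_trans) (use k(2) VH in \<open>auto simp: Half_def\<close>)
qed

text \<open>The doubling argument requires that a chart of \<open>M\<close> sends images of points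
  with first coordinate 0 to such points again. Otherwise the image in \<open>M\<close> would have a
  Euclidean neighbourhood and be an interior point, against the hypothesis on the boundary.\<close>

lemma openin_half_ball_chart:
  assumes M: "manifold_with_boundary d M" and d: "0 < d"
    and emb: "embedding_map (top_of_set (Half d)) M p"
    and bdry: "p ` half_space_boundary d = p ` Half d \<inter> manifold_boundary d M"
  shows "openin M (p ` Half d)"
proof (rule openin_embedding_image[OF M emb])
  fix U V W g g'
  assume U: "openin M U" and V: "openin (top_of_set (Half d)) V"
    and g: "homeomorphic_maps (subtopology M U) (top_of_set V) g g'"
    and Wdef: "W = {z \<in> Half d. p z \<in> U}"
    and W: "openin (top_of_set (Half d)) W"
    and k: "continuous_on W (g \<circ> p)" "(g \<circ> p) ` W \<subseteq> V" "inj_on (g \<circ> p) W"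
  have VH: "V \<subseteq> Half d" using openin_subset[OF V] by simp
  have US: "U \<subseteq> topspace M" using U openin_subset by blast
  show "openin (top_of_set (Half d)) ((g \<circ> p) ` W)"
  proof (rule invariance_of_domain_Half[OF d W k(1) _ k(3)])
    show "(g \<circ> p) ` W \<subseteq> Half d" using k(2) VH by blast
    fix z assume z: "z \<in> W" "z 0 = 0"
    show "(g \<circ> p) z 0 = 0"
    proof (rule ccontr)
      assume n: "(g \<circ> p) z 0 \<noteq> 0"
      define V' where "V' = {v \<in> V. 0 < v 0}"
      have gz: "g (p z) \<in> V'" using n k(2) z VH by (force simp: V'_def Half_def)
      obtain O' where O': "open O'" "V = Half d \<inter> O'" using V by (auto simp: openin_open)
      have "open (O' \<inter> {x::nat \<Rightarrow> real. 0 < x 0})"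
        by (intro open_Int O' open_Collect_less continuous_intros)
      moreover have "V' = Eucl d \<inter> (O' \<inter> {x. 0 < x 0})" by (auto simp: V'_def O'(2) Half_def)
      ultimately have oV': "openin (Euclidean_space d) V'"
        unfolding Euclidean_space_eq by (auto simp: openin_open)
      then have V'E: "V' \<subseteq> Eucl d" using openin_subset unfolding Euclidean_space_eq by fastforce
      have oV: "openin (top_of_set V) V'"
        using oV' unfolding Euclidean_space_eq
        by (rule openin_subset_trans) (use VH in \<open>auto simp: V'_def Half_def\<close>)
      have cg: "continuous_map (subtopology M U) (top_of_set V) g" using g by (simp add: homeomorphic_maps_def)
      define U' where "U' = {u \<in> topspace (subtopology M U). g u \<in> V'}"
      have "openin (subtopology M U) U'" unfolding U'_def by (rule openin_continuous_map_preimage[OF cg oV])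
      then have oU': "openin M U'" using U by (rule openin_trans_full)
      have U'U: "U' \<subseteq> U" by (auto simp: U'_def)
      have "homeomorphic_maps (subtopology (subtopology M U) U') (subtopology (top_of_set V) V') g g'"
      proof (rule homeomorphic_maps_subtopologies_alt[OF g])
        show "g ` (topspace (subtopology M U) \<inter> U') \<subseteq> V'" by (auto simp: U'_def)
        show "g' ` (topspace (top_of_set V) \<inter> V') \<subseteq> U'"
          using g by (auto simp: U'_def homeomorphic_maps_def continuous_map_def Pi_iff)
      qed
      moreover have "subtopology (subtopology M U) U' = subtopology M U'"
        using U'U by (simp add: subtopology_subtopology Int_absorb1)
      moreover have "subtopology (top_of_set V) V' = subtopology (Euclidean_space d) V'"
        using V'E by (simp add: Euclidean_space_eq subtopology_subtopology V'_def Int_absorb1 Collect_conj_eq)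
      ultimately have "subtopology M U' homeomorphic_space subtopology (Euclidean_space d) V'"
        unfolding homeomorphic_space_def by auto
      moreover have "p z \<in> U'" using gz z US by (auto simp: U'_def Wdef)
      moreover have "p z \<in> topspace M" using z US by (auto simp: Wdef)
      ultimately have "p z \<in> manifold_interior d M"
        unfolding manifold_interior_def using oU' oV' by blast
      moreover have "z \<in> half_space_boundary d"
        using z by (simp add: half_space_boundary_def half_space_eq Wdef)
      ultimately show False using bdry by (auto simp: manifold_boundary_def)
    qed
  qed
qed

section \<open>Homeomorphisms supported in a ball or half-ball\<close>

lemma line_cone_Eucl: "0 < d \<Longrightarrow> line_cone d (Eucl d)"
  by (intro line_cone.intro line_cone_axioms.intro cone_Eucl) (auto simp: Eucl_def last_vec_def)

text \<open>The half-space constrains coordinate 0 only, and the direction of translation is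
  coordinate \<open>d - 1\<close>; they differ exactly because \<open>d > 1\<close>.\<close>

lemma line_cone_Half: "1 < d \<Longrightarrow> line_cone d (Half d)"
  by (intro line_cone.intro line_cone_axioms.intro cone_Half) (auto simp: Half_def Eucl_def last_vec_def)

lemma (in line_cone) realizable_unit_ball:
  "log_realizable (homeo_group d T) (ball_homeos d T)"
  using realizable_core unfolding core_def .

lemma realizable_half_ball:
  assumes "0 < d"
  shows "log_realizable (homeo_group d (Half d))
    (ball_homeos d (Half d))"
proof (cases "d = 1")
  case True
  have "Half 1 = half_line" by (auto simp: Half_def Eucl_def half_line_def)
  then show ?thesis using realizable_half_line True by simp
next
  case False
  then show ?thesis using assms by (intro line_cone.realizable_unit_ball line_cone_Half) simp
qed

lemma realizable_supported:
  assumes M: "manifold_with_boundary d M" and U: "closed_ball_of d M U \<or> closed_half_ball_of d M U"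
  shows "log_realizable (Homeo0 M) {h \<in> carrier (Homeo0 M). homeo_support M h \<subseteq> U}"
proof (cases "d = 0")
  case True
  \<comment> \<open>In dimension 0 balls and half-balls have at most one point, and the group of
    maps supported there is trivial.\<close>
  have ub: "unit_ball 0 \<subseteq> {\<lambda>_. 0}" by (auto simp: unit_ball_eq Eucl_def)
  from U obtain p B where "U = p ` B" "B \<subseteq> unit_ball 0"
    unfolding True closed_ball_of_def closed_half_ball_of_def by (metis Int_lower1 order_refl)
  then have "U \<subseteq> p ` {\<lambda>_. 0}" using ub by blast
  then obtain u where u: "U \<subseteq> {u}" by simp
  interpret G: group "Homeo0 M" by (rule group_Homeo0)
  have "h = \<one>\<^bsub>Homeo0 M\<^esub>" if h: "h \<in> carrier (Homeo0 M)" "homeo_support M h \<subseteq> U" for h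
  proof -
    have hB: "h \<in> Bij (topspace M)" using Homeo0_homeos[OF h(1)] homeos_Bij by blast
    have fix': "h x = x" if "x \<in> topspace M" "x \<noteq> u" for x
    proof (rule ccontr)
      assume "h x \<noteq> x"
      then have "x \<in> homeo_support M h"
        unfolding homeo_support_def using closure_of_subset[of "{x \<in> topspace M. h x \<noteq> x}" M] that by blast
      then show False using h u that by blast
    qed
    \<comment> \<open>A bijection that fixes every point other than \<open>u\<close> fixes
      \<open>u\<close> too.\<close>
    have "h x = x" if x: "x \<in> topspace M" for x
    proof (rule ccontr)
      assume n: "h x \<noteq> x"
      then have "h x \<noteq> u" using fix'[OF x] by metis
      have hx: "h x \<in> topspace M" by (rule homeos_into[OF Homeo0_homeos[OF h(1)] x])
      have "inj_on h (topspace M)" using hB by (simp add: Bij_def bij_betw_def)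
      from inj_onD[OF this fix'[OF hx \<open>h x \<noteq> u\<close>] hx x] show False using n by simp
    qed
    then have "h x = (\<lambda>x\<in>topspace M. x) x" for x
      using Bij_imp_extensional[OF hB] by (simp add: extensional_def)
    then show ?thesis unfolding one_Homeo0 by blast
  qed
  then have "{h \<in> carrier (Homeo0 M). homeo_support M h \<subseteq> U} \<subseteq> {\<one>\<^bsub>Homeo0 M\<^esub>}" by blast
  then show ?thesis by (rule log_realizable_subset[OF G.log_realizable_singleton[OF G.one_closed]])
next
  case False
  then have d: "0 < d" by simp
  have Hd: "Hausdorff_space M" using M by (simp add: manifold_with_boundary_def)
  from U show ?thesis
  proof
    assume "closed_ball_of d M U"
    then obtain p where p: "embedding_map (top_of_set (Eucl d)) M p" "U = p ` {x \<in> Eucl d. nrm d x \<le> 1}"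
      unfolding closed_ball_of_def Euclidean_space_eq unit_ball_eq by blast
    interpret chart d "Eucl d" M p
      by (intro chart.intro chart_axioms.intro cone_Eucl Hd p(1) openin_ball_chart[OF M])
    show ?thesis
      unfolding p(2) by (rule realizable_chart[OF line_cone.realizable_unit_ball[OF line_cone_Eucl[OF d]]])
  next
    assume "closed_half_ball_of d M U"
    then obtain p where p: "embedding_map (top_of_set (Half d)) M p"
      "p ` half_space_boundary d = p ` Half d \<inter> manifold_boundary d M"
      "U = p ` {x \<in> Half d. nrm d x \<le> 1}"
      unfolding closed_half_ball_of_def unit_half_ball_eq by (auto simp: half_space_eq)
    interpret chart d "Half d" M p
      by (intro chart.intro chart_axioms.intro cone_Half Hd p(1) openin_half_ball_chart[OF M d p(1,2)])
    show ?thesis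
      unfolding p(3) by (rule realizable_chart[OF realizable_half_ball[OF d]])
  qed
qed

section \<open>Fragmentations and the conclusion\<close>

lemma Frag_attained:
  assumes "Frag M \<U> g = enat m"
  obtains fs where "length fs = m" "set fs \<subseteq> carrier (Homeo0 M)"
    "\<forall>h\<in>set fs. \<exists>U\<in>\<U>. homeo_support M h \<subseteq> U" "g = foldr (\<otimes>\<^bsub>Homeo0 M\<^esub>) fs \<one>\<^bsub>Homeo0 M\<^esub>"
proof -
  define A where "A = (\<lambda>fs. enat (length fs)) ` {fs. set fs \<subseteq> carrier (Homeo0 M) \<and>
        (\<forall>h\<in>set fs. \<exists>U\<in>\<U>. homeo_support M h \<subseteq> U) \<and> g = foldr (\<otimes>\<^bsub>Homeo0 M\<^esub>) fs \<one>\<^bsub>Homeo0 M\<^esub>}"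
  have I: "Inf A = enat m" using assms by (simp add: Frag_def A_def)
  then have "A \<noteq> {}" by (auto simp: Inf_enat_def)
  then obtain a where "a \<in> A" by blast
  then have "(LEAST x. x \<in> A) \<in> A" by (rule LeastI[of "\<lambda>x. x \<in> A"])
  then have "enat m \<in> A" using I \<open>A \<noteq> {}\<close> by (simp add: Inf_enat_def)
  then obtain fs where "enat m = enat (length fs)" "set fs \<subseteq> carrier (Homeo0 M)"
    "\<forall>h\<in>set fs. \<exists>U\<in>\<U>. homeo_support M h \<subseteq> U" "g = foldr (\<otimes>\<^bsub>Homeo0 M\<^esub>) fs \<one>\<^bsub>Homeo0 M\<^esub>"
    unfolding A_def by (elim imageE CollectE conjE)
  then show ?thesis by (intro that[of fs]) simp_all
qed

theorem theorem2p5: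
  fixes M :: "'a topology" and d :: nat and \<U> :: "'a set set" and f :: "'a \<Rightarrow> 'a"
  assumes "manifold_with_boundary d M" and "compact_space M"
    and "finite \<U>"
    and "\<And>U. U \<in> \<U> \<Longrightarrow> closed_ball_of d M U \<or> closed_half_ball_of d M U"
    and "(\<Union>U\<in>\<U>. M interior_of U) = topspace M"
    and "f \<in> carrier (Homeo0 M)"
    and "(\<lambda>n. xlogx (Frag M \<U> (f [^]\<^bsub>Homeo0 M\<^esub> n)) / ereal (real n)) \<longlonglongrightarrow> 0"
  shows "distortion_element (Homeo0 M) f"
proof -
  interpret G: group "Homeo0 M" by (rule group_Homeo0)
  define P where "P = (\<Union>U\<in>\<U>. {h \<in> carrier (Homeo0 M). homeo_support M h \<subseteq> U})"
  have P: "log_realizable (Homeo0 M) P"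
    unfolding P_def by (rule G.log_realizable_UN[OF assms(3)]) (rule realizable_supported[OF assms(1) assms(4)])
  define F where "F = (\<lambda>n::nat. Frag M \<U> (f [^]\<^bsub>Homeo0 M\<^esub> n))"
  have "\<forall>\<^sub>F n in sequentially. xlogx (F n) / ereal (real n) < 1"
    using order_tendstoD(2)[OF assms(7), of 1] by (simp add: F_def)
  \<comment> \<open>An infinite fragmentation length would make the quotient infinite, so the limit
    itself provides decompositions for all large \<open>n\<close>.\<close>
  then have fin: "\<forall>\<^sub>F n in sequentially. \<exists>m. F n = enat m"
    using eventually_gt_at_top[of 0]
  proof eventually_elim
    case (elim n)
    show ?case
    proof (cases "F n")
      case infinity
      then show ?thesis using elim by (simp add: xlogx_def)
    qed blast
  qed
  define good where "good = (\<lambda>n fs. F n = enat (length fs) \<and> set fs \<subseteq> P \<and>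
      f [^]\<^bsub>Homeo0 M\<^esub> n = foldr (\<otimes>\<^bsub>Homeo0 M\<^esub>) fs \<one>\<^bsub>Homeo0 M\<^esub>)"
  \<comment> \<open>A shortest decomposition for every large \<open>n\<close>; at the remaining
    \<open>n\<close> the choice is arbitrary, which no limit sees.\<close>
  define fs where "fs = (\<lambda>n. SOME fs. good n fs)"
  have ev: "\<forall>\<^sub>F n in sequentially. good n (fs n)"
    using fin
  proof eventually_elim
    case (elim n)
    then obtain m where m: "F n = enat m" by blast
    then have "Frag M \<U> (f [^]\<^bsub>Homeo0 M\<^esub> n) = enat m" by (simp add: F_def)
    then obtain gs where "length gs = m" "set gs \<subseteq> carrier (Homeo0 M)"
      "\<forall>h\<in>set gs. \<exists>U\<in>\<U>. homeo_support M h \<subseteq> U" "f [^]\<^bsub>Homeo0 M\<^esub> n = foldr (\<otimes>\<^bsub>Homeo0 M\<^esub>) gs \<one>\<^bsub>Homeo0 M\<^esub>"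
      by (rule Frag_attained)
    then have "good n gs" using m by (auto simp: good_def P_def)
    then show ?case unfolding fs_def by (rule someI)
  qed
  show ?thesis
  proof (rule G.distortion_elementI[OF P assms(6), where fs = fs])
    show "\<forall>\<^sub>F n in sequentially. set (fs n) \<subseteq> P \<and>
        f [^]\<^bsub>Homeo0 M\<^esub> n = foldr (\<otimes>\<^bsub>Homeo0 M\<^esub>) (fs n) \<one>\<^bsub>Homeo0 M\<^esub>"
      using ev by eventually_elim (simp add: good_def)
    have "\<forall>\<^sub>F n in sequentially. xlogx (F n) / ereal (real n)
        = ereal (real (length (fs n)) * ln (real (length (fs n))) / real n)"
      using ev eventually_gt_at_top[of 0] by eventually_elim (simp add: good_def xlogx_def)
    moreover have "(\<lambda>n. xlogx (F n) / ereal (real n)) \<longlonglongrightarrow> 0"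
      using assms(7) by (simp only: F_def)
    ultimately have "(\<lambda>n. ereal (real (length (fs n)) * ln (real (length (fs n))) / real n)) \<longlonglongrightarrow> 0"
      by (rule Lim_transform_eventually[rotated])
    then show "(\<lambda>n. real (length (fs n)) * ln (real (length (fs n))) / real n) \<longlonglongrightarrow> 0"
      by (simp add: zero_ereal_def)
  qed
qed

end
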